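(* Fix $t\in(0,1)$. Consider any sequence $s_n\to\infty$ (of positive integers) with $s_n/n\to0$ and any sequence $v_n\to\infty$. Let $\varphi^{q\text{-val}}$ be the $q$-value procedure at level $t$. (i) As $n\to\infty$, $$\sup_{\theta_0\in \ell_0(s_n;v_n)}\bigl|\mathrm{FDR}(\varphi^{q\text{-val}};\theta_0)-t\bigr|\to 0,\qquad \sup_{\theta_0\in \ell_0(s_n;v_n)}\mathrm{FNR}(\varphi^{q\text{-val}};\theta_0)\to 0.$$ (ii) Assume also that $s_n\ge(\log n)^3$ and $v_n\ge 3(\log\log(n/s_n))^{1/2}$. Then there exist constants $c,C,C'>0$ depending on $t$ such that, uniformly over $\theta_0\in\ell_0(s_n;v_n)$, for all $n$ large enough, $$c\,\frac{\log\log(n/s_n)}{\log(n/s_n)}\le \mathrm{FDR}(\varphi^{q\text{-val}};\theta_0)-t\le C\,\frac{\log\log(n/s_n)}{\log(n/s_n)},$$ $$\mathrm{FNR}(\varphi^{q\text{-val}};\theta_0)\le C'\bigl(\log(n/s_n)\bigr)^{-1}.$$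
   Context: Model: for each $n$ one observes $X=(X_1,\dots,X_n)$ with $X_i=\theta_{0,i}+\varepsilon_i$, $\varepsilon_i$ iid $\mathcal N(0,1)$, $\theta_0\in\mathbb R^n$ deterministic; $P_{\theta_0},E_{\theta_0}$ denote the law of $X$ and its expectation. Signal class: with $S_0=\{i:\theta_{0,i}\ne0\}$, $$\ell_0(s_n;v_n)=\{\theta_0\in\mathbb R^n: |S_0|=s_n,\ |\theta_{0,i}|\ge\sqrt{2\log(n/s_n)}+v_n\ \text{for all } i\in S_0\}.$$ Error rates: for a procedure $\varphi=\varphi(X)\in\{0,1\}^n$, $$\mathrm{FDR}(\varphi;\theta_0)=E_{\theta_0}\Bigl[\frac{\sum_{i=1}^n \mathbf 1\{\theta_{0,i}=0,\varphi_i=1\}}{1\vee\sum_{i=1}^n\varphi_i}\Bigr],\quad \mathrm{FNR}(\varphi;\theta_0)=E_{\theta_0}\Bigl[\frac{\sum_{i=1}^n\mathbf 1\{\theta_{0,i}\neq0,\varphi_i=0\}}{1\vee\sum_{i=1}^n\mathbf 1\{\theta_{0,i}\ne0\}}\Bigr].$$ Procedure: let $\phi$ be the standard normal density, $g(x)=(2\pi)^{-1/2}x^{-2}(1-e^{-x^2/2})$ (extended continuously at $0$; this is a probability density), and $\overline\Phi(x)=\int_x^\infty\phi$, $\overline G(x)=\int_x^\infty g$. Let $\hat w=\operatorname{argmax}_{w\in[1/n,1]}\sum_{i=1}^n\log\bigl((1-w)\phi(X_i)+wg(X_i)\bigr)$ (which exists almost surely). The $q$-values are $$q_{i,w}(X)=\frac{(1-w)\overline\Phi(|X_i|)}{(1-w)\overline\Phi(|X_i|)+w\overline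 G(|X_i|)},$$ and the $q$-value procedure at level $t$ is $\varphi^{q\text{-val}}=(\mathbf 1\{q_{i,\hat w}(X)<t\})_{1\le i\le n}$. *)

theory Defs
  imports "HOL-Probability.Probability"
begin

(* A vector of R^n is a function in {1..n} \<rightarrow>\<^sub>E UNIV, the space of Pi_M {1..n} (\<lambda>_. borel). *)

definition data_law :: "nat \<Rightarrow> (nat \<Rightarrow> real) \<Rightarrow> (nat \<Rightarrow> real) measure" where
  "data_law n \<theta> =
     distr (Pi\<^sub>M {1..n} (\<lambda>_. density lborel std_normal_density)) (Pi\<^sub>M {1..n} (\<lambda>_. borel))
       (\<lambda>\<epsilon>. \<lambda>i\<in>{1..n}. \<theta> i + \<epsilon> i)"

definition signal_class :: "nat \<Rightarrow> nat \<Rightarrow> real \<Rightarrow> (nat \<Rightarrow> real) set" where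
  "signal_class n s v =
     {\<theta> \<in> {1..n} \<rightarrow>\<^sub>E UNIV.
        card {i \<in> {1..n}. \<theta> i \<noteq> 0} = s \<and>
        (\<forall>i \<in> {i \<in> {1..n}. \<theta> i \<noteq> 0}. \<bar>\<theta> i\<bar> \<ge> sqrt (2 * ln (real n / real s)) + v)}"

(* A procedure maps the observation to its set of rejections, given as a predicate on {1..n}. *)

definition FDR :: "nat \<Rightarrow> ((nat \<Rightarrow> real) \<Rightarrow> nat \<Rightarrow> bool) \<Rightarrow> (nat \<Rightarrow> real) \<Rightarrow> real" where
  "FDR n \<phi> \<theta> =
     (\<integral>X. (\<Sum>i=1..n. of_bool (\<theta> i = 0 \<and> \<phi> X i)) / max 1 (\<Sum>i=1..n. of_bool (\<phi> X i))
        \<partial>data_law n \<theta>)"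

definition FNR :: "nat \<Rightarrow> ((nat \<Rightarrow> real) \<Rightarrow> nat \<Rightarrow> bool) \<Rightarrow> (nat \<Rightarrow> real) \<Rightarrow> real" where
  "FNR n \<phi> \<theta> =
     (\<integral>X. (\<Sum>i=1..n. of_bool (\<theta> i \<noteq> 0 \<and> \<not> \<phi> X i)) / max 1 (\<Sum>i=1..n. of_bool (\<theta> i \<noteq> 0))
        \<partial>data_law n \<theta>)"

(* The value at 0 is the continuous extension: (1 - exp (- x\<^sup>2 / 2)) / x\<^sup>2 tends to 1 / 2. *)
definition slab_density :: "real \<Rightarrow> real" where
  "slab_density x =
     1 / sqrt (2 * pi) * (if x = 0 then 1 / 2 else (1 - exp (- x\<^sup>2 / 2)) / x\<^sup>2)"

definition normal_tail :: "real \<Rightarrow> real" where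
  "normal_tail x = (LBINT y:{x..}. std_normal_density y)"

definition slab_tail :: "real \<Rightarrow> real" where
  "slab_tail x = (LBINT y:{x..}. slab_density y)"

(* For n \<ge> 1 the objective is continuous on [1/n, 1], and strictly concave unless the standard
   normal and slab densities agree at every X i. They agree only at two points x, -x, so the
   choice made by arg_max_on concerns finitely many observations X. *)
definition w_hat :: "nat \<Rightarrow> (nat \<Rightarrow> real) \<Rightarrow> real" where
  "w_hat n X =
     arg_max_on (\<lambda>w. \<Sum>i=1..n. ln ((1 - w) * std_normal_density (X i) + w * slab_density (X i)))
       {1 / real n..1}"

definition q_value :: "real \<Rightarrow> real \<Rightarrow> real" where
  "q_value w x =
     (1 - w) * normal_tail \<bar>x\<bar> / ((1 - w) * normal_tail \<bar>x\<bar> + w * slab_tail \<bar>x\<bar>)"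

definition q_value_procedure :: "nat \<Rightarrow> real \<Rightarrow> (nat \<Rightarrow> real) \<Rightarrow> nat \<Rightarrow> bool" where
  "q_value_procedure n t X i \<longleftrightarrow> q_value (w_hat n X) (X i) < t"

end

theory Submission
  imports Defs "HOL-Real_Asymp.Real_Asymp"
begin

text \<open>Write \<open>\<phi>\<close> and \<open>g\<close> for the null and slab densities, \<open>H x = x * g x\<close> and \<open>\<beta> = g / \<phi> - 1\<close>. Since
  \<open>H' = \<phi> - g\<close>, the slab tail exceeds the normal tail by exactly \<open>H\<close>. Hence the \<open>q\<close>-value with weight
  \<open>w\<close> rejects beyond the point \<open>\<xi>\<close> at which \<open>(1 - t - w)\<close> times the normal tail equals \<open>t * w * H \<xi>\<close>,
  and it rejects a null with probability \<open>2 * t * w * H \<xi> / (1 - t - w)\<close>.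

  In the score of the marginal likelihood a strong signal contributes about \<open>1 / w\<close> and a null has mean
  \<open>- m w\<close>, so the fitted weight nearly solves \<open>(n - s) * w * m w = s\<close>. The ratio of false to
  true discoveries is therefore close to \<open>t / (1 - t) * (2 * H \<xi> / m w)\<close>. The drift \<open>m w\<close> is close to \<open>2 * H \<zeta>\<close>
  with \<open>w * \<beta> \<zeta> = 1\<close>, and \<open>\<zeta> / \<xi> - 1\<close> is of exact order \<open>ln (ln (1 / w)) / ln (1 / w)\<close>, as
  \<open>g / \<phi>\<close> and the ratio of the tails differ by a factor of order \<open>x\<^sup>2\<close>. This is the bias in part (ii).

  Chebyshev's inequality for the score localises the fitted weight up to a relative error \<open>\<delta>\<close> outside an
  event of probability of order \<open>1 / (s * \<delta>\<^sup>2)\<close>; with \<open>\<delta> = 1 / ln (n / s)\<close> the condition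
  \<open>s \<ge> (ln n) ^ 3\<close> makes both negligible. The false discovery proportion is monotone in the weight, so
  it may be evaluated at two deterministic weights.\<close>

section \<open>The null and slab densities\<close>

text \<open>With \<open>L = ln (n / s)\<close>, the bias is only of order \<open>ln L / L\<close>,
  so for the lower bound of part (ii) every other relative error must be of smaller order, and the
  drift must be known up to that accuracy. This is feasible because one function,
  \<open>tail_gap\<close>, governs both sides: it gives the rejection probability at the threshold,
  and it is the outer part of the drift. Each bound on the bias thus compares two values of
  \<open>tail_gap\<close>, which behaves like a constant over \<open>x\<close>, at points whose
  squares differ by a multiple of \<open>ln L\<close>. The bias is positive because the point
  belonging to the drift lies farther out.

  The fitted weight is never expanded in \<open>n\<close> and \<open>s\<close>. The two
  deterministic weights are defined implicitly, by prescribing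
  \<open>(n - s) * (w * null_drift w)\<close> as \<open>s\<close> times a number close to 1; the
  expected number of false discoveries there is then \<open>t / (1 - t) * s\<close> times that
  number, up to the bias. Of the weight itself only \<open>L / 2 \<le> - ln w \<le> 2 * L\<close>
  enters.\<close>

abbreviation gauss :: "real \<Rightarrow> real" where
  "gauss \<equiv> std_normal_density"

lemma gauss_def: "gauss x = 1 / sqrt (2 * pi) * exp (- x\<^sup>2 / 2)"
  by (rule std_normal_density_def)

lemma gauss_pos: "0 < gauss x"
  by (simp add: normal_density_pos)

lemma gauss_minus [simp]: "gauss (- x) = gauss x"
  by (simp add: gauss_def)

lemma continuous_on_gauss: "continuous_on A gauss"
  unfolding gauss_def[abs_def] by (intro continuous_intros) auto

lemma isCont_gauss: "isCont gauss x"
  using continuous_on_gauss[of UNIV] by (simp add: continuous_on_eq_continuous_at)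

lemma DERIV_gauss: "(gauss has_real_derivative - x * gauss x) (at x)"
  unfolding gauss_def[abs_def] by (auto intro!: derivative_eq_intros simp: field_simps real_sqrt_mult)

lemma gauss_tendsto_0: "(gauss \<longlongrightarrow> 0) at_top"
  unfolding gauss_def[abs_def] by real_asymp

lemma gauss_antimono: "\<bar>x\<bar> \<le> \<bar>y\<bar> \<Longrightarrow> gauss y \<le> gauss x"
  unfolding gauss_def by (simp add: abs_le_square_iff divide_right_mono)

section \<open>The likelihood ratio of slab to null\<close>

definition lik_ratio :: "real \<Rightarrow> real" where
  "lik_ratio x = (if x = 0 then 1 / 2 else (exp (x\<^sup>2 / 2) - 1) / x\<^sup>2)"

lemma lik_ratio_minus [simp]: "lik_ratio (- x) = lik_ratio x"
  by (simp add: lik_ratio_def)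

lemma lik_ratio_abs [simp]: "lik_ratio \<bar>x\<bar> = lik_ratio x"
  by (simp add: lik_ratio_def)

lemma slab_density_eq: "slab_density x = lik_ratio x * gauss x"
  by (auto simp: slab_density_def lik_ratio_def gauss_def field_simps exp_minus)

lemma slab_density_minus [simp]: "slab_density (- x) = slab_density x"
  by (simp add: slab_density_eq)

lemma lik_ratio_ge_half: "1 / 2 \<le> lik_ratio x"
proof (cases "x = 0")
  case False
  have "x\<^sup>2 / 2 \<le> exp (x\<^sup>2 / 2) - 1"
    using exp_ge_add_one_self[of "x\<^sup>2 / 2"] by linarith
  then show ?thesis
    using False by (simp add: lik_ratio_def field_simps)
qed (simp add: lik_ratio_def)

lemma lik_ratio_pos: "0 < lik_ratio x"
  using lik_ratio_ge_half[of x] by linarith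

lemma slab_density_pos: "0 < slab_density x"
  by (simp add: slab_density_eq lik_ratio_pos gauss_pos)

text \<open>Slopes of chords of a convex function from a fixed point increase. For
  \<open>x \<noteq> 0\<close>, \<open>lik_ratio x\<close> is half such a slope of
  \<open>exp\<close>, taken at \<open>x\<^sup>2 / 2\<close>, hence increasing in
  \<bar>x\<bar>.\<close>

lemma exp_slope_mono:
  fixes u v :: real
  assumes "0 < u" "u \<le> v"
  shows "(exp u - 1) / u \<le> (exp v - 1) / v"
proof -
  have "exp ((1 - u / v) *\<^sub>R 0 + (u / v) *\<^sub>R v) \<le> (1 - u / v) * exp 0 + (u / v) * exp v"
    using assms by (intro convex_onD[OF exp_convex]) (auto simp: field_simps)
  then have "exp u - 1 \<le> (u / v) * (exp v - 1)"
    using assms by (simp add: right_diff_distrib left_diff_distrib)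
  then have "(exp u - 1) / u \<le> ((u / v) * (exp v - 1)) / u"
    using assms by (intro divide_right_mono) auto
  then show ?thesis
    using assms by simp
qed

lemma lik_ratio_mono:
  assumes "\<bar>x\<bar> \<le> \<bar>y\<bar>"
  shows "lik_ratio x \<le> lik_ratio y"
proof (cases "x = 0")
  case True
  then show ?thesis using lik_ratio_ge_half[of y] by (simp add: lik_ratio_def)
next
  case False
  moreover have "x\<^sup>2 / 2 \<le> y\<^sup>2 / 2"
    using assms by (simp add: abs_le_square_iff)
  ultimately have "(exp (x\<^sup>2 / 2) - 1) / (x\<^sup>2 / 2) \<le> (exp (y\<^sup>2 / 2) - 1) / (y\<^sup>2 / 2)"
    by (intro exp_slope_mono) auto
  then show ?thesis
    using False assms by (auto simp: lik_ratio_def field_simps)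
qed

lemma isCont_lik_ratio: "isCont lik_ratio x"
proof (cases "x = 0")
  case True
  have "((\<lambda>x::real. (exp (x\<^sup>2 / 2) - 1) / x\<^sup>2) \<longlongrightarrow> 1 / 2) (at 0)"
    by real_asymp
  then have "(lik_ratio \<longlongrightarrow> 1 / 2) (at 0)"
    by (rule Lim_transform_eventually) (auto simp: lik_ratio_def eventually_at_filter)
  then show ?thesis
    using True by (simp add: isCont_def lik_ratio_def)
next
  case False
  have "isCont (\<lambda>x::real. (exp (x\<^sup>2 / 2) - 1) / x\<^sup>2) x"
    using False by (intro continuous_intros) auto
  moreover have "\<forall>\<^sub>F y in nhds x. lik_ratio y = (exp (y\<^sup>2 / 2) - 1) / y\<^sup>2"
    using False by (rule eventually_mono[OF t1_space_nhds]) (auto simp: lik_ratio_def)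
  ultimately show ?thesis
    by (subst isCont_cong) auto
qed

lemma continuous_on_lik_ratio: "continuous_on A lik_ratio"
  using isCont_lik_ratio by (simp add: continuous_at_imp_continuous_on)

lemma lik_ratio_measurable [measurable]: "lik_ratio \<in> borel_measurable borel"
  by (intro borel_measurable_continuous_onI continuous_on_lik_ratio)

lemma isCont_slab_density: "isCont slab_density x"
  unfolding slab_density_eq[abs_def] by (intro continuous_intros isCont_lik_ratio isCont_gauss)

lemma slab_density_measurable [measurable]: "slab_density \<in> borel_measurable borel"
  unfolding slab_density_eq[abs_def] by measurable

text \<open>The excess of the slab tail over the normal tail: see \<open>slab_tail_eq\<close>.\<close>
definition tail_gap :: "real \<Rightarrow> real" where
  "tail_gap x = x * slab_density x"

lemma tail_gap_eq: "x \<noteq> 0 \<Longrightarrow> tail_gap x = 1 / sqrt (2 * pi) * (1 - exp (- x\<^sup>2 / 2)) / x"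
  by (simp add: tail_gap_def slab_density_def field_simps power2_eq_square)

lemma isCont_tail_gap: "isCont tail_gap x"
  unfolding tail_gap_def[abs_def] by (intro continuous_intros isCont_slab_density)

lemma tail_gap_nonneg: "0 \<le> x \<Longrightarrow> 0 \<le> tail_gap x"
  using slab_density_pos[of x] by (simp add: tail_gap_def)

lemma DERIV_tail_gap: "(tail_gap has_real_derivative gauss x - slab_density x) (at x)"
proof (cases "x = 0")
  case True
  have "((\<lambda>h. slab_density (0 + h)) \<longlongrightarrow> slab_density 0) (at 0)"
    using isCont_slab_density[of 0] by (simp add: isCont_def)
  then have "((\<lambda>h. (tail_gap (0 + h) - tail_gap 0) / h) \<longlongrightarrow> slab_density 0) (at 0)"
    by (rule Lim_transform_eventually) (auto simp: tail_gap_def eventually_at_filter)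
  \<comment> \<open>The difference quotient at 0 is the slab density itself; it agrees with the
    general formula because \<open>lik_ratio\<close> is \<open>1 / 2\<close> there, so
    \<open>gauss 0\<close> is twice \<open>slab_density 0\<close>.\<close>
  moreover have "slab_density 0 = gauss 0 - slab_density 0"
    by (simp add: slab_density_eq lik_ratio_def)
  ultimately show ?thesis
    using True unfolding DERIV_def by metis
next
  case False
  have "((\<lambda>x. 1 / sqrt (2 * pi) * (1 - exp (- x\<^sup>2 / 2)) / x) has_real_derivative gauss x - slab_density x) (at x)"
  proof -
    have "((\<lambda>x. c * (1 - exp (- x\<^sup>2 / 2)) / x) has_real_derivative
        c * exp (- x\<^sup>2 / 2) - c * ((1 - exp (- x\<^sup>2 / 2)) / x\<^sup>2)) (at x)" for c
      using False by (auto intro!: derivative_eq_intros simp: field_simps power2_eq_square)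
    from this[of "1 / sqrt (2 * pi)"] show ?thesis
      using False by (simp add: slab_density_def gauss_def)
  qed
  moreover have "\<forall>\<^sub>F y in nhds x. tail_gap y = 1 / sqrt (2 * pi) * (1 - exp (- y\<^sup>2 / 2)) / y"
    using False by (rule eventually_mono[OF t1_space_nhds]) (auto simp: tail_gap_eq)
  ultimately show ?thesis
    using False by (subst DERIV_cong_ev[where g="\<lambda>x. 1 / sqrt (2 * pi) * (1 - exp (- x\<^sup>2 / 2)) / x"]) auto
qed

lemma tail_gap_tendsto_0: "(tail_gap \<longlongrightarrow> 0) at_top"
proof -
  have "((\<lambda>x. 1 / sqrt (2 * pi) * (1 - exp (- x\<^sup>2 / 2)) / x) \<longlongrightarrow> (0::real)) at_top"
    by real_asymp
  then show ?thesis
    by (rule Lim_transform_eventually)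
       (auto simp: tail_gap_eq intro: eventually_mono[OF eventually_gt_at_top[of 0]])
qed

lemma inverse_sqrt_2pi_le: "1 / sqrt (2 * pi) \<le> 1 / 2"
proof -
  have "2 \<le> sqrt (2 * pi)"
    using pi_gt3 by (intro real_le_rsqrt) auto
  then show ?thesis by (simp add: field_simps)
qed

lemma tail_gap_upper:
  assumes "0 < x"
  shows "tail_gap x \<le> 1 / sqrt (2 * pi) / x"
  using assms by (simp add: tail_gap_eq field_simps)

text \<open>For large \<open>x\<close> this loses a factor 2 against \<open>tail_gap_upper\<close>,
  but it has the denominator \<open>1 + x\<close> of \<open>normal_tail_lower\<close>, so that the
  two cancel in \<open>threshold_exp_le\<close> at every positive threshold.\<close>

lemma tail_gap_upper':
  assumes "0 \<le> x"
  shows "tail_gap x \<le> 2 / sqrt (2 * pi) / (1 + x)"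
proof (cases "x = 0")
  case True
  then show ?thesis by (simp add: tail_gap_def)
next
  case False
  have "(1 - exp (- x\<^sup>2 / 2)) * (1 + x) \<le> 2 * x"
  proof (cases "x \<le> 1")
    case True
    have "1 - exp (- x\<^sup>2 / 2) \<le> x\<^sup>2 / 2"
      using exp_ge_add_one_self[of "- x\<^sup>2 / 2"] by simp
    then have "(1 - exp (- x\<^sup>2 / 2)) * (1 + x) \<le> x\<^sup>2 / 2 * 2"
      using True assms by (intro mult_mono) auto
    also have "\<dots> \<le> 2 * x"
      using True assms mult_left_le[of x x] by (simp add: power2_eq_square)
    finally show ?thesis .
  next
    case False
    have "(1 - exp (- x\<^sup>2 / 2)) * (1 + x) \<le> 1 * (2 * x)"
      using False by (intro mult_mono) auto
    then show ?thesis by simp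
  qed
  then have "(1 - exp (- x\<^sup>2 / 2)) / x \<le> 2 / (1 + x)"
    using False assms by (simp add: field_simps)
  then have "1 / sqrt (2 * pi) * ((1 - exp (- x\<^sup>2 / 2)) / x) \<le> 1 / sqrt (2 * pi) * (2 / (1 + x))"
    by (intro mult_left_mono) auto
  then show ?thesis
    using False assms by (simp add: tail_gap_eq)
qed

section \<open>Gaussian and slab tails\<close>

lemma has_bochner_integral_FTC_atLeast:
  fixes f F :: "real \<Rightarrow> real"
  assumes [measurable]: "f \<in> borel_measurable borel"
  assumes "\<And>x. a \<le> x \<Longrightarrow> DERIV F x :> f x" and nn: "\<And>x. a \<le> x \<Longrightarrow> 0 \<le> f x"
    and lim: "(F \<longlongrightarrow> T) at_top"
  shows "has_bochner_integral lborel (\<lambda>x. indicator {a..} x * f x) (T - F a)"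
proof (rule has_bochner_integral_nn_integral)
  have F_mono: "a \<le> x \<Longrightarrow> F a \<le> F x" for x
    using assms by (intro DERIV_nonneg_imp_nondecreasing[of a x F]) (auto intro: order_trans)
  then show "0 \<le> T - F a"
    using tendsto_lowerbound[OF lim, of "F a"] by (auto simp: eventually_at_top_linorder)
  have "(\<integral>\<^sup>+x. ennreal (indicator {a..} x * f x) \<partial>lborel) = (\<integral>\<^sup>+x. ennreal (f x) * indicator {a..} x \<partial>lborel)"
    by (intro nn_integral_cong) (auto split: split_indicator)
  also have "\<dots> = ennreal (T - F a)"
    using assms by (intro nn_integral_FTC_atLeast) auto
  finally show "(\<integral>\<^sup>+x. ennreal (indicator {a..} x * f x) \<partial>lborel) = ennreal (T - F a)" .
qed (auto simp: nn split: split_indicator)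

lemma normal_tail_alt: "normal_tail x = (\<integral>y. indicator {x..} y * gauss y \<partial>lborel)"
  by (simp add: normal_tail_def set_lebesgue_integral_def)

lemma slab_tail_alt: "slab_tail x = (\<integral>y. indicator {x..} y * slab_density y \<partial>lborel)"
  by (simp add: slab_tail_def set_lebesgue_integral_def)

lemma integrable_gauss_indicator [simp]: "A \<in> sets borel \<Longrightarrow> integrable lborel (\<lambda>y. indicator A y * gauss y)"
  using integrable_mult_indicator[of A lborel gauss] by simp

lemma normal_tail_diff:
  assumes "x \<le> y"
  shows "normal_tail x - normal_tail y = (\<integral>u. indicator {x..<y} u * gauss u \<partial>lborel)"
  unfolding normal_tail_alt using assms
  by (subst Bochner_Integration.integral_diff[symmetric], simp, simp)
     (intro Bochner_Integration.integral_cong refl, auto split: split_indicator)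

lemma normal_tail_antimono: "x \<le> y \<Longrightarrow> normal_tail y \<le> normal_tail x"
proof -
  assume "x \<le> y"
  moreover have "0 \<le> (\<integral>u. indicator {x..<y} u * gauss u \<partial>lborel)"
    by (intro Bochner_Integration.integral_nonneg) auto
  ultimately show ?thesis
    using normal_tail_diff[of x y] by linarith
qed

lemma normal_tail_nonneg: "0 \<le> normal_tail x"
  unfolding normal_tail_alt by (intro Bochner_Integration.integral_nonneg) auto

text \<open>From \<open>x\<close> to \<open>x + 1 / (1 + x)\<close> the exponent of the density
  changes by at most \<open>3 / 2\<close>. The tail is at least the width of this interval times the
  density at its right end.\<close>

lemma normal_tail_lower:
  assumes "0 \<le> x"
  shows "exp (- 3 / 2) * gauss x / (1 + x) \<le> normal_tail x"
proof -
  define y where "y = x + 1 / (1 + x)"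
  have "x \<le> y" using assms by (simp add: y_def)
  have "y\<^sup>2 = x\<^sup>2 + 2 * x / (1 + x) + 1 / (1 + x)\<^sup>2"
    by (simp add: y_def power2_sum power_divide)
  also have "\<dots> \<le> x\<^sup>2 + 2 + 1"
    using assms by (intro add_mono) (auto simp: field_simps)
  finally have "exp (- 3 / 2) * exp (- x\<^sup>2 / 2) \<le> exp (- y\<^sup>2 / 2)"
    by (simp flip: exp_add)
  then have g: "exp (- 3 / 2) * gauss x \<le> gauss y"
    by (simp add: gauss_def field_simps)
  have "exp (- 3 / 2) * gauss x / (1 + x) \<le> gauss y / (1 + x)"
    using assms g by (intro divide_right_mono) auto
  also have "\<dots> = (\<integral>u. indicator {x..<y} u * gauss y \<partial>lborel)"
    using \<open>x \<le> y\<close> by (simp add: y_def)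
  also have "\<dots> \<le> (\<integral>u. indicator {x..<y} u * gauss u \<partial>lborel)"
    using assms
    by (intro integral_mono integrable_gauss_indicator integrable_mult_left integrable_real_indicator)

       (auto split: split_indicator intro!: gauss_antimono simp: emeasure_lborel_Ico[OF \<open>x \<le> y\<close>])
  also have "\<dots> = normal_tail x - normal_tail y"
    by (simp add: normal_tail_diff \<open>x \<le> y\<close>)
  finally show ?thesis using normal_tail_nonneg[of y] by linarith
qed

lemma normal_tail_pos: "0 < normal_tail x"
proof -
  have "0 < exp (- 3 / 2) * gauss (max 0 x) / (1 + max 0 x)"
    by (intro divide_pos_pos mult_pos_pos gauss_pos) auto
  also have "\<dots> \<le> normal_tail (max 0 x)"
    by (rule normal_tail_lower) simp
  also have "\<dots> \<le> normal_tail x"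
    by (rule normal_tail_antimono) simp
  finally show ?thesis .
qed

text \<open>The Mills ratio bound: beyond \<open>x\<close> the density is at most
  \<open>y / x\<close> times itself, and \<open>y * gauss y\<close> has the antiderivative
  \<open>- gauss y\<close>.\<close>

lemma normal_tail_upper:
  assumes "0 < x"
  shows "normal_tail x \<le> gauss x / x"
proof -
  have "has_bochner_integral lborel (\<lambda>y. indicator {x..} y * (y * gauss y)) (0 - (- gauss x))"
    using assms gauss_tendsto_0
    by (intro has_bochner_integral_FTC_atLeast[where F="\<lambda>x. - gauss x"])
       (auto intro!: derivative_eq_intros DERIV_gauss tendsto_eq_intros)
  then have *: "integrable lborel (\<lambda>y. indicator {x..} y * (y * gauss y))"
    "(\<integral>y. indicator {x..} y * (y * gauss y) \<partial>lborel) = gauss x"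
    by (auto simp: has_bochner_integral_iff)
  have "x * normal_tail x = (\<integral>y. x * (indicator {x..} y * gauss y) \<partial>lborel)"
    by (simp add: normal_tail_alt)
  also have "\<dots> \<le> (\<integral>y. indicator {x..} y * (y * gauss y) \<partial>lborel)"
    using * by (intro integral_mono integrable_mult_right) (auto split: split_indicator intro: mult_right_mono)
  finally show ?thesis
    using * assms by (simp add: field_simps)
qed

lemma normal_tail_upper_exp:
  assumes "1 \<le> x"
  shows "normal_tail x \<le> exp (- x\<^sup>2 / 2) / 2"
proof -
  have "normal_tail x \<le> gauss x / x"
    using assms by (intro normal_tail_upper) auto
  also have "\<dots> \<le> gauss x / 1"
    using assms by (intro divide_left_mono) auto
  also have "\<dots> \<le> 1 / 2 * exp (- x\<^sup>2 / 2)"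
    unfolding gauss_def div_by_1 by (intro mult_right_mono inverse_sqrt_2pi_le) auto
  finally show ?thesis by simp
qed

lemma normal_tail_tendsto_0: "(normal_tail \<longlongrightarrow> 0) at_top"
proof (rule tendsto_sandwich)
  show "\<forall>\<^sub>F x in at_top. 0 \<le> normal_tail x"
    by (simp add: normal_tail_nonneg)
  show "\<forall>\<^sub>F x in at_top. normal_tail x \<le> exp (- x\<^sup>2 / 2) / 2"
    using eventually_ge_at_top[of 1] by eventually_elim (rule normal_tail_upper_exp)
  show "((\<lambda>x::real. exp (- x\<^sup>2 / 2) / 2) \<longlongrightarrow> 0) at_top"
    by real_asymp
qed auto

lemma DERIV_normal_tail: "(normal_tail has_real_derivative - gauss x) (at x)"
proof -
  define a where "a = x - 1"
  have "((\<lambda>u. LBINT y=a..u. gauss y) has_vector_derivative gauss x) (at x within {a..x+1})"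
    by (intro interval_integral_FTC2 continuous_on_gauss) (auto simp: a_def)
  then have "((\<lambda>u. LBINT y=a..u. gauss y) has_real_derivative gauss x) (at x)"
    using at_within_interior[of x "{a..x+1}"]
    by (simp add: has_real_derivative_iff_has_vector_derivative a_def)
  then have "((\<lambda>u. normal_tail a - (LBINT y=a..u. gauss y)) has_real_derivative - gauss x) (at x)"
    by (auto intro!: derivative_eq_intros)
  moreover have "\<forall>\<^sub>F u in nhds x. normal_tail u = normal_tail a - (LBINT y=a..u. gauss y)"
  proof -
    have "\<forall>\<^sub>F u in nhds x. u \<in> {a<..}"
      by (rule eventually_nhds_in_open) (auto simp: a_def)
    then show ?thesis
    proof eventually_elim
      case (elim u)
      have "(LBINT y=a..u. gauss y) = (LBINT y:{a..<u}. gauss y)"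
        using elim by (intro interval_integral_Ico) auto
      also have "\<dots> = normal_tail a - normal_tail u"
        using elim by (subst normal_tail_diff) (auto simp: set_lebesgue_integral_def)
      finally show ?case by simp
    qed
  qed
  ultimately show ?thesis
    by (subst DERIV_cong_ev[where g="\<lambda>u. normal_tail a - (LBINT y=a..u. gauss y)"]) auto
qed

lemma isCont_normal_tail: "isCont normal_tail x"
  using DERIV_normal_tail by (rule DERIV_isCont)

text \<open>By \<open>DERIV_tail_gap\<close> the negative of the claimed value is an antiderivative
  of the slab density, and it vanishes at infinity. As the density is nonnegative, integrability
  comes along, and total mass 1 follows from \<open>tail_gap 0 = 0\<close> and symmetry.\<close>

lemma has_bochner_integral_slab_tail:
  "has_bochner_integral lborel (\<lambda>y. indicator {x..} y * slab_density y) (normal_tail x + tail_gap x)"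
proof -
  have "has_bochner_integral lborel (\<lambda>y. indicator {x..} y * slab_density y)
      (- 0 - 0 - (- normal_tail x - tail_gap x))"
    (is "has_bochner_integral _ _ ?I")
    by (intro has_bochner_integral_FTC_atLeast[where F="\<lambda>x. - normal_tail x - tail_gap x"] tendsto_intros
         normal_tail_tendsto_0 tail_gap_tendsto_0)
       (auto intro!: derivative_eq_intros DERIV_normal_tail DERIV_tail_gap less_imp_le[OF slab_density_pos])
  also have "?I = normal_tail x + tail_gap x" by simp
  finally show ?thesis .
qed

lemma slab_tail_eq: "slab_tail x = normal_tail x + tail_gap x"
  using has_bochner_integral_slab_tail[of x] by (simp add: has_bochner_integral_iff slab_tail_alt)

lemma integrable_slab_density_indicator:
  "integrable lborel (\<lambda>y. indicator {x..} y * slab_density y)"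
  using has_bochner_integral_slab_tail[of x] by (simp add: has_bochner_integral_iff)

lemma integral_even_half_line:
  fixes f :: "real \<Rightarrow> real"
  assumes even: "\<And>x. f (- x) = f x" and int: "integrable lborel (\<lambda>x. indicator {0..} x * f x)"
  shows "integrable lborel f" "(\<integral>x. f x \<partial>lborel) = 2 * (\<integral>x. indicator {0..} x * f x \<partial>lborel)"
proof -
  have i2: "integrable lborel (\<lambda>x. indicator {..0} x * f x)"
    using lborel_integrable_real_affine[OF int, of "-1" 0]
    by (rule back_subst[where P="integrable lborel"]) (auto simp: even fun_eq_iff split: split_indicator)
  have m: "(\<lambda>x. indicator {0..} x * f x) \<in> borel_measurable borel"
     "(\<lambda>x. indicator {..0} x * f x) \<in> borel_measurable borel"
    using int i2 by (auto dest!: borel_measurable_integrable)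
  have "f = (\<lambda>x. if 0 \<le> x then indicator {0..} x * f x else indicator {..0} x * f x)"
    by auto
  also have "\<dots> \<in> borel_measurable borel"
    by (intro measurable_If m) simp
  finally have f: "f \<in> borel_measurable borel" .
  have AE: "AE x in lborel. f x = indicator {0..} x * f x + indicator {..0} x * f x"
    by (rule AE_mp[OF AE_lborel_singleton[of 0]]) (auto split: split_indicator)
  show "integrable lborel f"
    by (rule integrable_cong_AE_imp[OF Bochner_Integration.integrable_add[OF int i2]]) (use AE f m in auto)
  have "(\<integral>x. f x \<partial>lborel) = (\<integral>x. indicator {0..} x * f x + indicator {..0} x * f x \<partial>lborel)"
    by (rule integral_cong_AE) (use AE f m in auto)
  also have "\<dots> = (\<integral>x. indicator {0..} x * f x \<partial>lborel) + (\<integral>x. indicator {..0} x * f x \<partial>lborel)"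
    using int i2 by simp
  also have "(\<integral>x. indicator {..0} x * f x \<partial>lborel) = (\<integral>x. indicator {0..} x * f x \<partial>lborel)"
    by (subst lborel_integral_real_affine[of "-1" _ 0])
       (auto simp: even intro!: Bochner_Integration.integral_cong split: split_indicator)
  finally show "(\<integral>x. f x \<partial>lborel) = 2 * (\<integral>x. indicator {0..} x * f x \<partial>lborel)" by simp
qed

lemma normal_tail_0: "normal_tail 0 = 1 / 2"
  using integral_even_half_line(2)[of gauss] by (simp add: normal_tail_alt)

lemma integrable_slab_density: "integrable lborel slab_density"
  by (rule integral_even_half_line(1)[OF slab_density_minus integrable_slab_density_indicator])

lemma integral_slab_density: "(\<integral>x. slab_density x \<partial>lborel) = 1"
  using integral_even_half_line(2)[OF _ integrable_slab_density_indicator[of 0]] slab_tail_eq[of 0]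
  by (simp add: normal_tail_0 tail_gap_def slab_tail_alt)

section \<open>The score of the marginal likelihood under the null\<close>

text \<open>The derivative in \<open>w\<close> of
  \<open>ln ((1 - w) * gauss x + w * slab_density x)\<close>, with \<open>gauss x\<close>
  cancelled.\<close>

definition score_term :: "real \<Rightarrow> real \<Rightarrow> real" where
  "score_term w x = (lik_ratio x - 1) / (1 + w * (lik_ratio x - 1))"

abbreviation gauss_measure :: "real measure" where
  "gauss_measure \<equiv> density lborel gauss"

definition null_drift :: "real \<Rightarrow> real" where
  "null_drift w = - (\<integral>x. score_term w x \<partial>gauss_measure)"

interpretation gauss_prob: prob_space gauss_measure
  by (rule prob_space_normal_density) simp

lemma score_term_measurable [measurable]: "score_term w \<in> borel_measurable borel"
  unfolding score_term_def[abs_def] by measurable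

lemma score_denom_ge:
  assumes "0 \<le> w" "w \<le> 1"
  shows "1 / 2 \<le> 1 + w * (lik_ratio x - 1)"
proof -
  have "w * (1 - lik_ratio x) \<le> 1 * (1 / 2)"
    using assms lik_ratio_ge_half[of x] mult_left_mono[of "1 - lik_ratio x" "1 / 2" w] by auto
  then show ?thesis by (simp add: algebra_simps)
qed

lemma score_denom_pos:
  assumes "0 \<le> w" "w \<le> 1"
  shows "0 < 1 + w * (lik_ratio x - 1)"
  using score_denom_ge[OF assms, of x] by linarith

lemma score_term_ge:
  assumes "0 \<le> w" "w \<le> 1"
  shows "- 1 \<le> score_term w x"
proof -
  have "- (1 + w * (lik_ratio x - 1)) \<le> lik_ratio x - 1"
    using score_denom_ge[OF assms, of x] lik_ratio_ge_half[of x] by linarith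
  then show ?thesis
    using score_denom_pos[OF assms, of x] by (simp add: score_term_def pos_le_divide_eq)
qed

lemma score_term_le:
  assumes "0 < w" "w \<le> 1"
  shows "score_term w x \<le> 1 / w"
  using assms score_denom_pos[of w x] by (simp add: score_term_def field_simps)

lemma abs_score_term_le:
  assumes "0 < w" "w \<le> 1"
  shows "\<bar>score_term w x\<bar> \<le> 1 / w"
proof -
  have "1 \<le> 1 / w" using assms by simp
  then show ?thesis
    using score_term_ge[of w x] score_term_le[of w x] assms by linarith
qed

lemma score_term_diff:
  assumes "0 \<le> w" "w \<le> 1" "0 \<le> w'" "w' \<le> 1"
  shows "score_term w x - score_term w' x = (w' - w) * score_term w x * score_term w' x"
  using score_denom_pos[of w x] score_denom_pos[of w' x] assms
  by (simp add: score_term_def field_simps)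

text \<open>The linear term \<open>lik_ratio x - 1\<close> has mean zero under the null, so the
  drift is the mean of this remainder. Being nonnegative, the remainder can be estimated pointwise
  and dropped on part of the line.\<close>

lemma score_term_correction:
  assumes "0 \<le> w" "w \<le> 1"
  shows "lik_ratio x - 1 - score_term w x = w * (lik_ratio x - 1)\<^sup>2 / (1 + w * (lik_ratio x - 1))"
  using score_denom_pos[OF assms, of x] by (simp add: score_term_def field_simps power2_eq_square)

lemma score_term_correction_nonneg:
  assumes "0 \<le> w" "w \<le> 1"
  shows "0 \<le> lik_ratio x - 1 - score_term w x"
  using score_denom_pos[OF assms, of x] assms by (simp add: score_term_correction)

text \<open>One of the two denominators of the square is at least \<open>1 / 2\<close>; what is left
  is the remainder of \<open>score_term_correction\<close> divided by \<open>w\<close>. In this way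
  the variance of the null score is controlled by the drift itself.\<close>

lemma score_term_square_le:
  assumes "0 < w" "w \<le> 1"
  shows "(score_term w x)\<^sup>2 \<le> 2 / w * (lik_ratio x - 1 - score_term w x)"
proof -
  define B where "B = lik_ratio x - 1"
  define d where "d = 1 + w * B"
  have d: "1 / 2 \<le> d" using score_denom_ge[of w x] assms by (simp add: d_def B_def)
  have "(score_term w x)\<^sup>2 = B\<^sup>2 / d * (1 / d)"
    by (simp add: score_term_def B_def d_def power_divide power2_eq_square)
  also have "\<dots> \<le> B\<^sup>2 / d * 2"
    using d by (intro mult_left_mono) (auto simp: field_simps)
  also have "\<dots> = 2 / w * (lik_ratio x - 1 - score_term w x)"
    using assms by (simp add: score_term_correction B_def d_def)
  finally show ?thesis .
qed

lemma integrable_gauss_measure_bounded: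
  fixes f :: "real \<Rightarrow> real"
  assumes "f \<in> borel_measurable borel" "\<And>x. \<bar>f x\<bar> \<le> B"
  shows "integrable gauss_measure f"
  using assms by (intro gauss_prob.integrable_const_bound[where B=B]) auto

lemma integrable_score_term:
  assumes "0 < w" "w \<le> 1"
  shows "integrable gauss_measure (score_term w)"
  by (rule integrable_gauss_measure_bounded[OF _ abs_score_term_le[OF assms]]) simp

lemma integrable_lik_ratio: "integrable gauss_measure lik_ratio"
  using integrable_slab_density
  by (subst integrable_density) (auto simp: slab_density_eq[abs_def] mult.commute)

lemma integral_lik_ratio: "(\<integral>x. lik_ratio x \<partial>gauss_measure) = 1"
  using integral_slab_density
  by (subst integral_density) (auto simp: slab_density_eq[abs_def] mult.commute)

lemma null_drift_eq:
  assumes "0 < w" "w \<le> 1"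
  shows "null_drift w = (\<integral>x. lik_ratio x - 1 - score_term w x \<partial>gauss_measure)"
  using integrable_score_term[OF assms] integrable_lik_ratio integral_lik_ratio
  by (simp add: null_drift_def gauss_prob.prob_space[simplified])

lemma null_drift_nonneg:
  assumes "0 < w" "w \<le> 1"
  shows "0 \<le> null_drift w"
  unfolding null_drift_eq[OF assms]
  using assms by (intro Bochner_Integration.integral_nonneg score_term_correction_nonneg) auto

lemma null_drift_le_1:
  assumes "0 < w" "w \<le> 1"
  shows "null_drift w \<le> 1"
proof -
  have "(\<integral>x. - 1 \<partial>gauss_measure) \<le> (\<integral>x. score_term w x \<partial>gauss_measure)"
    using assms integrable_score_term[OF assms] by (intro integral_mono score_term_ge) auto
  then show ?thesis
    by (simp add: null_drift_def gauss_prob.prob_space[simplified])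
qed

lemma integral_score_term_square_le:
  assumes "0 < w" "w \<le> 1"
  shows "(\<integral>x. (score_term w x)\<^sup>2 \<partial>gauss_measure) \<le> 2 / w * null_drift w"
proof -
  have "integrable gauss_measure (\<lambda>x. (score_term w x)\<^sup>2)"
  proof (rule integrable_gauss_measure_bounded)
    show "\<bar>(score_term w x)\<^sup>2\<bar> \<le> (1 / w)\<^sup>2" for x
      using abs_score_term_le[OF assms, of x] power_mono[of "\<bar>score_term w x\<bar>" "1 / w" 2] by simp
  qed simp
  moreover have "integrable gauss_measure (\<lambda>x. 2 / w * (lik_ratio x - 1 - score_term w x))"
    using integrable_score_term[OF assms] integrable_lik_ratio by simp
  ultimately have "(\<integral>x. (score_term w x)\<^sup>2 \<partial>gauss_measure)
      \<le> (\<integral>x. 2 / w * (lik_ratio x - 1 - score_term w x) \<partial>gauss_measure)"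
    by (intro integral_mono score_term_square_le assms)
  also have "\<dots> = 2 / w * null_drift w"
    unfolding null_drift_eq[OF assms] by (rule integral_mult_right_zero)
  finally show ?thesis .
qed

text \<open>The identity \<open>score_term_diff\<close> is exact and bilinear in two scores, each at
  most \<open>1 / a\<close>. The resulting continuity feeds the intermediate value argument in
  \<open>weight_equation_solvable\<close>.\<close>

lemma null_drift_lipschitz:
  assumes "0 < a" "a \<le> w" "w \<le> 1" "a \<le> w'" "w' \<le> 1"
  shows "\<bar>null_drift w - null_drift w'\<bar> \<le> \<bar>w - w'\<bar> / a\<^sup>2"
proof -
  have int: "integrable gauss_measure (score_term w)" "integrable gauss_measure (score_term w')"
    using assms by (auto intro!: integrable_score_term)
  have "\<bar>null_drift w - null_drift w'\<bar> = \<bar>\<integral>x. score_term w x - score_term w' x \<partial>gauss_measure\<bar>"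
    using int by (simp add: null_drift_def abs_minus_commute)
  also have "\<dots> \<le> (\<integral>x. \<bar>score_term w x - score_term w' x\<bar> \<partial>gauss_measure)"
    by (rule integral_abs_bound)
  also have "\<dots> \<le> (\<integral>x. \<bar>w - w'\<bar> / a\<^sup>2 \<partial>gauss_measure)"
  proof (intro integral_mono)
    fix x
    have "\<bar>score_term w x - score_term w' x\<bar> = \<bar>w - w'\<bar> * (\<bar>score_term w x\<bar> * \<bar>score_term w' x\<bar>)"
      using assms by (subst score_term_diff) (auto simp: abs_mult abs_minus_commute)
    also have "\<dots> \<le> \<bar>w - w'\<bar> * (1 / a * (1 / a))"
    proof (intro mult_mono order_refl)
      have "\<bar>score_term v x\<bar> \<le> 1 / a" if "a \<le> v" "v \<le> 1" for v
        using abs_score_term_le[of v x] that assms(1) frac_le[of 1 1 a v] by force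
      then show "\<bar>score_term w x\<bar> \<le> 1 / a" "\<bar>score_term w' x\<bar> \<le> 1 / a"
        using assms by auto
    qed (use assms in auto)
    finally show "\<bar>score_term w x - score_term w' x\<bar> \<le> \<bar>w - w'\<bar> / a\<^sup>2"
      by (simp add: power2_eq_square)
  qed (use int in auto)
  finally show ?thesis
    by (simp add: gauss_prob.prob_space[simplified])
qed

lemma isCont_null_drift:
  assumes "0 < w" "w < 1"
  shows "isCont null_drift w"
proof -
  have "((\<lambda>y. null_drift y - null_drift w) \<longlongrightarrow> 0) (at w)"
  proof (rule tendsto_rabs_zero_cancel, rule tendsto_sandwich[OF _ _ tendsto_const])
    have "\<forall>\<^sub>F y in nhds w. y \<in> {w / 2<..<1}"
      using assms by (intro eventually_nhds_in_open) auto
    then have "\<forall>\<^sub>F y in at w. y \<in> {w / 2<..<1}"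
      by (simp add: eventually_at_filter eventually_mono)
    then show "\<forall>\<^sub>F y in at w. \<bar>null_drift y - null_drift w\<bar> \<le> \<bar>y - w\<bar> / (w / 2)\<^sup>2"
      by eventually_elim (use assms in \<open>auto intro!: null_drift_lipschitz\<close>)
    have "((\<lambda>y. \<bar>y - w\<bar> / (w / 2)\<^sup>2) \<longlongrightarrow> \<bar>w - w\<bar> / (w / 2)\<^sup>2) (at w)"
      using assms by (intro tendsto_intros) auto
    then show "((\<lambda>y. \<bar>y - w\<bar> / (w / 2)\<^sup>2) \<longlongrightarrow> 0) (at w)" by simp
  qed auto
  then show ?thesis
    by (simp add: isCont_def LIM_zero_iff)
qed

lemma null_drift_half_line:
  assumes "0 < w" "w \<le> 1"
  shows "integrable lborel (\<lambda>x. indicator {0..} x * ((lik_ratio x - 1 - score_term w x) * gauss x))"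
    and "null_drift w = 2 * (\<integral>x. indicator {0..} x * ((lik_ratio x - 1 - score_term w x) * gauss x) \<partial>lborel)"
proof -
  have "integrable gauss_measure (\<lambda>x. lik_ratio x - 1 - score_term w x)"
    using integrable_score_term[OF assms] integrable_lik_ratio by auto
  then have "integrable lborel (\<lambda>x. (lik_ratio x - 1 - score_term w x) * gauss x)"
    by (subst (asm) integrable_density) (auto simp: mult.commute)
  then show *: "integrable lborel (\<lambda>x. indicator {0..} x * ((lik_ratio x - 1 - score_term w x) * gauss x))"
    using integrable_mult_indicator[of "{0..}" lborel "\<lambda>x. (lik_ratio x - 1 - score_term w x) * gauss x"] by simp
  have "null_drift w = (\<integral>x. (lik_ratio x - 1 - score_term w x) * gauss x \<partial>lborel)"
    unfolding null_drift_eq[OF assms] by (subst integral_density) (auto simp: mult.commute)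
  also have "\<dots> = 2 * (\<integral>x. indicator {0..} x * ((lik_ratio x - 1 - score_term w x) * gauss x) \<partial>lborel)"
    by (rule integral_even_half_line(2)[OF _ *]) (simp add: score_term_def)
  finally show "null_drift w = 2 * (\<integral>x. indicator {0..} x * ((lik_ratio x - 1 - score_term w x) * gauss x) \<partial>lborel)" .
qed

text \<open>The second role of \<open>tail_gap\<close>: besides fixing the threshold, it is the
  contribution to the drift from beyond \<open>z\<close> once the score is neglected there.\<close>

lemma has_bochner_integral_tail_gap:
  "has_bochner_integral lborel (\<lambda>x. indicator {z..} x * ((lik_ratio x - 1) * gauss x)) (tail_gap z)"
proof -
  have "has_bochner_integral lborel (\<lambda>x. indicator {z..} x * slab_density x - indicator {z..} x * gauss x)
      (normal_tail z + tail_gap z - normal_tail z)"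
    by (intro has_bochner_integral_diff has_bochner_integral_slab_tail)
       (simp add: has_bochner_integral_iff normal_tail_alt)
  then show ?thesis
    by (simp add: slab_density_eq algebra_simps)
qed

text \<open>The remainder is \<open>psi x * (lik_ratio x - 1)\<close>, where \<open>psi\<close>
  increases with \<open>lik_ratio\<close>. Beyond \<open>z\<close> the factor \<open>psi x\<close>
  is replaced by \<open>psi z\<close>, and the nonnegative part below \<open>z\<close> is dropped;
  the 2 counts the half-lines.\<close>

lemma null_drift_lower:
  assumes w: "0 < w" "w \<le> 1" and z: "0 \<le> z" "1 \<le> lik_ratio z"
  shows "2 * (1 - 1 / (1 + w * (lik_ratio z - 1))) * tail_gap z \<le> null_drift w"
proof -
  define psi where "psi x = 1 - 1 / (1 + w * (lik_ratio x - 1))" for x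
  have corr: "lik_ratio x - 1 - score_term w x = psi x * (lik_ratio x - 1)" for x
    using score_denom_pos[of w x] w by (simp add: psi_def score_term_def field_simps)
  have "psi z * tail_gap z = (\<integral>x. psi z * (indicator {z..} x * ((lik_ratio x - 1) * gauss x)) \<partial>lborel)"
    using has_bochner_integral_tail_gap[of z] by (simp add: has_bochner_integral_iff)
  also have "\<dots> \<le> (\<integral>x. indicator {0..} x * ((lik_ratio x - 1 - score_term w x) * gauss x) \<partial>lborel)"
  proof (intro integral_mono null_drift_half_line w)
    show "integrable lborel (\<lambda>x. psi z * (indicator {z..} x * ((lik_ratio x - 1) * gauss x)))"
      using has_bochner_integral_tail_gap[of z] by (simp add: has_bochner_integral_iff)
    fix x
    show "psi z * (indicator {z..} x * ((lik_ratio x - 1) * gauss x))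
      \<le> indicator {0..} x * ((lik_ratio x - 1 - score_term w x) * gauss x)"
    proof (cases "z \<le> x")
      case True
      then have r: "lik_ratio z \<le> lik_ratio x"
        using z by (intro lik_ratio_mono) auto
      then have "psi z \<le> psi x"
        unfolding psi_def using score_denom_pos[of w z] w
        by (intro diff_mono order_refl frac_le add_mono mult_left_mono) auto
      then have "psi z * (lik_ratio x - 1) * gauss x \<le> psi x * (lik_ratio x - 1) * gauss x"
        using r z by (intro mult_right_mono) auto
      then show ?thesis
        using True z by (simp add: corr mult.assoc)
    next
      case False
      then show ?thesis
        using score_term_correction_nonneg[of w x] w by simp
    qed
  qed
  finally show ?thesis
    using null_drift_half_line(2)[OF w] unfolding psi_def by linarith
qed

text \<open>The derivative of this function dominates the square of \<open>lik_ratio\<close> times the Gaussian density, up to a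
  constant: the shift \<open>7\<close> makes its numerator \<open>x ^ 4 + 2 * x\<^sup>2 + 7\<close> at least \<open>(7 + x\<^sup>2)\<^sup>2 / 7\<close>.\<close>
definition sq_ratio_primitive :: "real \<Rightarrow> real" where
  "sq_ratio_primitive x = x * exp (x\<^sup>2 / 2) / (7 + x\<^sup>2) ^ 3"

text \<open>The left side grows like \<open>exp (x\<^sup>2 / 2) / x ^ 4\<close>, and the shift 7
  removes the singularity of this expression at 0. With \<open>u = x\<^sup>2\<close>, the constant
  64 in the proof comes from \<open>7 + u \<le> 8 * u\<close> when \<open>u > 1\<close>, while for
  \<open>u \<le> 1\<close> both factors of the numerator are of order \<open>u\<close>;
  \<open>1 / sqrt (2 * pi) \<le> 1 / 2\<close> turns it into 32.\<close>

lemma lik_ratio_square_gauss_le: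
  "(lik_ratio x)\<^sup>2 * gauss x \<le> 32 * exp (x\<^sup>2 / 2) / (7 + x\<^sup>2)\<^sup>2"
proof (cases "x = 0")
  case True
  have "(1 / 2)\<^sup>2 * (1 / sqrt (2 * pi)) \<le> (1 / 2)\<^sup>2 * (1 / 2::real)"
    by (intro mult_left_mono inverse_sqrt_2pi_le) auto
  also have "\<dots> \<le> 32 / 49" by (simp add: power2_eq_square)
  finally show ?thesis
    using True by (simp add: lik_ratio_def gauss_def power2_eq_square del: real_sqrt_mult)
next
  case False
  define u where "u = x\<^sup>2"
  have u: "u > 0" using False by (simp add: u_def)
  have eq: "(lik_ratio x)\<^sup>2 * gauss x = 1 / sqrt (2 * pi) * (((exp (u / 2) - 1) * (1 - exp (- u / 2))) / u\<^sup>2)"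
  proof -
    have "(exp (u / 2) - 1) * exp (- u / 2) = 1 - exp (- u / 2)"
      by (simp add: left_diff_distrib flip: exp_add)
    then have "(exp (u / 2) - 1)\<^sup>2 * exp (- u / 2) = (exp (u / 2) - 1) * (1 - exp (- u / 2))"
      by (simp add: power2_eq_square mult.assoc)
    then show ?thesis
      using False by (simp add: lik_ratio_def gauss_def u_def power_divide flip: mult.assoc)
  qed
  have "((exp (u / 2) - 1) * (1 - exp (- u / 2))) / u\<^sup>2 \<le> 64 * exp (u / 2) / (7 + u)\<^sup>2"
  proof (cases "u \<le> 1")
    case True
    have "1 - exp (- u / 2) \<le> u / 2"
      using exp_ge_add_one_self[of "- u / 2"] by simp
    moreover have "exp (u / 2) - 1 \<le> exp (u / 2) * (u / 2)"
    proof -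
      have "exp (u / 2) * (1 - u / 2) \<le> exp (u / 2) * exp (- u / 2)"
        using exp_ge_add_one_self[of "- u / 2"] by (intro mult_left_mono) auto
      then show ?thesis by (simp add: algebra_simps flip: exp_add)
    qed
    ultimately have "(exp (u / 2) - 1) * (1 - exp (- u / 2)) \<le> exp (u / 2) * (u / 2) * (u / 2)"
      using u by (intro mult_mono) auto
    then have "((exp (u / 2) - 1) * (1 - exp (- u / 2))) / u\<^sup>2 \<le> (exp (u / 2) * (u / 2) * (u / 2)) / u\<^sup>2"
      by (intro divide_right_mono) auto
    also have "\<dots> = 64 * exp (u / 2) / 256"
      using u by (simp add: power2_eq_square)
    also have "\<dots> \<le> 64 * exp (u / 2) / (7 + u)\<^sup>2"
    proof (intro divide_left_mono)
      have "(7 + u)\<^sup>2 \<le> 16\<^sup>2" using True u by (intro power_mono) auto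
      then show "(7 + u)\<^sup>2 \<le> 256" by simp
    qed (use u in auto)
    finally show ?thesis .
  next
    case False
    have "((exp (u / 2) - 1) * (1 - exp (- u / 2))) / u\<^sup>2 \<le> exp (u / 2) * 1 / u\<^sup>2"
      using u by (intro divide_right_mono mult_mono) auto
    also have "\<dots> = 64 * exp (u / 2) / (8 * u)\<^sup>2"
      by (simp add: power_mult_distrib)
    also have "\<dots> \<le> 64 * exp (u / 2) / (7 + u)\<^sup>2"
      using False by (intro divide_left_mono power_mono) auto
    finally show ?thesis .
  qed
  then have "(lik_ratio x)\<^sup>2 * gauss x \<le> 1 / 2 * (64 * exp (u / 2) / (7 + u)\<^sup>2)"
    unfolding eq using u by (intro mult_mono inverse_sqrt_2pi_le divide_nonneg_nonneg mult_nonneg_nonneg) auto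
  then show ?thesis by (simp add: u_def)
qed

lemma has_bochner_integral_sq_ratio_primitive:
  assumes "0 \<le> z"
  shows "has_bochner_integral lborel (\<lambda>x. exp (x\<^sup>2 / 2) * (x ^ 4 + 2 * x\<^sup>2 + 7) / (7 + x\<^sup>2) ^ 4 * indicator {0..z} x)
    (sq_ratio_primitive z)"
proof -
  have "has_bochner_integral lborel (\<lambda>x. exp (x\<^sup>2 / 2) * (x ^ 4 + 2 * x\<^sup>2 + 7) / (7 + x\<^sup>2) ^ 4 * indicator {0..z} x)
    (sq_ratio_primitive z - sq_ratio_primitive 0)"
  proof (rule has_bochner_integral_FTC_Icc_nonneg)
    fix x :: real
    have nz: "7 + x\<^sup>2 \<noteq> 0" using zero_le_power2[of x] by linarith
    have "(sq_ratio_primitive has_real_derivative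
        ((exp (x\<^sup>2 / 2) + x * (exp (x\<^sup>2 / 2) * x)) * (7 + x\<^sup>2) ^ 3 - x * exp (x\<^sup>2 / 2) * (3 * (7 + x\<^sup>2)\<^sup>2 * (2 * x)))
          / ((7 + x\<^sup>2) ^ 3 * (7 + x\<^sup>2) ^ 3)) (at x)"
      unfolding sq_ratio_primitive_def[abs_def]
      by (rule derivative_eq_intros refl | use nz in \<open>simp; fail\<close>)+
    moreover have "((exp (x\<^sup>2 / 2) + x * (exp (x\<^sup>2 / 2) * x)) * (7 + x\<^sup>2) ^ 3 - x * exp (x\<^sup>2 / 2) * (3 * (7 + x\<^sup>2)\<^sup>2 * (2 * x)))
          / ((7 + x\<^sup>2) ^ 3 * (7 + x\<^sup>2) ^ 3) = exp (x\<^sup>2 / 2) * (x ^ 4 + 2 * x\<^sup>2 + 7) / (7 + x\<^sup>2) ^ 4"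
    proof -
      define y e where "y = 7 + x\<^sup>2" and "e = exp (x\<^sup>2 / 2)"
      have y: "y \<noteq> 0" using nz by (simp add: y_def)
      have "(e + x * (e * x)) * y ^ 3 - x * e * (3 * y\<^sup>2 * (2 * x)) = e * ((1 + x\<^sup>2) * y - 6 * x\<^sup>2) * y\<^sup>2"
        by (simp add: algebra_simps power2_eq_square power3_eq_cube)
      moreover have "(1 + x\<^sup>2) * y - 6 * x\<^sup>2 = x ^ 4 + 2 * x\<^sup>2 + 7"
        by (simp add: y_def algebra_simps power2_eq_square power4_eq_xxxx)
      moreover have "y ^ 3 * y ^ 3 = y ^ 4 * y\<^sup>2"
        by (simp flip: power_add)
      ultimately have "((e + x * (e * x)) * y ^ 3 - x * e * (3 * y\<^sup>2 * (2 * x))) / (y ^ 3 * y ^ 3)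
          = e * (x ^ 4 + 2 * x\<^sup>2 + 7) * y\<^sup>2 / (y ^ 4 * y\<^sup>2)"
        by (simp only:)
      also have "\<dots> = e * (x ^ 4 + 2 * x\<^sup>2 + 7) / y ^ 4"
        by (rule nonzero_mult_divide_mult_cancel_right) (use y in simp)
      finally have "((e + x * (e * x)) * y ^ 3 - x * e * (3 * y\<^sup>2 * (2 * x))) / (y ^ 3 * y ^ 3)
          = e * (x ^ 4 + 2 * x\<^sup>2 + 7) / y ^ 4" .
      then show ?thesis by (simp only: y_def e_def)
    qed
    ultimately show "(sq_ratio_primitive has_real_derivative exp (x\<^sup>2 / 2) * (x ^ 4 + 2 * x\<^sup>2 + 7) / (7 + x\<^sup>2) ^ 4) (at x)"
      by simp
  qed (use assms in auto)
  then show ?thesis by (simp add: sq_ratio_primitive_def)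
qed

text \<open>Beyond \<open>z\<close> the score is nonnegative, so the remainder is at most
  \<open>lik_ratio x - 1\<close>. Inside, it is quadratic: the denominator is at least
  \<open>1 / 2\<close>, and \<bar>lik_ratio x - 1\<bar> is at most \<open>lik_ratio x\<close>
  because the latter is at least \<open>1 / 2\<close>. The constant is
  \<open>448 = 2 * 32 * 7\<close>.\<close>

lemma null_drift_upper:
  assumes w: "0 < w" "w \<le> 1" and z: "0 \<le> z" "1 \<le> lik_ratio z"
  shows "null_drift w \<le> 2 * (tail_gap z + 448 * w * sq_ratio_primitive z)"
proof -
  define D where "D x = exp (x\<^sup>2 / 2) * (x ^ 4 + 2 * x\<^sup>2 + 7) / (7 + x\<^sup>2) ^ 4" for x :: real
  note D = has_bochner_integral_sq_ratio_primitive[OF z(1), folded D_def]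
  have "(\<integral>x. indicator {0..} x * ((lik_ratio x - 1 - score_term w x) * gauss x) \<partial>lborel)
    \<le> (\<integral>x. indicator {z..} x * ((lik_ratio x - 1) * gauss x) + 448 * w * (D x * indicator {0..z} x) \<partial>lborel)"
  proof (intro integral_mono null_drift_half_line w)
    show "integrable lborel (\<lambda>x. indicator {z..} x * ((lik_ratio x - 1) * gauss x) + 448 * w * (D x * indicator {0..z} x))"
      using has_bochner_integral_tail_gap[of z] D by (auto simp: has_bochner_integral_iff)
    fix x
    have D_nonneg: "0 \<le> D x" by (auto simp: D_def intro!: divide_nonneg_pos mult_nonneg_nonneg add_nonneg_nonneg add_pos_nonneg zero_less_power)
    show "indicator {0..} x * ((lik_ratio x - 1 - score_term w x) * gauss x)
        \<le> indicator {z..} x * ((lik_ratio x - 1) * gauss x) + 448 * w * (D x * indicator {0..z} x)"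
    proof (cases "z \<le> x")
      case True
      then have "lik_ratio z \<le> lik_ratio x"
        using z by (intro lik_ratio_mono) auto
      then have "0 \<le> score_term w x"
        using z w score_denom_pos[of w x] by (auto simp: score_term_def)
      then have "(lik_ratio x - 1 - score_term w x) * gauss x \<le> (lik_ratio x - 1) * gauss x"
        by (intro mult_right_mono) auto
      moreover have "0 \<le> 448 * w * (D x * indicator {0..z} x)"
        using D_nonneg w by auto
      ultimately show ?thesis using True z by simp
    next
      case False
      show ?thesis
      proof (cases "0 \<le> x")
        case True
        have "(lik_ratio x - 1)\<^sup>2 \<le> (lik_ratio x)\<^sup>2"
          using lik_ratio_ge_half[of x] by (intro abs_le_square_iff[THEN iffD1]) auto
        then have "w * (lik_ratio x - 1)\<^sup>2 / (1 + w * (lik_ratio x - 1)) \<le> w * (lik_ratio x)\<^sup>2 / (1 / 2)"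
          using w score_denom_ge[of w x] by (intro frac_le mult_left_mono) auto
        then have "(lik_ratio x - 1 - score_term w x) * gauss x \<le> w * (lik_ratio x)\<^sup>2 / (1 / 2) * gauss x"
          using w by (intro mult_right_mono) (auto simp: score_term_correction)
        also have "\<dots> = 2 * w * ((lik_ratio x)\<^sup>2 * gauss x)" by simp
        also have "\<dots> \<le> 2 * w * (32 * exp (x\<^sup>2 / 2) / (7 + x\<^sup>2)\<^sup>2)"
          using w by (intro mult_left_mono lik_ratio_square_gauss_le) auto
        also have "32 * exp (x\<^sup>2 / 2) / (7 + x\<^sup>2)\<^sup>2 \<le> 224 * D x"
        proof -
          define u where "u = x\<^sup>2"
          have u: "u \<ge> 0" by (simp add: u_def)
          have x4: "x ^ 4 = u\<^sup>2" by (simp add: u_def flip: power_mult)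
          have "(7 + u)\<^sup>2 \<le> 7 * (u\<^sup>2 + 2 * u + 7)"
            by (simp add: power2_sum)
          then have "exp (u / 2) * (7 + u)\<^sup>2 / (7 + u) ^ 4 \<le> exp (u / 2) * (7 * (u\<^sup>2 + 2 * u + 7)) / (7 + u) ^ 4"
            using u by (intro divide_right_mono mult_left_mono) auto
          also have "\<dots> = 7 * (exp (u / 2) * (u\<^sup>2 + 2 * u + 7) / (7 + u) ^ 4)"
            by simp
          finally have "exp (u / 2) * (7 + u)\<^sup>2 / ((7 + u)\<^sup>2 * (7 + u)\<^sup>2) \<le> 7 * D x"
            unfolding D_def x4 by (simp add: u_def[symmetric] flip: power_add)
          moreover have "exp (u / 2) * (7 + u)\<^sup>2 / ((7 + u)\<^sup>2 * (7 + u)\<^sup>2) = exp (u / 2) / (7 + u)\<^sup>2"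
            by (rule nonzero_mult_divide_mult_cancel_right) (use u in simp)
          ultimately have "exp (u / 2) / (7 + u)\<^sup>2 \<le> 7 * D x"
            by simp
          then show ?thesis
            by (simp add: u_def)
        qed
        finally show ?thesis
          using True False w by simp
      qed (use False z in simp)
    qed
  qed
  also have "\<dots> = tail_gap z + 448 * w * sq_ratio_primitive z"
    using has_bochner_integral_tail_gap[of z] D by (simp add: has_bochner_integral_iff)
  finally show ?thesis
    using null_drift_half_line(2)[OF w] by simp
qed

section \<open>The rejection threshold of the q-value\<close>

lemma slab_tail_pos: "0 \<le> x \<Longrightarrow> 0 < slab_tail x"
  using normal_tail_pos[of x] tail_gap_nonneg[of x] by (simp add: slab_tail_eq)

lemma q_value_less_iff:
  assumes "0 < w" "w \<le> 1"
  shows "q_value w x < t \<longleftrightarrow> (1 - w) * (1 - t) * normal_tail \<bar>x\<bar> < t * w * slab_tail \<bar>x\<bar>"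
proof -
  have "0 \<le> (1 - w) * normal_tail \<bar>x\<bar>" "0 < w * slab_tail \<bar>x\<bar>"
    using assms normal_tail_nonneg[of "\<bar>x\<bar>"] slab_tail_pos[of "\<bar>x\<bar>"] by auto
  then show ?thesis
    unfolding q_value_def by (subst pos_divide_less_eq) (auto simp: algebra_simps)
qed

lemma q_value_less_mono_weight:
  assumes "0 < w" "w \<le> w'" "w' \<le> 1" "t < 1" "0 < t" "q_value w x < t"
  shows "q_value w' x < t"
proof -
  have "(1 - w') * (1 - t) * normal_tail \<bar>x\<bar> \<le> (1 - w) * (1 - t) * normal_tail \<bar>x\<bar>"
    using assms normal_tail_nonneg[of "\<bar>x\<bar>"] by (intro mult_right_mono) auto
  also have "\<dots> < t * w * slab_tail \<bar>x\<bar>"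
    using assms by (subst q_value_less_iff[symmetric]) auto
  also have "\<dots> \<le> t * w' * slab_tail \<bar>x\<bar>"
    using assms slab_tail_pos[of "\<bar>x\<bar>"] by (intro mult_right_mono mult_left_mono) auto
  finally show ?thesis
    using assms by (subst q_value_less_iff) auto
qed

text \<open>A monotone likelihood ratio passes to the tails. Cut at \<open>y\<close>: between
  \<open>x\<close> and \<open>y\<close> the slab mass is at most \<open>lik_ratio y\<close> times
  the normal mass, beyond \<open>y\<close> it is at least that.\<close>

lemma tail_ratio_mono:
  assumes "0 \<le> x" "x \<le> y"
  shows "slab_tail x * normal_tail y \<le> slab_tail y * normal_tail x"
proof -
  define A where "A = normal_tail x - normal_tail y"
  have iS: "integrable lborel (\<lambda>u. indicator {x..<y} u * slab_density u)"
    using integrable_mult_indicator[of "{x..<y}" lborel slab_density] integrable_slab_density by simp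
  have "slab_tail x - slab_tail y = (\<integral>u. indicator {x..<y} u * slab_density u \<partial>lborel)"
    unfolding slab_tail_alt using assms
    by (subst Bochner_Integration.integral_diff[symmetric, OF integrable_slab_density_indicator integrable_slab_density_indicator])
       (intro Bochner_Integration.integral_cong refl, auto split: split_indicator)
  also have "\<dots> \<le> (\<integral>u. lik_ratio y * (indicator {x..<y} u * gauss u) \<partial>lborel)"
    using assms
    by (intro integral_mono iS integrable_mult_right integrable_gauss_indicator)
       (auto split: split_indicator simp: slab_density_eq intro!: mult_right_mono lik_ratio_mono)
  also have "\<dots> = lik_ratio y * A"
    unfolding A_def using assms by (simp add: normal_tail_diff)
  finally have 1: "slab_tail x \<le> slab_tail y + lik_ratio y * A" by simp
  have "lik_ratio y * normal_tail y = (\<integral>u. lik_ratio y * (indicator {y..} u * gauss u) \<partial>lborel)"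
    by (simp add: normal_tail_alt)
  also have "\<dots> \<le> slab_tail y"
    unfolding slab_tail_alt using assms
    by (intro integral_mono integrable_slab_density_indicator integrable_mult_right integrable_gauss_indicator)
       (auto split: split_indicator simp: slab_density_eq intro!: mult_right_mono lik_ratio_mono)
  finally have 2: "lik_ratio y * normal_tail y \<le> slab_tail y" .
  have "slab_tail x * normal_tail y \<le> (slab_tail y + lik_ratio y * A) * normal_tail y"
    by (intro mult_right_mono 1 normal_tail_nonneg)
  also have "\<dots> = slab_tail y * normal_tail y + A * (lik_ratio y * normal_tail y)"
    by (simp add: algebra_simps)
  also have "\<dots> \<le> slab_tail y * normal_tail y + A * slab_tail y"
    using normal_tail_antimono[OF assms(2)] by (intro add_left_mono mult_left_mono 2) (auto simp: A_def)
  also have "\<dots> = slab_tail y * normal_tail x"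
    by (simp add: A_def algebra_simps)
  finally show ?thesis .
qed

lemma q_value_less_mono_obs:
  assumes "0 < w" "w \<le> 1" "t < 1" "0 < t" "\<bar>x\<bar> \<le> \<bar>y\<bar>" "q_value w x < t"
  shows "q_value w y < t"
proof -
  have "((1 - w) * (1 - t) * normal_tail \<bar>y\<bar>) * normal_tail \<bar>x\<bar> = ((1 - w) * (1 - t) * normal_tail \<bar>x\<bar>) * normal_tail \<bar>y\<bar>"
    by (simp add: mult_ac)
  also have "\<dots> < (t * w * slab_tail \<bar>x\<bar>) * normal_tail \<bar>y\<bar>"
    using assms by (intro mult_strict_right_mono normal_tail_pos) (subst q_value_less_iff[symmetric], auto)
  also have "\<dots> = t * w * (slab_tail \<bar>x\<bar> * normal_tail \<bar>y\<bar>)" by simp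
  also have "\<dots> \<le> t * w * (slab_tail \<bar>y\<bar> * normal_tail \<bar>x\<bar>)"
    using assms by (intro mult_left_mono tail_ratio_mono) auto
  finally have "((1 - w) * (1 - t) * normal_tail \<bar>y\<bar>) * normal_tail \<bar>x\<bar> < (t * w * slab_tail \<bar>y\<bar>) * normal_tail \<bar>x\<bar>"
    by (simp add: mult_ac)
  then show ?thesis
    using assms normal_tail_pos[of "\<bar>x\<bar>"]
    by (subst q_value_less_iff) (auto simp: mult_less_cancel_right)
qed

lemma q_value_less_iff_gap:
  assumes "0 < w" "w \<le> 1"
  shows "q_value w x < t \<longleftrightarrow> (1 - t - w) * normal_tail \<bar>x\<bar> < t * w * tail_gap \<bar>x\<bar>"
  unfolding q_value_less_iff[OF assms] slab_tail_eq by (simp add: algebra_simps)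

text \<open>The threshold is the last point where \<open>D\<close> is nonpositive. It exists because
  \<open>w < 1 - t\<close> makes \<open>D 0\<close> negative, while far out the Gaussian tail is
  negligible against \<open>tail_gap\<close>. Continuity gives equality there, and monotonicity in
  \<bar>x\<bar> excludes rejections below it.\<close>

lemma q_value_threshold_exists:
  assumes w: "0 < w" "w < 1 - t" and t: "0 < t" "t < 1"
  shows "\<exists>\<xi>>0. (1 - t - w) * normal_tail \<xi> = t * w * tail_gap \<xi> \<and> (\<forall>x. q_value w x < t \<longleftrightarrow> \<xi> < \<bar>x\<bar>)"
proof -
  have w1: "w \<le> 1" using w t by simp
  define D where "D x = t * w * tail_gap x - (1 - t - w) * normal_tail x" for x
  have rej: "q_value w x < t \<longleftrightarrow> 0 < D \<bar>x\<bar>" for x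
    unfolding q_value_less_iff_gap[OF w(1) w1] D_def by auto
  have isCont_D: "isCont D x" for x
    unfolding D_def by (intro continuous_intros isCont_tail_gap isCont_normal_tail)
  define A where "A = {x. 0 \<le> x \<and> D x \<le> 0}"
  define \<xi> where "\<xi> = Sup A"
  have D0: "D 0 < 0"
    using w t by (simp add: D_def tail_gap_def normal_tail_0)
  have "\<forall>\<^sub>F x in at_top. (1 - t - w) * (exp (- x\<^sup>2 / 2) / 2) < t * w * (1 / sqrt (2 * pi) * (1 - exp (- x\<^sup>2 / 2)) / x)"
  proof -
    have "\<forall>\<^sub>F x in at_top. a * (exp (- x\<^sup>2 / 2) / 2) < b * (1 - exp (- x\<^sup>2 / 2)) / x" if "0 < a" "0 < b" for a b :: real
      using that by real_asymp
    from this[of "1 - t - w" "t * w * (1 / sqrt (2 * pi))"] show ?thesis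
      using w t by (simp add: mult.assoc)
  qed
  then have "\<forall>\<^sub>F x in at_top. 0 < D x"
    using eventually_ge_at_top[of 1]
  proof eventually_elim
    case (elim x)
    have "(1 - t - w) * normal_tail x \<le> (1 - t - w) * (exp (- x\<^sup>2 / 2) / 2)"
      using elim w by (intro mult_left_mono normal_tail_upper_exp) auto
    also have "\<dots> < t * w * (1 / sqrt (2 * pi) * (1 - exp (- x\<^sup>2 / 2)) / x)"
      by (rule elim(1))
    also have "\<dots> = t * w * tail_gap x"
      using elim(2) by (subst tail_gap_eq) auto
    finally show ?case by (simp add: D_def)
  qed
  then obtain b where b: "\<And>x. b \<le> x \<Longrightarrow> 0 < D x"
    by (auto simp: eventually_at_top_linorder)
  have bdd: "bdd_above A"
  proof (rule bdd_aboveI)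
    fix x assume "x \<in> A"
    then show "x \<le> b" using b[of x] by (cases "x \<le> b") (auto simp: A_def)
  qed
  have ne: "0 \<in> A" using D0 by (simp add: A_def)
  have "closed A"
    unfolding A_def
    by (intro closed_Collect_conj closed_Collect_le continuous_intros continuous_at_imp_continuous_on ballI isCont_D)
  then have \<xi>A: "\<xi> \<in> A"
    unfolding \<xi>_def using ne bdd by (intro closed_contains_Sup) auto
  have above: "0 < D x" if "\<xi> < x" for x
  proof (rule ccontr)
    assume "\<not> 0 < D x"
    then have "x \<in> A" using that \<xi>A by (auto simp: A_def)
    then have "x \<le> \<xi>" unfolding \<xi>_def by (rule cSup_upper[OF _ bdd])
    then show False using that by simp
  qed
  have "((\<lambda>x. D x) \<longlongrightarrow> D \<xi>) (at_right \<xi>)"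
    using isCont_D[of \<xi>] by (auto simp: isCont_def intro: filterlim_at_split[THEN iffD1, THEN conjunct2])
  then have "0 \<le> D \<xi>"
    by (rule tendsto_lowerbound) (auto simp: eventually_at_right[of \<xi> "\<xi> + 1"] intro!: exI[of _ "\<xi> + 1"] less_imp_le above)
  then have D\<xi>: "D \<xi> = 0" using \<xi>A by (auto simp: A_def)
  then have "\<xi> \<noteq> 0" using D0 by auto
  then have pos: "0 < \<xi>" using \<xi>A by (auto simp: A_def)
  have "q_value w x < t \<longleftrightarrow> \<xi> < \<bar>x\<bar>" for x
  proof
    assume "q_value w x < t"
    show "\<xi> < \<bar>x\<bar>"
    proof (rule ccontr)
      assume "\<not> \<xi> < \<bar>x\<bar>"
      then have "q_value w \<xi> < t"
        using \<open>q_value w x < t\<close> w w1 t by (intro q_value_less_mono_obs[of w t x \<xi>]) auto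
      then show False using D\<xi> pos by (simp add: rej)
    qed
  qed (simp add: rej above)
  then show ?thesis
    using pos D\<xi> by (intro exI[of _ \<xi>]) (auto simp: D_def)
qed

lemma normal_tail_measurable [measurable]: "normal_tail \<in> borel_measurable borel"
  by (intro borel_measurable_continuous_onI continuous_at_imp_continuous_on ballI isCont_normal_tail)

lemma tail_gap_measurable [measurable]: "tail_gap \<in> borel_measurable borel"
  unfolding tail_gap_def[abs_def] by measurable

lemma slab_tail_measurable [measurable]: "slab_tail \<in> borel_measurable borel"
  unfolding slab_tail_eq[abs_def] by measurable

lemma q_value_measurable [measurable]:
  assumes [measurable]: "f \<in> borel_measurable M" "g \<in> borel_measurable M"
  shows "(\<lambda>x. q_value (f x) (g x)) \<in> borel_measurable M"
  unfolding q_value_def by measurable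

lemma measure_gauss_tails:
  assumes "0 \<le> z"
  shows "measure gauss_measure {x. z < \<bar>x\<bar>} = 2 * normal_tail z"
proof -
  have i: "integrable lborel (\<lambda>x. indicator {0..} x * (indicator {x. z < \<bar>x\<bar>} x * gauss x))"
    using integrable_gauss_indicator[of "{0..} \<inter> {x. z < \<bar>x\<bar>}"]
    by (simp add: indicator_inter_arith mult.assoc)
  have "measure gauss_measure {x. z < \<bar>x\<bar>} = (\<integral>x. indicator {x. z < \<bar>x\<bar>} x \<partial>gauss_measure)"
    by simp
  also have "\<dots> = (\<integral>x. indicator {x. z < \<bar>x\<bar>} x * gauss x \<partial>lborel)"
    by (subst integral_density) (auto simp: mult.commute)
  also have "\<dots> = 2 * (\<integral>x. indicator {0..} x * (indicator {x. z < \<bar>x\<bar>} x * gauss x) \<partial>lborel)"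
    by (rule integral_even_half_line(2)[OF _ i]) (simp add: indicator_def)
  also have "(\<integral>x. indicator {0..} x * (indicator {x. z < \<bar>x\<bar>} x * gauss x) \<partial>lborel) = normal_tail z"
    unfolding normal_tail_alt
  proof (rule integral_cong_AE)
    show "AE x in lborel. indicator {0..} x * (indicator {x. z < \<bar>x\<bar>} x * gauss x) = indicator {z..} x * gauss x"
      by (rule AE_mp[OF AE_lborel_singleton[of z]]) (use assms in \<open>auto split: split_indicator\<close>)
  qed auto
  finally show ?thesis .
qed

definition null_reject :: "real \<Rightarrow> real \<Rightarrow> real" where
  "null_reject t w = measure gauss_measure {x. q_value w x < t}"

lemma null_reject_threshold:
  assumes w: "0 < w" "w < 1 - t" and t: "0 < t" "t < 1"
  obtains \<xi> where "0 < \<xi>" "(1 - t - w) * normal_tail \<xi> = t * w * tail_gap \<xi>"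
    "null_reject t w = 2 * t * w * tail_gap \<xi> / (1 - t - w)"
proof -
  obtain \<xi> where \<xi>: "0 < \<xi>" "(1 - t - w) * normal_tail \<xi> = t * w * tail_gap \<xi>"
    "\<And>x. q_value w x < t \<longleftrightarrow> \<xi> < \<bar>x\<bar>"
    using q_value_threshold_exists[OF assms] by auto
  have "null_reject t w = 2 * normal_tail \<xi>"
    unfolding null_reject_def \<xi>(3) using \<xi>(1) by (simp add: measure_gauss_tails)
  also have "\<dots> = 2 * t * w * tail_gap \<xi> / (1 - t - w)"
    using \<xi>(2) w by (simp add: field_simps)
  finally show thesis using \<xi> that by blast
qed

lemma exp_three_halves_le: "exp (3 / 2 :: real) \<le> 6"
proof -
  have "exp (1 / 2 :: real) \<le> 1 + 1 / 2 + (1 / 2)\<^sup>2"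
    by (rule exp_bound) auto
  then have "exp (1 / 2 :: real) ^ 3 \<le> (7 / 4) ^ 3"
    by (intro power_mono) (auto simp: power2_eq_square)
  also have "exp (1 / 2 :: real) ^ 3 = exp (3 / 2)"
    by (simp flip: exp_of_nat_mult)
  finally show ?thesis by (simp add: power3_eq_cube)
qed

text \<open>For \<open>w = exp (- l)\<close> this says that \<open>\<xi>\<^sup>2 / 2\<close> is at
  least \<open>l\<close> minus a constant, without logarithmic correction. The 24 collects
  \<open>1 - t - w \<ge> (1 - t) / 2\<close>, \<open>exp (- 3 / 2) \<ge> 1 / 6\<close> and the
  factor 2 of \<open>tail_gap_upper'\<close>.\<close>

lemma threshold_exp_le:
  assumes w: "0 < w" "w \<le> (1 - t) / 2" and t: "0 < t" "t < 1" and \<xi>: "0 < \<xi>"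
    and eq: "(1 - t - w) * normal_tail \<xi> = t * w * tail_gap \<xi>"
  shows "exp (- \<xi>\<^sup>2 / 2) \<le> 24 * t / (1 - t) * w"
proof -
  define k where "k = 1 / sqrt (2 * pi)"
  have k: "k > 0" by (simp add: k_def)
  have e: "1 / 6 \<le> exp (- 3 / 2 :: real)"
    using exp_three_halves_le le_imp_inverse_le[of "exp (3 / 2 :: real)" 6] by (simp add: exp_minus)
  have "(1 - t) / 2 * (1 / 6 * gauss \<xi> / (1 + \<xi>)) \<le> (1 - t - w) * (exp (- 3 / 2) * gauss \<xi> / (1 + \<xi>))"
    using w t \<xi> by (intro mult_mono divide_right_mono mult_right_mono e) auto
  also have "\<dots> \<le> (1 - t - w) * normal_tail \<xi>"
    using w t \<xi> by (intro mult_left_mono normal_tail_lower) auto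
  also have "\<dots> \<le> t * w * (2 * k / (1 + \<xi>))"
    unfolding eq k_def using w t \<xi> tail_gap_upper'[of \<xi>] by (intro mult_left_mono) auto
  finally have "((1 - t) / 2 * (1 / 6 * gauss \<xi>)) / (1 + \<xi>) \<le> (t * w * (2 * k)) / (1 + \<xi>)"
    by simp
  then have "(1 - t) / 2 * (1 / 6 * gauss \<xi>) \<le> t * w * (2 * k)"
    using \<xi> by (subst (asm) divide_le_cancel) auto
  then have "k * ((1 - t) / 12 * exp (- \<xi>\<^sup>2 / 2)) \<le> k * (2 * t * w)"
    by (simp add: gauss_def k_def)
  then have "(1 - t) / 12 * exp (- \<xi>\<^sup>2 / 2) \<le> 2 * t * w"
    using k by (subst (asm) mult_le_cancel_left_pos)
  then show ?thesis
    using t by (simp add: field_simps)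
qed

text \<open>The converse: \<open>\<xi>\<^sup>2 / 2\<close> is at most \<open>l\<close> plus a
  constant. Both tails have the same factor \<open>1 / \<xi>\<close>, and for
  \<open>\<xi> \<ge> 1\<close> the factor \<open>1 - exp (- \<xi>\<^sup>2 / 2)\<close> in
  \<open>tail_gap\<close> is at least \<open>1 / 3\<close>.\<close>

lemma threshold_exp_ge:
  assumes w: "0 < w" "w < 1 - t" and t: "0 < t" "t < 1" and \<xi>: "1 \<le> \<xi>"
    and eq: "(1 - t - w) * normal_tail \<xi> = t * w * tail_gap \<xi>"
  shows "w \<le> 3 / t * exp (- \<xi>\<^sup>2 / 2)"
proof -
  define k where "k = 1 / sqrt (2 * pi)"
  have k: "k > 0" by (simp add: k_def)
  have "exp (- \<xi>\<^sup>2 / 2) \<le> exp (- (1 / 2 :: real))"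
    using \<xi> by (simp add: power_mono)
  also have "\<dots> \<le> 2 / 3"
    using exp_ge_add_one_self[of "1 / 2 :: real"] by (simp add: exp_minus field_simps)
  finally have e: "1 / 3 \<le> 1 - exp (- \<xi>\<^sup>2 / 2)" by simp
  have "k * (1 / 3) / \<xi> \<le> k * (1 - exp (- \<xi>\<^sup>2 / 2)) / \<xi>"
    using e \<xi> k by (intro divide_right_mono mult_left_mono) auto
  also have "\<dots> = tail_gap \<xi>"
    using \<xi> by (subst tail_gap_eq) (auto simp: k_def)
  finally have "t * w * (k * (1 / 3) / \<xi>) \<le> t * w * tail_gap \<xi>"
    using w t by (intro mult_left_mono) auto
  also have "\<dots> \<le> 1 * (gauss \<xi> / \<xi>)"
    unfolding eq[symmetric] using w t \<xi> normal_tail_nonneg[of \<xi>] by (intro mult_mono normal_tail_upper) auto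
  finally have "k * (t * w * (1 / 3)) \<le> k * exp (- \<xi>\<^sup>2 / 2)"
    using \<xi> by (simp add: gauss_def k_def field_simps)
  then show ?thesis
    using k t by (simp add: field_simps)
qed

section \<open>Asymptotics for small weights\<close>

text \<open>The weight is written \<open>w = exp (- l)\<close>. The point \<open>z\<close> with \<open>z\<^sup>2 / 2 = l + 3 * ln l\<close> lies far enough beyond
  \<open>\<zeta>\<close> that \<open>w * \<beta> z \<ge> l\<close>.\<close>
lemma eventually_null_drift_lower:
  "\<forall>\<^sub>F l in at_top. 2 * (l / (1 + l)) *
     (1 / sqrt (2 * pi) * (1 - exp (- (l + 3 * ln l))) / sqrt (2 * (l + 3 * ln l))) \<le> null_drift (exp (- l))"
proof -
  have "\<forall>\<^sub>F l in at_top. l \<le> exp (- l) * ((exp (l + 3 * ln l) - 1) / (2 * (l + 3 * ln l)) - (1::real))"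
    by real_asymp
  moreover have "\<forall>\<^sub>F l in at_top. 0 < l + 3 * ln (l::real)"
    by real_asymp
  moreover have "\<forall>\<^sub>F l in at_top. (1::real) \<le> l"
    by (rule eventually_ge_at_top)
  ultimately show ?thesis
  proof eventually_elim
    case (elim l)
    define z where "z = sqrt (2 * (l + 3 * ln l))"
    have z: "0 < z" "z\<^sup>2 = 2 * (l + 3 * ln l)" using elim by (auto simp: z_def)
    have r: "lik_ratio z = (exp (l + 3 * ln l) - 1) / (2 * (l + 3 * ln l))"
      using z by (simp add: lik_ratio_def)
    have b: "l \<le> exp (- l) * (lik_ratio z - 1)" using elim(1) by (simp only: r)
    have r1: "1 \<le> lik_ratio z"
    proof (rule ccontr)
      assume "\<not> 1 \<le> lik_ratio z"
      then have "exp (- l) * (lik_ratio z - 1) \<le> 0" by (intro mult_nonneg_nonpos) auto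
      then show False using b elim by linarith
    qed
    have g: "tail_gap z = 1 / sqrt (2 * pi) * (1 - exp (- (l + 3 * ln l))) / z"
      using z by (subst tail_gap_eq) (auto simp del: real_sqrt_mult)
    have "l / (1 + l) = 1 - 1 / (1 + l)"
      using elim by (simp add: field_simps)
    also have "\<dots> \<le> 1 - 1 / (1 + exp (- l) * (lik_ratio z - 1))"
      using b elim by (intro diff_mono frac_le) auto
    finally have "2 * (l / (1 + l)) * tail_gap z \<le> 2 * (1 - 1 / (1 + exp (- l) * (lik_ratio z - 1))) * tail_gap z"
      using z by (intro mult_right_mono mult_left_mono tail_gap_nonneg) auto
    also have "\<dots> \<le> null_drift (exp (- l))"
      using z r1 elim by (intro null_drift_lower) auto
    finally show ?case unfolding z_def[symmetric] g[symmetric] .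
  qed
qed

text \<open>The drift decays only like \<open>1 / sqrt l\<close>, so it exceeds any multiple of the
  weight. At \<open>l = L / 2\<close> this makes \<open>w * null_drift w\<close> at least
  \<open>4 * exp (- L)\<close>.\<close>

lemma eventually_null_drift_large:
  "\<forall>\<^sub>F l in at_top. 4 * exp (- l) \<le> null_drift (exp (- l))"
proof -
  have "\<forall>\<^sub>F l in at_top. 4 * exp (- l) \<le> 2 * (l / (1 + l)) *
     (k * (1 - exp (- (l + 3 * ln l))) / sqrt (2 * (l + 3 * ln l)))" if "0 < k" for k :: real
    using that by real_asymp
  from this[of "1 / sqrt (2 * pi)"] have "\<forall>\<^sub>F l in at_top. 4 * exp (- l) \<le> 2 * (l / (1 + l)) *
     (1 / sqrt (2 * pi) * (1 - exp (- (l + 3 * ln l))) / sqrt (2 * (l + 3 * ln l)))"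
    by simp
  with eventually_null_drift_lower show ?thesis
    by eventually_elim (rule order_trans)
qed

text \<open>The quotient of the roots is \<open>1 + 3 / 2 * (ln l / l)\<close> to leading order, and
  the other factors exceed 1 by at most order \<open>1 / l\<close>. The constants
  \<open>7 / 4\<close> and 2 leave room for these.\<close>

lemma eventually_upper_ratio_bound:
  fixes A a :: real
  assumes "0 < a"
  shows "\<forall>\<^sub>F l in at_top. sqrt (2 * (l + 3 * ln l)) / sqrt (2 * (l - A)) * (a / (a - exp (- l)))
     * ((1 + l) / l) * (1 / (1 - exp (- (l + 3 * ln l)))) \<le> 1 + 2 * (ln l / l)"
proof -
  have "\<forall>\<^sub>F l in at_top. sqrt (2 * (l + 3 * ln l)) / sqrt (2 * (l - A)) \<le> 1 + 7 / 4 * (ln l / l)"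
    by real_asymp
  moreover have "\<forall>\<^sub>F l in at_top. a / (a - exp (- l)) \<le> 1 + 1 / l"
    using assms by real_asymp
  moreover have "\<forall>\<^sub>F l in at_top. 0 \<le> a / (a - exp (- l))"
    using assms by real_asymp
  moreover have "\<forall>\<^sub>F l in at_top. 1 / (1 - exp (- (l + 3 * ln l))) \<le> 1 + 1 / (l::real)"
    by real_asymp
  moreover have "\<forall>\<^sub>F l in at_top. 0 \<le> 1 / (1 - exp (- (l + 3 * ln (l::real))))"
    by real_asymp
  moreover have "\<forall>\<^sub>F l in at_top. 0 \<le> sqrt (2 * (l + 3 * ln l)) / sqrt (2 * (l - A))"
    by real_asymp
  moreover have "\<forall>\<^sub>F l in at_top. (1 + 7 / 4 * (ln l / l)) * (1 + 1 / l) * ((1 + l) / l) * (1 + 1 / l) \<le> 1 + 2 * (ln l / l::real)"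
    by real_asymp
  moreover have "\<forall>\<^sub>F l in at_top. (1::real) \<le> l"
    by (rule eventually_ge_at_top)
  ultimately show ?thesis
  proof eventually_elim
    case (elim l)
    have "sqrt (2 * (l + 3 * ln l)) / sqrt (2 * (l - A)) * (a / (a - exp (- l)))
        * ((1 + l) / l) * (1 / (1 - exp (- (l + 3 * ln l))))
      \<le> (1 + 7 / 4 * (ln l / l)) * (1 + 1 / l) * ((1 + l) / l) * (1 + 1 / l)"
      using elim by (intro mult_mono order_refl mult_nonneg_nonneg) auto
    then show ?case using elim by linarith
  qed
qed

text \<open>A lower bound for the threshold, \<open>X \<le> \<xi>\<close>, meets a lower bound for
  the drift taken at the point \<open>Z\<close>. Up to factors tending to 1 the claim is that
  \<open>1 / X\<close> exceeds \<open>1 / Z\<close> by a relative amount of order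
  \<open>ln l / l\<close>.\<close>

lemma eventually_null_reject_upper:
  assumes t: "0 < t" "t < 1"
  shows "\<forall>\<^sub>F l in at_top. null_reject t (exp (- l))
    \<le> (1 + 2 * (ln l / l)) * (t / (1 - t)) * (exp (- l) * null_drift (exp (- l)))"
proof -
  define A where "A = ln (24 * t / (1 - t))"
  have expA: "exp A = 24 * t / (1 - t)" using t by (simp add: A_def)
  have "\<forall>\<^sub>F l in at_top. exp (- l) \<le> (1 - t) / 2"
    using t by real_asymp
  moreover have "\<forall>\<^sub>F l in at_top. 0 < l + 3 * ln (l::real)"
    by real_asymp
  moreover have "\<forall>\<^sub>F l in at_top. max 1 (A + 1) \<le> l"
    by (rule eventually_ge_at_top)
  moreover note eventually_null_drift_lower
  moreover have "\<forall>\<^sub>F l in at_top. sqrt (2 * (l + 3 * ln l)) / sqrt (2 * (l - A)) * ((1 - t) / (1 - t - exp (- l)))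
     * ((1 + l) / l) * (1 / (1 - exp (- (l + 3 * ln l)))) \<le> 1 + 2 * (ln l / l)"
    using t by (intro eventually_upper_ratio_bound) simp
  ultimately show ?thesis
  proof eventually_elim
    case (elim l)
    define w where "w = exp (- l)"
    define k where "k = 1 / sqrt (2 * pi)"
    define X where "X = sqrt (2 * (l - A))"
    define Z where "Z = sqrt (2 * (l + 3 * ln l))"
    define E where "E = 1 - exp (- (l + 3 * ln l))"
    define R where "R = 1 + 2 * (ln l / l)"
    have w: "0 < w" "w \<le> (1 - t) / 2" "w < 1 - t" using elim t by (auto simp: w_def)
    have pos: "0 < k" "0 < X" "0 < Z" "0 < E" "0 < l" using elim by (auto simp: k_def X_def Z_def E_def)
    obtain \<xi> where \<xi>: "0 < \<xi>" "(1 - t - w) * normal_tail \<xi> = t * w * tail_gap \<xi>"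
      "null_reject t w = 2 * t * w * tail_gap \<xi> / (1 - t - w)"
      using null_reject_threshold[OF w(1) w(3) t] by blast
    have "exp (- \<xi>\<^sup>2 / 2) \<le> exp (A - l)"
      using threshold_exp_le[OF w(1,2) t \<xi>(1,2)] by (simp add: expA exp_diff w_def exp_minus field_simps)
    then have "2 * (l - A) \<le> \<xi>\<^sup>2" by simp
    then have "X \<le> \<xi>"
      unfolding X_def using \<xi>(1) by (intro real_le_lsqrt) auto
    have "tail_gap \<xi> \<le> k / \<xi>"
      using tail_gap_upper[OF \<xi>(1)] by (simp add: k_def)
    also have "\<dots> \<le> k / X"
      using \<open>X \<le> \<xi>\<close> pos by (intro divide_left_mono) auto
    finally have H: "tail_gap \<xi> \<le> k / X" .
    have "tail_gap \<xi> * ((1 - t) / (1 - t - w)) \<le> k / X * ((1 - t) / (1 - t - w))"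
      using w t by (intro mult_right_mono H) auto
    \<comment> \<open>The first factor is the lower bound for half the drift, the second is the
      ratio bounded in \<open>eventually_upper_ratio_bound\<close>.\<close>
    also have "\<dots> = (l / (1 + l) * (k * E / Z)) * (Z / X * ((1 - t) / (1 - t - w)) * ((1 + l) / l) * (1 / E))"
    proof -
      have "k / X * q = (l / (1 + l) * (k * E / Z)) * (Z / X * q * ((1 + l) / l) * (1 / E))" for q
        using pos by (simp add: divide_simps)
      then show ?thesis .
    qed
    also have "\<dots> \<le> (l / (1 + l) * (k * E / Z)) * R"
      using pos elim(5) unfolding R_def[symmetric] w_def[symmetric] X_def[symmetric] Z_def[symmetric] E_def[symmetric]
      by (intro mult_left_mono) auto
    also have "\<dots> \<le> (null_drift w / 2) * R"
    proof (rule mult_right_mono)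
      show "l / (1 + l) * (k * E / Z) \<le> null_drift w / 2"
        using elim(4) unfolding w_def[symmetric] k_def[symmetric] E_def[symmetric] Z_def[symmetric] by linarith
      show "0 \<le> R" using elim(3) by (simp add: R_def)
    qed
    finally have main: "tail_gap \<xi> * ((1 - t) / (1 - t - w)) \<le> null_drift w / 2 * R" .
    have "null_reject t w = 2 * (t / (1 - t)) * w * (tail_gap \<xi> * ((1 - t) / (1 - t - w)))"
      using t w by (simp add: \<xi>(3))
    also have "\<dots> \<le> 2 * (t / (1 - t)) * w * (null_drift w / 2 * R)"
      using t w by (intro mult_left_mono main) auto
    also have "\<dots> = R * (t / (1 - t)) * (w * null_drift w)"
    proof -
      have "2 * q * w * (null_drift w / 2 * R) = R * q * (w * null_drift w)" for q
        by simp
      then show ?thesis .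
    qed
    finally show ?case by (simp only: R_def w_def)
  qed
qed

text \<open>Neglecting the term with \<open>B\<close>, the quotient is
  \<open>sqrt (x\<^sup>2 + 2 * ln x) / x\<close>, about \<open>1 + ln x / x\<^sup>2\<close>.
  Relative to \<open>1 / sqrt (x\<^sup>2 + 2 * ln x)\<close> that term is of order
  \<open>1 / x ^ 3\<close>; giving up half of the gain covers it.\<close>

lemma eventually_lower_ratio_bound:
  fixes B :: real
  assumes "0 < B"
  shows "\<forall>\<^sub>F x in at_top. 1 + 1 / 2 * (ln x / x\<^sup>2)
     \<le> (1 - exp (- x\<^sup>2 / 2)) / x / (1 / sqrt (x\<^sup>2 + 2 * ln x) + B * x / sqrt (x\<^sup>2 + 2 * ln x) ^ 5)"
  using assms by real_asymp

text \<open>Now the drift is needed from above, by a cut at some \<open>z\<close> beyond the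
  threshold. Moving to \<open>z\<^sup>2 = \<xi>\<^sup>2 + 2 * ln \<xi>\<close> lowers
  \<open>k / z\<close> against \<open>k / \<xi>\<close> by a relative amount of order
  \<open>ln \<xi> / \<xi>\<^sup>2\<close>, which is the bias. It raises
  \<open>exp (z\<^sup>2 / 2)\<close> only by a factor \<open>\<xi>\<close>, so by
  \<open>threshold_exp_ge\<close> the inner part \<open>w * sq_ratio_primitive z\<close> is of order
  \<open>1 / \<xi> ^ 4\<close>, small against the gain.\<close>

lemma eventually_null_reject_lower:
  assumes t: "0 < t" "t < 1"
  shows "\<forall>\<^sub>F l in at_top. (1 + 1 / 12 * (ln l / l)) * (t / (1 - t)) * (exp (- l) * null_drift (exp (- l)))
    \<le> null_reject t (exp (- l))"
proof -
  define A where "A = ln (24 * t / (1 - t))"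
  have expA: "exp A = 24 * t / (1 - t)" using t by (simp add: A_def)
  define A' where "A' = ln (3 / t)"
  have expA': "exp A' = 3 / t" using t by (simp add: A'_def)
  define k where "k = 1 / sqrt (2 * pi)"
  have k: "0 < k" by (simp add: k_def)
  \<comment> \<open>\<open>1344 = 448 * 3\<close>: the constant of \<open>null_drift_upper\<close>
    times that of \<open>threshold_exp_ge\<close>, divided by the common factor \<open>k\<close> of
    \<open>tail_gap\<close>.\<close>
  define B where "B = 1344 / (t * k)"
  have "0 < B" using t k by (simp add: B_def)
  then obtain X where X: "\<And>x. X \<le> x \<Longrightarrow> 1 + 1 / 2 * (ln x / x\<^sup>2)
     \<le> (1 - exp (- x\<^sup>2 / 2)) / x / (1 / sqrt (x\<^sup>2 + 2 * ln x) + B * x / sqrt (x\<^sup>2 + 2 * ln x) ^ 5)"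
    using eventually_lower_ratio_bound[of B] unfolding eventually_at_top_linorder by blast
  have "\<forall>\<^sub>F z in at_top. 1 \<le> (exp (z\<^sup>2 / 2) - 1) / (z::real)\<^sup>2"
    by real_asymp
  then obtain X' where X': "\<And>z. X' \<le> z \<Longrightarrow> 1 \<le> (exp (z\<^sup>2 / 2) - 1) / (z::real)\<^sup>2"
    unfolding eventually_at_top_linorder by blast
  have "\<forall>\<^sub>F l in at_top. exp (- l) \<le> (1 - t) / 2"
    using t by real_asymp
  moreover have "\<forall>\<^sub>F l in at_top. max 1 (max (2 * A) (2 * A')) \<le> l"
    by (rule eventually_ge_at_top)
  moreover have "\<forall>\<^sub>F l in at_top. max X X' \<le> sqrt l"
    using sqrt_at_top unfolding filterlim_at_top by blast
  ultimately show ?thesis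
  proof eventually_elim
    case (elim l)
    define w where "w = exp (- l)"
    have w: "0 < w" "w \<le> (1 - t) / 2" "w < 1 - t" "w \<le> 1" using elim t by (auto simp: w_def)
    obtain \<xi> where \<xi>: "0 < \<xi>" "(1 - t - w) * normal_tail \<xi> = t * w * tail_gap \<xi>"
      "null_reject t w = 2 * t * w * tail_gap \<xi> / (1 - t - w)"
      using null_reject_threshold[OF w(1) w(3) t] by blast
    have "exp (- \<xi>\<^sup>2 / 2) \<le> exp (A - l)"
      using threshold_exp_le[OF w(1,2) t \<xi>(1,2)] by (simp add: expA exp_diff w_def exp_minus field_simps)
    then have "2 * (l - A) \<le> \<xi>\<^sup>2" by simp
    then have \<xi>l: "l \<le> \<xi>\<^sup>2" using elim by simp
    then have \<xi>_sqrt: "sqrt l \<le> \<xi>"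
      using \<xi>(1) elim by (intro real_le_lsqrt) auto
    then have \<xi>1: "1 \<le> \<xi>" "X \<le> \<xi>" "X' \<le> \<xi>"
      using elim real_sqrt_ge_one[of l] by linarith+
    have w_le: "w \<le> 3 / t * exp (- \<xi>\<^sup>2 / 2)"
      by (rule threshold_exp_ge[OF w(1,3) t \<xi>1(1) \<xi>(2)])
    have "exp (- l) \<le> exp (A' + - \<xi>\<^sup>2 / 2)"
      unfolding exp_add expA' w_def[symmetric] by (rule w_le)
    then have "\<xi>\<^sup>2 \<le> 2 * l + 2 * A'" by simp
    then have \<xi>u: "\<xi>\<^sup>2 \<le> 3 * l" using elim by simp
    \<comment> \<open>slightly below \<open>\<zeta>\<close>, so that the part of the drift inside \<open>z\<close> is of lower order than \<open>tail_gap z\<close>\<close>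
    define z where "z = sqrt (\<xi>\<^sup>2 + 2 * ln \<xi>)"
    have ln\<xi>: "0 \<le> ln \<xi>" using \<xi>1 by simp
    have z2: "z\<^sup>2 = \<xi>\<^sup>2 + 2 * ln \<xi>" using ln\<xi> by (simp add: z_def)
    have z\<xi>: "\<xi> \<le> z"
      unfolding z_def using ln\<xi> by (intro real_le_rsqrt) auto
    then have z: "0 < z" "X' \<le> z" using \<xi>1 by auto
    have "1 \<le> lik_ratio z" using X'[OF z(2)] z by (simp add: lik_ratio_def)
    then have "null_drift w \<le> 2 * (tail_gap z + 448 * w * sq_ratio_primitive z)"
      using z w by (intro null_drift_upper) auto
    also have "\<dots> \<le> 2 * (k / z + 448 * (3 / t * (\<xi> / z ^ 5)))"
    proof (intro mult_left_mono add_mono)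
      show "tail_gap z \<le> k / z" using tail_gap_upper[OF z(1)] by (simp add: k_def)
      have "sq_ratio_primitive z \<le> z * exp (z\<^sup>2 / 2) / (z\<^sup>2) ^ 3"
        unfolding sq_ratio_primitive_def using z by (intro divide_left_mono power_mono mult_pos_pos zero_less_power) (auto intro: add_pos_nonneg)
      also have "\<dots> = exp (\<xi>\<^sup>2 / 2) * \<xi> / z ^ 5"
      proof -
        have "exp (z\<^sup>2 / 2) = exp (\<xi>\<^sup>2 / 2) * \<xi>"
          using \<xi>(1) by (simp add: z2 add_divide_distrib exp_add)
        moreover have "(z\<^sup>2) ^ 3 = z ^ 5 * z" by (simp flip: power_mult add: eval_nat_numeral)
        ultimately show ?thesis using z by simp
      qed
      finally have "w * sq_ratio_primitive z \<le> (3 / t * exp (- \<xi>\<^sup>2 / 2)) * (exp (\<xi>\<^sup>2 / 2) * \<xi> / z ^ 5)"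
        using z w t by (intro mult_mono w_le) (auto simp: sq_ratio_primitive_def)
      also have "\<dots> = (exp (- \<xi>\<^sup>2 / 2) * exp (\<xi>\<^sup>2 / 2)) * (3 / t * (\<xi> / z ^ 5))" by simp
      also have "exp (- \<xi>\<^sup>2 / 2) * exp (\<xi>\<^sup>2 / 2) = 1" by (simp flip: exp_add)
      finally show "448 * w * sq_ratio_primitive z \<le> 448 * (3 / t * (\<xi> / z ^ 5))"
        by simp
    qed auto
    also have "\<dots> = 2 * k * (1 / z + B * \<xi> / z ^ 5)"
      using k t by (simp add: B_def field_simps)
    finally have d: "null_drift w / (2 * k) \<le> 1 / z + B * \<xi> / z ^ 5"
      using k by (simp add: field_simps)
    define Q where "Q = 1 + 1 / 2 * (ln \<xi> / \<xi>\<^sup>2)"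
    have "Q \<le> (1 - exp (- \<xi>\<^sup>2 / 2)) / \<xi> / (1 / z + B * \<xi> / z ^ 5)"
      unfolding Q_def z_def by (rule X[OF \<xi>1(2)])
    moreover have "0 < 1 / z + B * \<xi> / z ^ 5"
      using z \<open>0 < B\<close> \<xi>1 by (intro add_pos_pos divide_pos_pos mult_pos_pos zero_less_power) auto
    ultimately have "Q * (1 / z + B * \<xi> / z ^ 5) \<le> (1 - exp (- \<xi>\<^sup>2 / 2)) / \<xi>"
      by (subst (asm) pos_le_divide_eq)
    moreover have "Q * (null_drift w / (2 * k)) \<le> Q * (1 / z + B * \<xi> / z ^ 5)"
      using ln\<xi> by (intro mult_left_mono d) (auto simp: Q_def)
    ultimately have "k * (Q * (null_drift w / (2 * k))) \<le> k * ((1 - exp (- \<xi>\<^sup>2 / 2)) / \<xi>)"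
      using k by (intro mult_left_mono) auto
    then have H: "Q * (null_drift w / 2) \<le> tail_gap \<xi>"
      using k \<xi>(1) by (simp add: tail_gap_eq k_def)
    \<comment> \<open>The passage from \<open>\<xi>\<close> to \<open>l\<close> uses
      \<open>l \<le> \<xi>\<^sup>2 \<le> 3 * l\<close>: the logarithm loses a factor 2, the
      denominator a factor 3.\<close>
    have "1 / 12 * (ln l / l) = 1 / 2 * ((1 / 2 * ln l) / (3 * l))" by simp
    also have "\<dots> \<le> 1 / 2 * (ln \<xi> / \<xi>\<^sup>2)"
    proof (intro mult_left_mono frac_le)
      have "ln l \<le> ln (\<xi>\<^sup>2)" using \<xi>l elim \<xi>(1) by (subst ln_le_cancel_iff) auto
      then show "1 / 2 * ln l \<le> ln \<xi>" using \<xi>(1) by (simp add: ln_realpow)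
    qed (use ln\<xi> \<xi>u \<xi>(1) in auto)
    finally have "1 + 1 / 12 * (ln l / l) \<le> Q" by (simp add: Q_def)
    then have "(1 + 1 / 12 * (ln l / l)) * (t / (1 - t)) * (w * null_drift w) \<le> Q * (t / (1 - t)) * (w * null_drift w)"
      using t w null_drift_nonneg[of w] by (intro mult_right_mono) auto
    also have "\<dots> = 2 * t * w * (Q * (null_drift w / 2)) / (1 - t)"
    proof -
      have "Q * (t / a) * (w * null_drift w) = 2 * t * w * (Q * (null_drift w / 2)) / a" for a
        by simp
      then show ?thesis .
    qed
    also have "\<dots> \<le> 2 * t * w * tail_gap \<xi> / (1 - t)"
      using t w by (intro divide_right_mono mult_left_mono H) auto
    also have "\<dots> \<le> null_reject t w"
      unfolding \<xi>(3) using t w tail_gap_nonneg[of \<xi>] \<xi>(1) by (intro divide_left_mono) auto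
    finally show ?case by (simp only: w_def)
  qed
qed

section \<open>The empirical Bayes weight\<close>

text \<open>Strictness ensures that \<open>lik_ratio x = 1\<close> has at most two solutions. The
  mean values of \<open>exp\<close> on the adjacent intervals from 0 to \<open>u\<close> and from
  \<open>u\<close> to \<open>v\<close> are attained at points \<open>a < b\<close>, so the slope to
  \<open>v\<close> is strictly larger.\<close>

lemma lik_ratio_strict_mono:
  assumes "\<bar>x\<bar> < \<bar>y\<bar>"
  shows "lik_ratio x < lik_ratio y"
proof -
  define u v where "u = x\<^sup>2 / 2" and "v = y\<^sup>2 / 2"
  have "x\<^sup>2 < y\<^sup>2" using power_strict_mono[OF assms, of 2] by simp
  then have uv: "0 \<le> u" "u < v" by (auto simp: u_def v_def)
  have y: "y \<noteq> 0" using assms by auto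
  have ry: "lik_ratio y = (exp v - 1) / (2 * v)"
    using y by (simp add: lik_ratio_def v_def)
  show ?thesis
  proof (cases "x = 0")
    case True
    have "1 + v < exp v"
    proof -
      have "exp v \<noteq> 1 + v"
      proof
        assume "exp v = 1 + v"
        then have "ln (1 + v) = (1 + v) - 1" by (metis add_diff_cancel_left' ln_exp)
        then show False using ln_eq_minus_one[of "1 + v"] uv by simp
      qed
      then show ?thesis using exp_ge_add_one_self[of v] by linarith
    qed
    then show ?thesis
      using True uv by (simp add: ry lik_ratio_def[of 0] field_simps)
  next
    case False
    then have u: "0 < u" by (simp add: u_def)
    obtain a where a: "0 < a" "a < u" "exp u - exp 0 = (u - 0) * exp a"
      using MVT2[of 0 u exp exp] u by (auto intro: DERIV_exp)
    obtain b where b: "u < b" "b < v" "exp v - exp u = (v - u) * exp b"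
      using MVT2[of u v exp exp] uv by (auto intro: DERIV_exp)
    have eu: "exp u - 1 = u * exp a" using a by simp
    have "v * exp a = u * exp a + (v - u) * exp a" by (simp add: algebra_simps)
    also have "\<dots> < u * exp a + (v - u) * exp b"
      using a b uv by (intro add_strict_left_mono mult_strict_left_mono) auto
    also have "\<dots> = exp v - 1" using eu b by simp
    finally have "exp a < (exp v - 1) / v" using uv by (simp add: field_simps)
    moreover have "lik_ratio x = exp a / 2"
      using False eu u by (simp add: lik_ratio_def u_def field_simps)
    ultimately show ?thesis by (simp add: ry)
  qed
qed

lemma finite_lik_ratio_eq_1: "finite {x. lik_ratio x = 1}"
proof (cases "{x. lik_ratio x = 1} = {}")
  case False
  then obtain c where c: "lik_ratio c = 1" by auto
  have "x = c \<or> x = - c" if "lik_ratio x = 1" for x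
  proof -
    have "\<bar>x\<bar> = \<bar>c\<bar>"
      using lik_ratio_strict_mono[of x c] lik_ratio_strict_mono[of c x] that c by force
    then show ?thesis by (auto simp: abs_eq_iff)
  qed
  then have "{x. lik_ratio x = 1} \<subseteq> {c, - c}" by auto
  then show ?thesis by (rule finite_subset) simp
qed simp

section \<open>The log-likelihood and its maximiser\<close>

definition log_lik :: "nat \<Rightarrow> (nat \<Rightarrow> real) \<Rightarrow> real \<Rightarrow> real" where
  "log_lik n X w = (\<Sum>i=1..n. ln ((1 - w) * gauss (X i) + w * slab_density (X i)))"

definition score :: "nat \<Rightarrow> (nat \<Rightarrow> real) \<Rightarrow> real \<Rightarrow> real" where
  "score n X w = (\<Sum>i=1..n. score_term w (X i))"

lemma mixture_density_eq:
  "(1 - w) * gauss x + w * slab_density x = gauss x * (1 + w * (lik_ratio x - 1))"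
  by (simp add: slab_density_eq algebra_simps)

lemma mixture_density_pos:
  assumes "0 \<le> w" "w \<le> 1"
  shows "0 < (1 - w) * gauss x + w * slab_density x"
  unfolding mixture_density_eq using score_denom_pos[OF assms, of x] gauss_pos[of x] by simp

text \<open>Concavity in the form used later: the ratio \<open>R\<close> of the mixture densities
  satisfies \<open>R - 1 = (w - a) * score_term a x\<close> exactly, so the tangent bound is
  \<open>ln R \<le> R - 1\<close>, strict unless \<open>R = 1\<close>.\<close>

lemma log_mixture_tangent:
  fixes x :: real
  assumes a: "0 \<le> a" "a \<le> 1" and w: "0 \<le> w" "w \<le> 1"
  defines "l \<equiv> (\<lambda>w. ln ((1 - w) * gauss x + w * slab_density x))"
  shows "l w \<le> l a + (w - a) * score_term a x"
    and "w \<noteq> a \<Longrightarrow> lik_ratio x \<noteq> 1 \<Longrightarrow> l w < l a + (w - a) * score_term a x"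
proof -
  define R where "R = (1 + w * (lik_ratio x - 1)) / (1 + a * (lik_ratio x - 1))"
  have da: "0 < 1 + a * (lik_ratio x - 1)" and dw: "0 < 1 + w * (lik_ratio x - 1)"
    using score_denom_pos a w by auto
  have "0 < R" using da dw by (simp add: R_def)
  have R1: "R - 1 = (w - a) * score_term a x"
    using da by (simp add: R_def score_term_def field_simps)
  have l: "l w - l a = ln R"
    using da dw gauss_pos[of x] unfolding l_def mixture_density_eq R_def
    by (simp add: ln_mult ln_div)
  show "l w \<le> l a + (w - a) * score_term a x"
    using ln_le_minus_one[OF \<open>0 < R\<close>] R1 l by linarith
  assume "w \<noteq> a" "lik_ratio x \<noteq> 1"
  then have "R \<noteq> 1" using R1 da by (auto simp: score_term_def)
  then have "ln R \<noteq> R - 1" using ln_eq_minus_one[OF \<open>0 < R\<close>] by auto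
  then show "l w < l a + (w - a) * score_term a x"
    using ln_le_minus_one[OF \<open>0 < R\<close>] R1 l by linarith
qed

lemma log_lik_tangent:
  assumes "0 \<le> a" "a \<le> 1" "0 \<le> w" "w \<le> 1"
  shows "log_lik n X w \<le> log_lik n X a + (w - a) * score n X a"
  unfolding log_lik_def score_def sum_distrib_left sum.distrib[symmetric]
  using assms by (intro sum_mono log_mixture_tangent(1))

lemma log_lik_tangent_strict:
  assumes "0 \<le> a" "a \<le> 1" "0 \<le> w" "w \<le> 1" "w \<noteq> a" "i \<in> {1..n}" "lik_ratio (X i) \<noteq> 1"
  shows "log_lik n X w < log_lik n X a + (w - a) * score n X a"
  unfolding log_lik_def score_def sum_distrib_left sum.distrib[symmetric]
  using assms by (intro sum_strict_mono_ex1 ballI log_mixture_tangent(1) bexI[of _ i] log_mixture_tangent(2)) auto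

text \<open>Continuity on a compact interval supplies a maximiser; only then is the choice made by
  \<open>arg_max_on\<close> known to be one.\<close>

lemma w_hat_argmax:
  assumes "1 \<le> n"
  shows "w_hat n X \<in> {1 / real n..1}" "\<And>w. w \<in> {1 / real n..1} \<Longrightarrow> log_lik n X w \<le> log_lik n X (w_hat n X)"
proof -
  have "continuous_on {1 / real n..1} (log_lik n X)"
    unfolding log_lik_def[abs_def]
  proof (intro continuous_intros ballI)
    fix i w assume "w \<in> {1 / real n..1}"
    then have "0 \<le> w" "w \<le> 1" by (auto intro: order_trans[rotated])
    then show "(1 - w) * gauss (X i) + w * slab_density (X i) \<noteq> 0"
      using mixture_density_pos[of w "X i"] by simp
  qed
  moreover have "{1 / real n..1} \<noteq> {}" using assms by simp
  ultimately obtain w0 where w0: "w0 \<in> {1 / real n..1}" "\<And>w. w \<in> {1 / real n..1} \<Longrightarrow> log_lik n X w \<le> log_lik n X w0"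
    using continuous_attains_sup[of "{1 / real n..1}" "log_lik n X"] by auto
  have eq: "w_hat n X = arg_max (log_lik n X) (\<lambda>w. w \<in> {1 / real n..1})"
    by (simp add: w_hat_def arg_max_on_def log_lik_def[abs_def])
  have "w_hat n X \<in> {1 / real n..1} \<and> (\<forall>w\<in>{1 / real n..1}. log_lik n X w \<le> log_lik n X (w_hat n X))"
    unfolding eq by (rule arg_maxI[where x=w0 and f="log_lik n X"]) (use w0 in \<open>auto simp: not_less\<close>)
  then show "w_hat n X \<in> {1 / real n..1}" "\<And>w. w \<in> {1 / real n..1} \<Longrightarrow> log_lik n X w \<le> log_lik n X (w_hat n X)"
    by auto
qed

lemma w_hat_bounds:
  assumes "1 \<le> n"
  shows "0 < w_hat n X" "1 / real n \<le> w_hat n X" "w_hat n X \<le> 1"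
proof -
  show *: "1 / real n \<le> w_hat n X" "w_hat n X \<le> 1" using w_hat_argmax(1)[OF assms, of X] by auto
  show "0 < w_hat n X" by (rule less_le_trans[OF _ *(1)]) (use assms in simp)
qed

text \<open>A positive score at \<open>a\<close> makes every smaller weight strictly worse than
  \<open>a\<close>. A zero score suffices once some observation has \<open>lik_ratio\<close>
  different from 1, since the tangent bound is then strict. For \<open>a < 1 / n\<close> the claim
  is contained in the range of \<open>w_hat\<close>.\<close>

lemma w_hat_ge:
  assumes n: "1 \<le> n" and a: "a \<le> 1"
    and s: "0 < score n X a \<or> 0 \<le> score n X a \<and> (\<exists>i\<in>{1..n}. lik_ratio (X i) \<noteq> 1)"
  shows "a \<le> w_hat n X"
proof (rule ccontr)
  assume "\<not> a \<le> w_hat n X"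
  define w where "w = w_hat n X"
  have w: "w < a" "0 < w" "1 / real n \<le> w" "w \<le> 1" using \<open>\<not> a \<le> w_hat n X\<close> w_hat_bounds[OF n, of X] by (auto simp: w_def)
  then have "log_lik n X a \<le> log_lik n X w"
    using w_hat_argmax(2)[OF n, of a X] a by (simp add: w_def)
  moreover have "log_lik n X w < log_lik n X a"
    using s
  proof
    assume "0 < score n X a"
    then have "(w - a) * score n X a < 0" using w by (intro mult_neg_pos) auto
    then show ?thesis using log_lik_tangent[of a w n X] w a by linarith
  next
    assume *: "0 \<le> score n X a \<and> (\<exists>i\<in>{1..n}. lik_ratio (X i) \<noteq> 1)"
    then have "(w - a) * score n X a \<le> 0" using w by (intro mult_nonpos_nonneg) auto
    then show ?thesis using * log_lik_tangent_strict[of a w _ n X] w a by force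
  qed
  ultimately show False by simp
qed

lemma w_hat_le:
  assumes n: "1 \<le> n" and a: "1 / real n \<le> a" "a \<le> 1"
    and s: "score n X a < 0 \<or> score n X a \<le> 0 \<and> (\<exists>i\<in>{1..n}. lik_ratio (X i) \<noteq> 1)"
  shows "w_hat n X \<le> a"
proof (rule ccontr)
  assume "\<not> w_hat n X \<le> a"
  define w where "w = w_hat n X"
  have w: "a < w" "0 < w" "w \<le> 1" using \<open>\<not> w_hat n X \<le> a\<close> w_hat_bounds[OF n, of X] by (auto simp: w_def)
  have a0: "0 < a" by (rule less_le_trans[OF _ a(1)]) (use n in simp)
  have "log_lik n X a \<le> log_lik n X w"
    using w_hat_argmax(2)[OF n, of a X] a by (simp add: w_def)
  moreover have "log_lik n X w < log_lik n X a"
    using s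
  proof
    assume "score n X a < 0"
    then have "(w - a) * score n X a < 0" using w by (intro mult_pos_neg) auto
    then show ?thesis using log_lik_tangent[of a w n X] w a a0 by linarith
  next
    assume *: "score n X a \<le> 0 \<and> (\<exists>i\<in>{1..n}. lik_ratio (X i) \<noteq> 1)"
    then have "(w - a) * score n X a \<le> 0" using w by (intro mult_nonneg_nonpos) auto
    then show ?thesis using * log_lik_tangent_strict[of a w _ n X] w a a0 by force
  qed
  ultimately show False by simp
qed

lemma score_measurable [measurable]:
  "(\<lambda>X. score n X w) \<in> borel_measurable (Pi\<^sub>M {1..n} (\<lambda>_. borel))"
  unfolding score_def by measurable

text \<open>This serves measurability: the maximiser is described by countably many conditions on
  scores at fixed rational weights, each measurable in the data.\<close>

lemma w_hat_ge_iff: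
  assumes n: "1 \<le> n" and i: "\<exists>i\<in>{1..n}. lik_ratio (X i) \<noteq> 1" and a: "a \<le> 1"
  shows "a \<le> w_hat n X \<longleftrightarrow> (\<forall>b::rat. 1 / real n < of_rat b \<and> of_rat b < a \<longrightarrow> 0 < score n X (of_rat b))"
proof (intro iffI allI impI)
  fix b :: rat
  assume "a \<le> w_hat n X" and b: "1 / real n < of_rat b \<and> of_rat b < a"
  show "0 < score n X (of_rat b)"
  proof (rule ccontr)
    assume "\<not> 0 < score n X (of_rat b)"
    moreover have "real_of_rat b \<le> 1" using b a by linarith
    ultimately have "w_hat n X \<le> of_rat b"
      using i b by (intro w_hat_le n) auto
    then show False using b \<open>a \<le> w_hat n X\<close> by simp
  qed
next
  assume *: "\<forall>b::rat. 1 / real n < of_rat b \<and> of_rat b < a \<longrightarrow> 0 < score n X (of_rat b)"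
  show "a \<le> w_hat n X"
  proof (rule ccontr)
    assume "\<not> a \<le> w_hat n X"
    then obtain b where b: "w_hat n X < of_rat b" "of_rat b < a"
      using of_rat_dense[of "w_hat n X" a] by auto
    moreover have "1 / real n \<le> w_hat n X" by (rule w_hat_bounds[OF n])
    ultimately have "0 < score n X (of_rat b)" using * by auto
    moreover have "real_of_rat b \<le> 1" using b a by linarith
    ultimately have "of_rat b \<le> w_hat n X"
      by (intro w_hat_ge n) auto
    then show False using b by simp
  qed
qed

lemma sets_finite_subset_PiE:
  fixes A :: "(nat \<Rightarrow> real) set"
  assumes "finite A" "A \<subseteq> {1..n} \<rightarrow>\<^sub>E UNIV"
  shows "A \<in> sets (Pi\<^sub>M {1..n} (\<lambda>_. borel))"
proof (rule sets.countable)
  show "countable A" using assms by (simp add: countable_finite)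
  fix x assume "x \<in> A"
  then have "{x} = Pi\<^sub>E {1..n} (\<lambda>i. {x i})"
    using assms by (subst PiE_singleton) (auto simp: PiE_iff)
  then show "{x} \<in> sets (Pi\<^sub>M {1..n} (\<lambda>_. borel))"
    by (simp add: sets_PiM_I_finite)
qed

text \<open>The value of \<open>w_hat\<close> is an arbitrary choice only when \<open>lik_ratio (X i) = 1\<close> for all \<open>i\<close>. This happens on a
  finite set of observations, all of whose subsets are measurable.\<close>
lemma w_hat_measurable [measurable]:
  assumes n: "1 \<le> n"
  shows "w_hat n \<in> borel_measurable (Pi\<^sub>M {1..n} (\<lambda>_. borel))"
proof (rule borel_measurableI_ge)
  fix a :: real
  let ?M = "Pi\<^sub>M {1..n} (\<lambda>_. borel :: real measure)"
  define A where "A = {X \<in> space ?M. \<forall>i\<in>{1..n}. lik_ratio (X i) = 1}"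
  have "A = ({1..n} \<rightarrow>\<^sub>E {x. lik_ratio x = 1})"
    by (simp add: A_def space_PiM set_eq_iff PiE_iff) blast
  then have "finite A" using finite_lik_ratio_eq_1 by (simp add: finite_PiE)
  have A_sub: "A \<subseteq> {1..n} \<rightarrow>\<^sub>E UNIV" by (auto simp: A_def space_PiM)
  have fin: "B \<in> sets ?M" if "B \<subseteq> A" for B
    using that A_sub \<open>finite A\<close> by (intro sets_finite_subset_PiE) (auto intro: finite_subset)
  show "{X \<in> space ?M. a \<le> w_hat n X} \<in> sets ?M"
  proof (cases "a \<le> 1")
    case True
    have "{X \<in> space ?M. a \<le> w_hat n X} = ({X \<in> space ?M. \<forall>b::rat. 1 / real n < of_rat b \<and> of_rat b < a \<longrightarrow> 0 < score n X (of_rat b)} - A)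
        \<union> {X \<in> A. a \<le> w_hat n X}"
      using w_hat_ge_iff[OF n _ True] by (fastforce simp: A_def)
    also have "\<dots> \<in> sets ?M"
    proof -
      have "{X \<in> space ?M. \<forall>b::rat. 1 / real n < of_rat b \<and> of_rat b < a \<longrightarrow> 0 < score n X (of_rat b)} \<in> sets ?M"
        by measurable
      moreover have "A \<in> sets ?M" "{X \<in> A. a \<le> w_hat n X} \<in> sets ?M"
        by (rule fin; blast)+
      ultimately show ?thesis by (intro sets.Un sets.Diff)
    qed
    finally show ?thesis .
  next
    case False
    then have "w_hat n X < a" for X
      using w_hat_bounds(3)[OF n, of X] by linarith
    then have "{X \<in> space ?M. a \<le> w_hat n X} = {}"
      by (auto simp: not_le)
    then show ?thesis by (simp only: sets.empty_sets)
  qed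
qed

section \<open>Moments under independent Gaussian noise\<close>

abbreviation noise :: "nat \<Rightarrow> (nat \<Rightarrow> real) measure" where
  "noise n \<equiv> Pi\<^sub>M {1..n} (\<lambda>_. gauss_measure)"

interpretation noise_product: product_prob_space "\<lambda>_::nat. gauss_measure" UNIV
  by unfold_locales

interpretation noise: prob_space "noise n" for n
  by (rule prob_space_PiM) (rule gauss_prob.prob_space_axioms)

lemma sets_noise [measurable_cong]: "sets (noise n) = sets (Pi\<^sub>M {1..n} (\<lambda>_. borel))"
  by (intro sets_PiM_cong) auto

lemma integral_noise_component:
  fixes f :: "real \<Rightarrow> real"
  assumes i: "i \<in> {1..n}" and f [measurable]: "f \<in> borel_measurable borel"
  shows "(\<integral>e. f (e i) \<partial>noise n) = (\<integral>x. f x \<partial>gauss_measure)"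
proof -
  have "(\<integral>x. f x \<partial>gauss_measure) = (\<integral>x. f x \<partial>distr (noise n) gauss_measure (\<lambda>e. e i))"
    using i by (subst distr_PiM_component) (auto intro: gauss_prob.prob_space_axioms)
  also have "\<dots> = (\<integral>e. f (e i) \<partial>noise n)"
    using i by (subst integral_distr) auto
  finally show ?thesis ..
qed

lemma integrable_noise_bounded:
  fixes f :: "(nat \<Rightarrow> real) \<Rightarrow> real"
  assumes "f \<in> borel_measurable (Pi\<^sub>M {1..n} (\<lambda>_. borel))" "\<And>e. \<bar>f e\<bar> \<le> B"
  shows "integrable (noise n) f"
  using assms by (intro noise.integrable_const_bound[where B=B]) (auto simp: measurable_cong_sets[OF sets_noise])

lemma integral_noise_two_components:
  fixes f g :: "real \<Rightarrow> real"
  assumes ij: "i \<in> {1..n}" "j \<in> {1..n}" "i \<noteq> j"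
    and f: "integrable gauss_measure f" and g: "integrable gauss_measure g"
  shows "(\<integral>e. f (e i) * g (e j) \<partial>noise n) = (\<integral>x. f x \<partial>gauss_measure) * (\<integral>x. g x \<partial>gauss_measure)"
proof -
  \<comment> \<open>The remaining coordinates carry the constant 1, so the product formula over all
    coordinates leaves two nontrivial factors.\<close>
  define h where "h k = (if k = i then f else if k = j then g else (\<lambda>_. 1))" for k
  have prod: "(\<Prod>k\<in>{1..n}. F k) = F i * F j" if "\<And>k. k \<noteq> i \<Longrightarrow> k \<noteq> j \<Longrightarrow> F k = 1" for F :: "nat \<Rightarrow> real"
  proof -
    have "(\<Prod>k\<in>{1..n}. F k) = (\<Prod>k\<in>{i, j}. F k)"
      using ij that by (intro prod.mono_neutral_right) auto
    then show ?thesis using ij by simp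
  qed
  have "(\<integral>e. (\<Prod>k\<in>{1..n}. h k (e k)) \<partial>noise n) = (\<Prod>k\<in>{1..n}. integral\<^sup>L gauss_measure (h k))"
    using f g by (intro noise_product.product_integral_prod) (auto simp: h_def)
  also have "(\<lambda>e. \<Prod>k\<in>{1..n}. h k (e k)) = (\<lambda>e. f (e i) * g (e j))"
    using ij by (subst prod) (auto simp: h_def fun_eq_iff)
  also have "(\<Prod>k\<in>{1..n}. integral\<^sup>L gauss_measure (h k)) = (\<integral>x. f x \<partial>gauss_measure) * (\<integral>x. g x \<partial>gauss_measure)"
    using ij by (subst prod) (auto simp: h_def gauss_prob.prob_space[simplified])
  finally show ?thesis .
qed

text \<open>Centred independent summands are orthogonal. The variance is relaxed to raw second
  moments because these are what \<open>score_term_square_le\<close> and indicators provide.\<close>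

lemma noise_sum_moments:
  fixes f :: "nat \<Rightarrow> real \<Rightarrow> real"
  assumes A: "A \<subseteq> {1..n}"
    and f [measurable]: "\<And>i. f i \<in> borel_measurable borel" and bnd: "\<And>i x. \<bar>f i x\<bar> \<le> B"
  defines "\<mu> \<equiv> \<Sum>i\<in>A. \<integral>x. f i x \<partial>gauss_measure"
  shows "(\<integral>e. (\<Sum>i\<in>A. f i (e i)) \<partial>noise n) = \<mu>"
    and "(\<integral>e. ((\<Sum>i\<in>A. f i (e i)) - \<mu>)\<^sup>2 \<partial>noise n) \<le> (\<Sum>i\<in>A. \<integral>x. (f i x)\<^sup>2 \<partial>gauss_measure)"
proof -
  have finA: "finite A" using A by (rule finite_subset) simp
  have fm: "(\<lambda>e. f i (e i)) \<in> borel_measurable (Pi\<^sub>M {1..n} (\<lambda>_. borel))" if "i \<in> A" for i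
    using that A by (intro measurable_compose[OF _ f] measurable_component_singleton) auto
  have int: "integrable (noise n) (\<lambda>e. f i (e i))" if "i \<in> A" for i
    using fm[OF that] bnd by (rule integrable_noise_bounded)
  show "(\<integral>e. (\<Sum>i\<in>A. f i (e i)) \<partial>noise n) = \<mu>"
  proof -
    have "(\<integral>e. (\<Sum>i\<in>A. f i (e i)) \<partial>noise n) = (\<Sum>i\<in>A. \<integral>e. f i (e i) \<partial>noise n)"
      using int by (rule Bochner_Integration.integral_sum)
    also have "\<dots> = \<mu>"
      unfolding \<mu>_def using A f by (intro sum.cong refl integral_noise_component) auto
    finally show ?thesis .
  qed
  define m where "m i = (\<integral>x. f i x \<partial>gauss_measure)" for i
  define g where "g i x = f i x - m i" for i x
  have gm: "g i \<in> borel_measurable borel" for i unfolding g_def by measurable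
  have B0: "0 \<le> B" by (rule order_trans[OF abs_ge_zero bnd])
  have mB: "\<bar>m i\<bar> \<le> B" for i
  proof -
    have "\<bar>m i\<bar> \<le> (\<integral>x. \<bar>f i x\<bar> \<partial>gauss_measure)"
      unfolding m_def by (rule integral_abs_bound)
    also have "\<dots> \<le> (\<integral>x. B \<partial>gauss_measure)"
      by (intro integral_mono integrable_gauss_measure_bounded[where B=B] bnd) (auto simp: bnd B0)
    finally show ?thesis by (simp add: gauss_prob.prob_space[simplified])
  qed
  have gB: "\<bar>g i x\<bar> \<le> 2 * B" for i x
    unfolding g_def using bnd[of i x] mB[of i] by linarith
  have gi: "integrable gauss_measure (g i)" for i
    by (rule integrable_gauss_measure_bounded[OF gm gB])
  have fi: "integrable gauss_measure (f i)" for i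
    by (rule integrable_gauss_measure_bounded[OF f bnd])
  have g0: "(\<integral>x. g i x \<partial>gauss_measure) = 0" for i
    unfolding g_def using fi by (simp add: m_def gauss_prob.prob_space[simplified])
  have gmn: "(\<lambda>e. g i (e i)) \<in> borel_measurable (Pi\<^sub>M {1..n} (\<lambda>_. borel))" if "i \<in> A" for i
    using that A by (intro measurable_compose[OF _ gm] measurable_component_singleton) auto
  have ggi: "integrable (noise n) (\<lambda>e. g i (e i) * g j (e j))" if "i \<in> A" "j \<in> A" for i j
  proof (rule integrable_noise_bounded)
    show "\<bar>g i (e i) * g j (e j)\<bar> \<le> (2 * B) * (2 * B)" for e
      unfolding abs_mult by (intro mult_mono gB) (use B0 in auto)
  qed (use gmn that in auto)
  have "(\<integral>e. ((\<Sum>i\<in>A. f i (e i)) - \<mu>)\<^sup>2 \<partial>noise n) = (\<integral>e. (\<Sum>i\<in>A. \<Sum>j\<in>A. g i (e i) * g j (e j)) \<partial>noise n)"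
  proof -
    have "(\<Sum>i\<in>A. f i (e i)) - \<mu> = (\<Sum>i\<in>A. g i (e i))" for e
      by (simp add: \<mu>_def g_def m_def sum_subtractf)
    then show ?thesis by (simp only: power2_eq_square sum_product)
  qed
  also have "\<dots> = (\<Sum>i\<in>A. \<Sum>j\<in>A. \<integral>e. g i (e i) * g j (e j) \<partial>noise n)"
    using ggi by (subst Bochner_Integration.integral_sum)
      (auto intro!: sum.cong Bochner_Integration.integrable_sum Bochner_Integration.integral_sum)
  also have "\<dots> = (\<Sum>i\<in>A. \<Sum>j\<in>A. if j = i then \<integral>x. (g i x)\<^sup>2 \<partial>gauss_measure else 0)"
  proof (intro sum.cong refl)
    fix i j assume ij: "i \<in> A" "j \<in> A"
    show "(\<integral>e. g i (e i) * g j (e j) \<partial>noise n) = (if j = i then \<integral>x. (g i x)\<^sup>2 \<partial>gauss_measure else 0)"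
    proof (cases "j = i")
      case True
      have "(\<integral>e. (g i (e i))\<^sup>2 \<partial>noise n) = (\<integral>x. (g i x)\<^sup>2 \<partial>gauss_measure)"
        using ij A gm by (intro integral_noise_component) auto
      then show ?thesis using True by (simp add: power2_eq_square)
    next
      case False
      then show ?thesis
        using ij A by (subst integral_noise_two_components) (auto simp: gi g0)
    qed
  qed
  also have "\<dots> = (\<Sum>i\<in>A. \<integral>x. (g i x)\<^sup>2 \<partial>gauss_measure)"
    using finA by simp
  also have "\<dots> \<le> (\<Sum>i\<in>A. \<integral>x. (f i x)\<^sup>2 \<partial>gauss_measure)"
  proof (rule sum_mono)
    fix i
    have f2: "integrable gauss_measure (\<lambda>x. (f i x)\<^sup>2)"
    proof (rule integrable_gauss_measure_bounded)
      show "\<bar>(f i x)\<^sup>2\<bar> \<le> B\<^sup>2" for x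
        using power_mono[OF bnd, of i x 2] by simp
    qed measurable
    have "(\<integral>x. (g i x)\<^sup>2 \<partial>gauss_measure) = (\<integral>x. (f i x)\<^sup>2 \<partial>gauss_measure) - (m i)\<^sup>2"
      unfolding g_def power2_diff using f2 fi
      by (simp add: m_def[symmetric] gauss_prob.prob_space[simplified] power2_eq_square)
    then show "(\<integral>x. (g i x)\<^sup>2 \<partial>gauss_measure) \<le> (\<integral>x. (f i x)\<^sup>2 \<partial>gauss_measure)" by simp
  qed
  finally show "(\<integral>e. ((\<Sum>i\<in>A. f i (e i)) - \<mu>)\<^sup>2 \<partial>noise n) \<le> (\<Sum>i\<in>A. \<integral>x. (f i x)\<^sup>2 \<partial>gauss_measure)" .
qed

lemma noise_sum_Chebyshev:
  fixes f :: "nat \<Rightarrow> real \<Rightarrow> real"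
  assumes A: "A \<subseteq> {1..n}"
    and f [measurable]: "\<And>i. f i \<in> borel_measurable borel" and bnd: "\<And>i x. \<bar>f i x\<bar> \<le> B"
    and c: "0 < c"
  defines "\<mu> \<equiv> \<Sum>i\<in>A. \<integral>x. f i x \<partial>gauss_measure"
  shows "noise.prob n {e \<in> space (noise n). c \<le> \<bar>(\<Sum>i\<in>A. f i (e i)) - \<mu>\<bar>} \<le> (\<Sum>i\<in>A. \<integral>x. (f i x)\<^sup>2 \<partial>gauss_measure) / c\<^sup>2"
proof -
  let ?S = "\<lambda>e. \<Sum>i\<in>A. f i (e i)"
  have m: "?S \<in> borel_measurable (Pi\<^sub>M {1..n} (\<lambda>_. borel))"
    using A by (intro borel_measurable_sum measurable_compose[OF _ f] measurable_component_singleton) auto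
  then have m': "?S \<in> borel_measurable (noise n)" by (simp add: measurable_cong_sets[OF sets_noise])
  have S_bnd: "\<bar>?S e\<bar> \<le> card A * B" for e
    by (rule order_trans[OF sum_abs sum_bounded_above]) (rule bnd)
  have "integrable (noise n) (\<lambda>e. (?S e)\<^sup>2)"
  proof (rule integrable_noise_bounded)
    show "\<bar>(?S e)\<^sup>2\<bar> \<le> (card A * B)\<^sup>2" for e
      using power_mono[OF S_bnd, of e 2] by simp
  qed (use m in measurable)
  then have "noise.prob n {e \<in> space (noise n). c \<le> \<bar>?S e - noise.expectation n ?S\<bar>} \<le> noise.variance n ?S / c\<^sup>2"
    by (intro noise.Chebyshev_inequality m' c)
  moreover have "noise.expectation n ?S = \<mu>"
    unfolding \<mu>_def by (rule noise_sum_moments(1)[OF A f bnd])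
  moreover have "noise.variance n ?S / c\<^sup>2 \<le> (\<Sum>i\<in>A. \<integral>x. (f i x)\<^sup>2 \<partial>gauss_measure) / c\<^sup>2"
    using noise_sum_moments[OF A f bnd] by (intro divide_right_mono) auto
  ultimately show ?thesis by simp
qed

section \<open>False and missed discoveries\<close>

declare One_nat_def [simp del] \<comment> \<open>keeps the simplifier from rewriting \<open>{1..n}\<close> to \<open>{Suc 0..n}\<close>\<close>

abbreviation observe :: "nat \<Rightarrow> (nat \<Rightarrow> real) \<Rightarrow> (nat \<Rightarrow> real) \<Rightarrow> nat \<Rightarrow> real" where
  "observe n \<theta> e \<equiv> (\<lambda>i\<in>{1..n}. \<theta> i + e i)"

lemma observe_measurable [measurable]: "observe n \<theta> \<in> measurable (noise n) (Pi\<^sub>M {1..n} (\<lambda>_. borel))"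
  by (intro measurable_restrict) measurable

lemma integral_data_law:
  fixes f :: "(nat \<Rightarrow> real) \<Rightarrow> real"
  assumes "f \<in> borel_measurable (Pi\<^sub>M {1..n} (\<lambda>_. borel))"
  shows "(\<integral>X. f X \<partial>data_law n \<theta>) = (\<integral>e. f (observe n \<theta> e) \<partial>noise n)"
  unfolding data_law_def using assms observe_measurable[where n=n and \<theta>=\<theta>] by (subst integral_distr) auto

lemma q_value_procedure_measurable [measurable]:
  assumes "1 \<le> n" "i \<in> {1..n}"
  shows "Measurable.pred (Pi\<^sub>M {1..n} (\<lambda>_. borel)) (\<lambda>X. q_value_procedure n t X i)"
  unfolding q_value_procedure_def
  using assms by measurable

abbreviation q_FDR :: "nat \<Rightarrow> real \<Rightarrow> (nat \<Rightarrow> real) \<Rightarrow> real" where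
  "q_FDR n t \<theta> \<equiv> FDR n (q_value_procedure n t) \<theta>"

abbreviation q_FNR :: "nat \<Rightarrow> real \<Rightarrow> (nat \<Rightarrow> real) \<Rightarrow> real" where
  "q_FNR n t \<theta> \<equiv> FNR n (q_value_procedure n t) \<theta>"

lemma FDR_eq:
  assumes n: "1 \<le> n"
  shows "q_FDR n t \<theta> =
    (\<integral>e. (\<Sum>i=1..n. of_bool (\<theta> i = 0 \<and> q_value_procedure n t (observe n \<theta> e) i)) /
      max 1 (\<Sum>i=1..n. of_bool (q_value_procedure n t (observe n \<theta> e) i)) \<partial>noise n)"
proof -
  have "(\<lambda>X. of_bool (q_value_procedure n t X i) :: real) \<in> borel_measurable (Pi\<^sub>M {1..n} (\<lambda>_. borel))"
     "(\<lambda>X. of_bool (\<theta> i = 0 \<and> q_value_procedure n t X i) :: real) \<in> borel_measurable (Pi\<^sub>M {1..n} (\<lambda>_. borel))"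
    if "i \<in> {1..n}" for i
    using q_value_procedure_measurable[OF n that, of t] by measurable
  then show ?thesis
    unfolding FDR_def by (intro integral_data_law borel_measurable_divide borel_measurable_max borel_measurable_sum) auto
qed

lemma FNR_eq:
  assumes n: "1 \<le> n"
  shows "q_FNR n t \<theta> =
    (\<integral>e. (\<Sum>i=1..n. of_bool (\<theta> i \<noteq> 0 \<and> \<not> q_value_procedure n t (observe n \<theta> e) i)) /
      max 1 (\<Sum>i=1..n. of_bool (\<theta> i \<noteq> 0)) \<partial>noise n)"
proof -
  have "(\<lambda>X. of_bool (\<theta> i \<noteq> 0 \<and> \<not> q_value_procedure n t X i) :: real) \<in> borel_measurable (Pi\<^sub>M {1..n} (\<lambda>_. borel))"
    if "i \<in> {1..n}" for i
    using q_value_procedure_measurable[OF n that, of t] by measurable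
  then show ?thesis
    unfolding FNR_def by (intro integral_data_law borel_measurable_divide borel_measurable_max borel_measurable_sum) auto
qed

section \<open>The false discovery proportion as a function of the false count\<close>

lemma fraction_mono:
  fixes x y s :: real
  assumes "0 \<le> x" "x \<le> y" "0 < s"
  shows "x / (x + s) \<le> y / (y + s)"
  using assms by (simp add: divide_simps algebra_simps)

text \<open>Later \<open>z\<close> is the indicator of the event that the fitted weight leaves its
  range; on it the fraction is merely known to be at most 1.\<close>

lemma fraction_le_plus_exception:
  fixes x y s z :: real
  assumes "0 \<le> x" "0 \<le> y" "0 < s" "0 \<le> z" "x \<le> y \<or> z = 1"
  shows "x / (x + s) \<le> y / (y + s) + z"
proof (cases "x \<le> y")
  case True
  then show ?thesis using fraction_mono[of x y s] assms by linarith
next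
  case False
  have "x / (x + s) \<le> 1" "0 \<le> y / (y + s)" using assms by (auto simp: divide_simps)
  then show ?thesis using False assms by linarith
qed

text \<open>The remainder of the tangent line at \<mu> is computed exactly. Here its sign is used;
  \<open>fraction_tangent_lower\<close> bounds its factor \<open>s / (x + s)\<close> by 1.\<close>

lemma fraction_tangent_upper:
  fixes x \<mu> s :: real
  assumes "0 \<le> x" "0 \<le> \<mu>" "0 < s"
  shows "x / (x + s) \<le> \<mu> / (\<mu> + s) + s / (\<mu> + s)\<^sup>2 * (x - \<mu>)"
proof -
  have eq: "x / (x + s) - \<mu> / (\<mu> + s) = s / (\<mu> + s)\<^sup>2 * (x - \<mu>) - s * (x - \<mu>)\<^sup>2 / ((\<mu> + s)\<^sup>2 * (x + s))"
    using assms by (simp add: divide_simps power2_eq_square) (simp add: algebra_simps)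
  have "0 \<le> s * (x - \<mu>)\<^sup>2 / ((\<mu> + s)\<^sup>2 * (x + s))"
    using assms by (intro divide_nonneg_nonneg mult_nonneg_nonneg) auto
  then show ?thesis using eq by linarith
qed

lemma fraction_tangent_lower:
  fixes x \<mu> s :: real
  assumes "0 \<le> x" "0 \<le> \<mu>" "0 < s"
  shows "\<mu> / (\<mu> + s) + s / (\<mu> + s)\<^sup>2 * (x - \<mu>) - (x - \<mu>)\<^sup>2 / (\<mu> + s)\<^sup>2 \<le> x / (x + s)"
proof -
  have eq: "x / (x + s) - \<mu> / (\<mu> + s) = s / (\<mu> + s)\<^sup>2 * (x - \<mu>) - s * (x - \<mu>)\<^sup>2 / ((\<mu> + s)\<^sup>2 * (x + s))"
    using assms by (simp add: divide_simps power2_eq_square) (simp add: algebra_simps)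
  have "s / (x + s) * ((x - \<mu>)\<^sup>2 / (\<mu> + s)\<^sup>2) \<le> 1 * ((x - \<mu>)\<^sup>2 / (\<mu> + s)\<^sup>2)"
    using assms by (intro mult_right_mono) auto
  moreover have "s / (x + s) * ((x - \<mu>)\<^sup>2 / (\<mu> + s)\<^sup>2) = s * (x - \<mu>)\<^sup>2 / ((\<mu> + s)\<^sup>2 * (x + s))"
    by (simp add: mult_ac)
  ultimately show ?thesis using eq by linarith
qed

text \<open>Jensen's inequality for the concave function \<open>x / (x + s)\<close>, with a second-order converse: for a sum of
  independent indicators the variance is at most the mean, which leaves an error of only \<open>1 / s\<close>.\<close>
lemma expected_fraction_bounds:
  fixes s :: real
  assumes A: "A \<subseteq> {1..n}" and P [measurable]: "Measurable.pred borel P" and s: "0 < s"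
  defines "N \<equiv> (\<lambda>e. \<Sum>i\<in>A. of_bool (P (e i)) :: real)"
    and "\<mu> \<equiv> card A * gauss_prob.prob {x. P x}"
  shows "(\<integral>e. N e / (N e + s) \<partial>noise n) \<le> \<mu> / (\<mu> + s)"
    and "\<mu> / (\<mu> + s) - 1 / s \<le> (\<integral>e. N e / (N e + s) \<partial>noise n)"
proof -
  define f where "f = (\<lambda>(i::nat) x. of_bool (P x) :: real)"
  have fm [measurable]: "f i \<in> borel_measurable borel" for i unfolding f_def by measurable
  have fb: "\<bar>f i x\<bar> \<le> 1" for i x by (simp add: f_def)
  have N_f: "N e = (\<Sum>i\<in>A. f i (e i))" for e by (simp add: N_def f_def)
  have fi: "(\<integral>x. f i x \<partial>gauss_measure) = gauss_prob.prob {x. P x}" for i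
  proof -
    have "(\<integral>x. f i x \<partial>gauss_measure) = (\<integral>x. indicator {x. P x} x \<partial>gauss_measure)"
      by (intro Bochner_Integration.integral_cong) (auto simp: indicator_def f_def)
    then show ?thesis by simp
  qed
  have f2: "(\<lambda>x. (f i x)\<^sup>2) = f i" for i by (auto simp: f_def fun_eq_iff)
  have \<mu>0: "0 \<le> \<mu>" by (simp add: \<mu>_def)
  have N0: "0 \<le> N e" for e by (simp add: N_def sum_nonneg)
  have Ncard: "N e \<le> card A" for e
    unfolding N_def using sum_bounded_above[of A "\<lambda>i. of_bool (P (e i)) :: real" 1] by simp
  have Nm [measurable]: "N \<in> borel_measurable (Pi\<^sub>M {1..n} (\<lambda>_. borel))"
    unfolding N_f[abs_def] using A
    by (intro borel_measurable_sum measurable_compose[OF _ fm] measurable_component_singleton) auto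
  have EN: "(\<integral>e. N e \<partial>noise n) = \<mu>"
    unfolding N_f using noise_sum_moments(1)[of A n f 1] A fb by (simp add: fi \<mu>_def)
  have VN: "(\<integral>e. (N e - \<mu>)\<^sup>2 \<partial>noise n) \<le> \<mu>"
    unfolding N_f using noise_sum_moments(2)[of A n f 1] A fb by (simp add: fi f2 \<mu>_def)
  have iN: "integrable (noise n) N"
    by (rule integrable_noise_bounded[where B="card A"]) (use N0 Ncard in auto)
  have iN2: "integrable (noise n) (\<lambda>e. (N e - \<mu>)\<^sup>2)"
  proof (rule integrable_noise_bounded)
    fix e
    have "\<bar>N e - \<mu>\<bar> \<le> card A + \<mu>" using N0[of e] Ncard[of e] \<mu>0 by linarith
    from power_mono[OF this, of 2] show "\<bar>(N e - \<mu>)\<^sup>2\<bar> \<le> (card A + \<mu>)\<^sup>2" by simp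
  qed measurable
  have iF: "integrable (noise n) (\<lambda>e. N e / (N e + s))"
    by (rule integrable_noise_bounded[where B=1]) (use N0 s in \<open>auto simp: divide_simps add_nonneg_pos\<close>)
  have "(\<integral>e. N e / (N e + s) \<partial>noise n) \<le> (\<integral>e. \<mu> / (\<mu> + s) + s / (\<mu> + s)\<^sup>2 * (N e - \<mu>) \<partial>noise n)"
    using N0 \<mu>0 s iN by (intro integral_mono iF fraction_tangent_upper) auto
  also have "\<dots> = \<mu> / (\<mu> + s)"
    using iN by (simp add: EN noise.prob_space)
  finally show "(\<integral>e. N e / (N e + s) \<partial>noise n) \<le> \<mu> / (\<mu> + s)" .
  have "\<mu> / (\<mu> + s) - 1 / s \<le> \<mu> / (\<mu> + s) - \<mu> / (\<mu> + s)\<^sup>2"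
  proof -
    have "\<mu> / (\<mu> + s)\<^sup>2 = \<mu> / (\<mu> + s) * (1 / (\<mu> + s))" by (simp add: power2_eq_square)
    also have "\<dots> \<le> 1 * (1 / s)"
      using \<mu>0 s by (intro mult_mono) (auto simp: frac_le)
    finally show ?thesis by simp
  qed
  also have "\<dots> \<le> \<mu> / (\<mu> + s) - (\<integral>e. (N e - \<mu>)\<^sup>2 \<partial>noise n) / (\<mu> + s)\<^sup>2"
    by (intro diff_mono order_refl divide_right_mono VN) auto
  also have "\<dots> = (\<integral>e. \<mu> / (\<mu> + s) + s / (\<mu> + s)\<^sup>2 * (N e - \<mu>) - (N e - \<mu>)\<^sup>2 / (\<mu> + s)\<^sup>2 \<partial>noise n)"
    using iN iN2 by (simp add: EN noise.prob_space)
  also have "\<dots> \<le> (\<integral>e. N e / (N e + s) \<partial>noise n)"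
    using N0 \<mu>0 s iN iN2 by (intro integral_mono iF fraction_tangent_lower) auto
  finally show "\<mu> / (\<mu> + s) - 1 / s \<le> (\<integral>e. N e / (N e + s) \<partial>noise n)" .
qed

text \<open>\<open>V\<close> and \<open>T\<close> stand for the numbers of false and true
  discoveries among \<open>s\<close> signals. Replacing the random \<open>T\<close> by
  \<open>s\<close> costs at most the proportion of missed signals, whose mean is the FNR. That
  \<open>V\<close> is 0 or at least 1 makes the \<open>max 1\<close> harmless.\<close>

lemma fdp_sandwich:
  fixes V T s :: real
  assumes V: "V = 0 \<or> 1 \<le> V" and T: "0 \<le> T" "T \<le> s" and s: "1 \<le> s"
  shows "V / (V + s) \<le> V / max 1 (V + T)"
    and "V / max 1 (V + T) \<le> V / (V + s) + (s - T) / s"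
proof -
  show "V / (V + s) \<le> V / max 1 (V + T)"
    using assms by (intro divide_left_mono) auto
  show "V / max 1 (V + T) \<le> V / (V + s) + (s - T) / s"
  proof (cases "V = 0")
    case False
    then have V1: "1 \<le> V" using V by simp
    have "V / (V + T) - V / (V + s) = V / (V + T) * ((s - T) / (V + s))"
      using V1 T s by (simp add: divide_simps) (simp add: algebra_simps)
    also have "\<dots> \<le> 1 * ((s - T) / s)"
      using V1 T s by (intro mult_mono frac_le) auto
    finally show ?thesis using V1 T by (simp add: max_absorb2)
  qed (use assms in auto)
qed

section \<open>Counts of false and missed discoveries\<close>

definition nulls :: "nat \<Rightarrow> (nat \<Rightarrow> real) \<Rightarrow> nat set" where
  "nulls n \<theta> = {i \<in> {1..n}. \<theta> i = 0}"

definition signals :: "nat \<Rightarrow> (nat \<Rightarrow> real) \<Rightarrow> nat set" where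
  "signals n \<theta> = {i \<in> {1..n}. \<theta> i \<noteq> 0}"

lemma finite_nulls [simp]: "finite (nulls n \<theta>)" and finite_signals [simp]: "finite (signals n \<theta>)"
  by (auto simp: nulls_def signals_def)

lemma nulls_subset: "nulls n \<theta> \<subseteq> {1..n}" and signals_subset: "signals n \<theta> \<subseteq> {1..n}"
  by (auto simp: nulls_def signals_def)

lemma nulls_Un_signals: "{1..n} = nulls n \<theta> \<union> signals n \<theta>" and nulls_Int_signals: "nulls n \<theta> \<inter> signals n \<theta> = {}"
  by (auto simp: nulls_def signals_def)

lemma card_nulls: "real (card (nulls n \<theta>)) = real n - real (card (signals n \<theta>))"
proof -
  have "card {1..n} = card (nulls n \<theta>) + card (signals n \<theta>)"
    unfolding nulls_Un_signals[of n \<theta>] by (intro card_Un_disjoint nulls_Int_signals) auto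
  then show ?thesis by simp
qed

lemma sum_nulls_signals: "(\<Sum>i=1..n. f i) = (\<Sum>i\<in>nulls n \<theta>. f i) + (\<Sum>i\<in>signals n \<theta>. f i)"
  unfolding nulls_Un_signals[of n \<theta>] by (intro sum.union_disjoint nulls_Int_signals) auto

definition fitted_weight :: "nat \<Rightarrow> (nat \<Rightarrow> real) \<Rightarrow> (nat \<Rightarrow> real) \<Rightarrow> real" where
  "fitted_weight n \<theta> e = w_hat n (observe n \<theta> e)"

definition false_count :: "nat \<Rightarrow> real \<Rightarrow> (nat \<Rightarrow> real) \<Rightarrow> (nat \<Rightarrow> real) \<Rightarrow> real" where
  "false_count n t \<theta> e = (\<Sum>i\<in>nulls n \<theta>. of_bool (q_value (fitted_weight n \<theta> e) (e i) < t))"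

definition missed_count :: "nat \<Rightarrow> real \<Rightarrow> (nat \<Rightarrow> real) \<Rightarrow> (nat \<Rightarrow> real) \<Rightarrow> real" where
  "missed_count n t \<theta> e = (\<Sum>i\<in>signals n \<theta>. of_bool (\<not> q_value (fitted_weight n \<theta> e) (\<theta> i + e i) < t))"

lemma fitted_weight_measurable [measurable]:
  assumes "1 \<le> n"
  shows "fitted_weight n \<theta> \<in> borel_measurable (noise n)"
  unfolding fitted_weight_def
  by (rule measurable_compose[OF observe_measurable w_hat_measurable[OF assms]])

lemma noise_component_measurable: "i \<in> {1..n} \<Longrightarrow> (\<lambda>e. e i) \<in> borel_measurable (noise n)"
  by (simp add: measurable_cong_sets[OF sets_noise] measurable_component_singleton)

lemma false_count_measurable:
  assumes n: "1 \<le> n"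
  shows "false_count n t \<theta> \<in> borel_measurable (noise n)"
proof -
  have "(\<lambda>e. of_bool (q_value (fitted_weight n \<theta> e) (e i) < t) :: real) \<in> borel_measurable (noise n)" if "i \<in> nulls n \<theta>" for i
  proof -
    have [measurable]: "(\<lambda>e. e i) \<in> borel_measurable (noise n)"
      using that nulls_subset by (intro noise_component_measurable) blast
    note fitted_weight_measurable[OF n, measurable]
    show ?thesis by measurable
  qed
  then show ?thesis unfolding false_count_def[abs_def] by (rule borel_measurable_sum)
qed

lemma missed_count_measurable:
  assumes n: "1 \<le> n"
  shows "missed_count n t \<theta> \<in> borel_measurable (noise n)"
proof -
  have "(\<lambda>e. of_bool (\<not> q_value (fitted_weight n \<theta> e) (\<theta> i + e i) < t) :: real) \<in> borel_measurable (noise n)" if "i \<in> signals n \<theta>" for i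
  proof -
    have [measurable]: "(\<lambda>e. e i) \<in> borel_measurable (noise n)"
      using that signals_subset by (intro noise_component_measurable) blast
    note fitted_weight_measurable[OF n, measurable]
    show ?thesis by measurable
  qed
  then show ?thesis unfolding missed_count_def[abs_def] by (rule borel_measurable_sum)
qed

lemma sum_of_bool_bounds:
  fixes A :: "'a set"
  shows "0 \<le> (\<Sum>i\<in>A. of_bool (P i) :: real)" "(\<Sum>i\<in>A. of_bool (P i) :: real) \<le> card A"
  using sum_bounded_above[of A "\<lambda>i. of_bool (P i) :: real" 1] by (simp_all add: sum_nonneg)

lemma false_count_bounds: "0 \<le> false_count n t \<theta> e" "false_count n t \<theta> e \<le> card (nulls n \<theta>)"
  unfolding false_count_def by (rule sum_of_bool_bounds)+

lemma missed_count_bounds: "0 \<le> missed_count n t \<theta> e" "missed_count n t \<theta> e \<le> card (signals n \<theta>)"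
  unfolding missed_count_def by (rule sum_of_bool_bounds)+

lemma false_count_cases: "false_count n t \<theta> e = 0 \<or> 1 \<le> false_count n t \<theta> e"
proof -
  have "false_count n t \<theta> e = real (card (nulls n \<theta> \<inter> {i. q_value (fitted_weight n \<theta> e) (e i) < t}))"
    unfolding false_count_def by (rule sum_of_bool_eq; rule finite_nulls)
  then obtain k where "false_count n t \<theta> e = real k" by blast
  then show ?thesis by (cases k) auto
qed

lemma q_value_procedure_observe:
  "i \<in> {1..n} \<Longrightarrow> q_value_procedure n t (observe n \<theta> e) i \<longleftrightarrow> q_value (fitted_weight n \<theta> e) (\<theta> i + e i) < t"
  by (simp add: q_value_procedure_def fitted_weight_def)

lemma FNR_eq_missed_count:
  assumes n: "1 \<le> n" and s: "1 \<le> card (signals n \<theta>)"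
  shows "q_FNR n t \<theta> = (\<integral>e. missed_count n t \<theta> e / card (signals n \<theta>) \<partial>noise n)"
proof -
  have "(\<Sum>i=1..n. of_bool (\<theta> i \<noteq> 0 \<and> \<not> q_value_procedure n t (observe n \<theta> e) i)) = missed_count n t \<theta> e" for e
  proof -
    have "(\<Sum>i\<in>signals n \<theta>. of_bool (\<theta> i \<noteq> 0 \<and> \<not> q_value_procedure n t (observe n \<theta> e) i)) = missed_count n t \<theta> e"
      unfolding missed_count_def
      by (intro sum.cong refl) (auto simp: signals_def q_value_procedure_observe)
    moreover have "(\<Sum>i\<in>nulls n \<theta>. of_bool (\<theta> i \<noteq> 0 \<and> \<not> q_value_procedure n t (observe n \<theta> e) i)) = (0::real)"
      by (intro sum.neutral) (auto simp: nulls_def)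
    ultimately show ?thesis by (simp only: sum_nulls_signals[of _ n \<theta>])
  qed
  moreover have "(\<Sum>i=1..n. of_bool (\<theta> i \<noteq> 0)) = real (card (signals n \<theta>))"
    by (subst sum_of_bool_eq) (auto simp: signals_def intro!: arg_cong[where f=card])
  ultimately show ?thesis
    unfolding FNR_eq[OF n] using s by simp
qed

lemma FDR_eq_counts:
  assumes n: "1 \<le> n"
  shows "q_FDR n t \<theta> = (\<integral>e. false_count n t \<theta> e /
    max 1 (false_count n t \<theta> e + (card (signals n \<theta>) - missed_count n t \<theta> e)) \<partial>noise n)"
proof -
  have 1: "(\<Sum>i\<in>nulls n \<theta>. of_bool (q_value_procedure n t (observe n \<theta> e) i)) = false_count n t \<theta> e" for e
    unfolding false_count_def by (intro sum.cong refl) (auto simp: nulls_def q_value_procedure_observe)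
  have 2: "(\<Sum>i\<in>signals n \<theta>. of_bool (q_value_procedure n t (observe n \<theta> e) i)) = card (signals n \<theta>) - missed_count n t \<theta> e" for e
  proof -
    have "(\<Sum>i\<in>signals n \<theta>. of_bool (q_value_procedure n t (observe n \<theta> e) i)) =
       (\<Sum>i\<in>signals n \<theta>. 1 - of_bool (\<not> q_value (fitted_weight n \<theta> e) (\<theta> i + e i) < t) :: real)"
      by (intro sum.cong refl) (auto simp: signals_def q_value_procedure_observe)
    then show ?thesis by (simp add: sum_subtractf missed_count_def)
  qed
  have 3: "(\<Sum>i=1..n. of_bool (\<theta> i = 0 \<and> q_value_procedure n t (observe n \<theta> e) i)) = false_count n t \<theta> e" for e
  proof -
    have "(\<Sum>i\<in>nulls n \<theta>. of_bool (\<theta> i = 0 \<and> q_value_procedure n t (observe n \<theta> e) i)) = false_count n t \<theta> e"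
      unfolding 1[symmetric] by (intro sum.cong refl) (auto simp: nulls_def)
    moreover have "(\<Sum>i\<in>signals n \<theta>. of_bool (\<theta> i = 0 \<and> q_value_procedure n t (observe n \<theta> e) i)) = (0::real)"
      by (intro sum.neutral) (auto simp: signals_def)
    ultimately show ?thesis by (simp only: sum_nulls_signals[of _ n \<theta>])
  qed
  show ?thesis
    unfolding FDR_eq[OF n] 3 sum_nulls_signals[of "\<lambda>i. of_bool (q_value_procedure n t (observe n \<theta> _) i)" n \<theta>] 1 2 ..
qed

lemma integrable_noise_bounded':
  fixes f :: "(nat \<Rightarrow> real) \<Rightarrow> real"
  assumes "f \<in> borel_measurable (noise n)" "\<And>e. \<bar>f e\<bar> \<le> B"
  shows "integrable (noise n) f"
  using assms by (intro noise.integrable_const_bound[where B=B]) auto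

lemma integrable_missed_count:
  assumes n: "1 \<le> n"
  shows "integrable (noise n) (missed_count n t \<theta>)"
  by (rule integrable_noise_bounded'[OF missed_count_measurable[OF n], where B="card (signals n \<theta>)"])
     (use missed_count_bounds in auto)

lemma integrable_false_fraction:
  fixes s :: real
  assumes n: "1 \<le> n" and s: "0 < s"
  shows "integrable (noise n) (\<lambda>e. false_count n t \<theta> e / (false_count n t \<theta> e + s))"
proof (rule integrable_noise_bounded'[where B=1])
  note false_count_measurable[OF n, measurable]
  show "(\<lambda>e. false_count n t \<theta> e / (false_count n t \<theta> e + s)) \<in> borel_measurable (noise n)"
    by measurable
  show "\<bar>false_count n t \<theta> e / (false_count n t \<theta> e + s)\<bar> \<le> 1" for e
    using false_count_bounds(1)[of n t \<theta> e] s by (simp add: divide_simps add_nonneg_pos)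
qed

lemma FDR_fraction_bounds:
  fixes t :: real
  assumes n: "1 \<le> n" and s: "1 \<le> card (signals n \<theta>)"
  defines "F \<equiv> (\<integral>e. false_count n t \<theta> e / (false_count n t \<theta> e + card (signals n \<theta>)) \<partial>noise n)"
  shows "F \<le> q_FDR n t \<theta>"
    and "q_FDR n t \<theta> \<le> F + q_FNR n t \<theta>"
proof -
  define S where "S = real (card (signals n \<theta>))"
  have S: "1 \<le> S" using s by (simp add: S_def)
  let ?V = "false_count n t \<theta>" and ?U = "missed_count n t \<theta>"
  have ms [measurable]: "?V \<in> borel_measurable (noise n)" "?U \<in> borel_measurable (noise n)"
    by (rule false_count_measurable[OF n] missed_count_measurable[OF n])+
  have T: "0 \<le> S - ?U e" "S - ?U e \<le> S" for e
    using missed_count_bounds[of n t \<theta> e] by (auto simp: S_def)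
  have low: "?V e / (?V e + S) \<le> ?V e / max 1 (?V e + (S - ?U e))" for e
    by (rule fdp_sandwich(1)[OF false_count_cases T S])
  have upp: "?V e / max 1 (?V e + (S - ?U e)) \<le> ?V e / (?V e + S) + ?U e / S" for e
    using fdp_sandwich(2)[OF false_count_cases T S, of n t \<theta> e e] by simp
  have int1: "integrable (noise n) (\<lambda>e. ?V e / (?V e + S))"
    using S by (intro integrable_false_fraction n) auto
  have int2: "integrable (noise n) (\<lambda>e. ?V e / max 1 (?V e + (S - ?U e)))"
  proof (rule integrable_noise_bounded'[where B=1])
    show "(\<lambda>e. ?V e / max 1 (?V e + (S - ?U e))) \<in> borel_measurable (noise n)"
      by measurable
    fix e
    have "0 \<le> ?V e" "?V e \<le> max 1 (?V e + (S - ?U e))"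
      using T[of e] false_count_bounds(1)[of n t \<theta> e] by auto
    moreover have "0 < max 1 (?V e + (S - ?U e))" by simp
    ultimately show "\<bar>?V e / max 1 (?V e + (S - ?U e))\<bar> \<le> 1" by simp
  qed
  show "F \<le> q_FDR n t \<theta>"
    unfolding F_def FDR_eq_counts[OF n] S_def[symmetric] by (intro integral_mono int1 int2 low)
  have "q_FDR n t \<theta> \<le> (\<integral>e. ?V e / (?V e + S) + ?U e / S \<partial>noise n)"
    unfolding FDR_eq_counts[OF n] S_def[symmetric]
    using integrable_missed_count[OF n] by (intro integral_mono int1 int2 upp) (auto simp: int1)
  also have "\<dots> = F + q_FNR n t \<theta>"
    unfolding FNR_eq_missed_count[OF n s] F_def S_def[symmetric]
    using integrable_missed_count[OF n] int1 by simp
  finally show "q_FDR n t \<theta> \<le> F + q_FNR n t \<theta>" .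
qed

lemma fitted_weight_pos: "1 \<le> n \<Longrightarrow> 0 < fitted_weight n \<theta> e" and fitted_weight_le_1: "1 \<le> n \<Longrightarrow> fitted_weight n \<theta> e \<le> 1"
  unfolding fitted_weight_def by (auto intro: w_hat_bounds)

lemma null_event_measurable: "Measurable.pred borel (\<lambda>x. q_value w x < t)"
  by measurable

lemma integrable_weight_event:
  assumes n: "1 \<le> n"
  shows "integrable (noise n) (indicator {e \<in> space (noise n). w < fitted_weight n \<theta> e} :: _ \<Rightarrow> real)"
    and "integrable (noise n) (indicator {e \<in> space (noise n). fitted_weight n \<theta> e < w} :: _ \<Rightarrow> real)"
proof -
  note fitted_weight_measurable[OF n, measurable]
  have "indicator {e \<in> space (noise n). w < fitted_weight n \<theta> e} \<in> borel_measurable (noise n)"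
     "indicator {e \<in> space (noise n). fitted_weight n \<theta> e < w} \<in> borel_measurable (noise n)"
    by measurable
  then show "integrable (noise n) (indicator {e \<in> space (noise n). w < fitted_weight n \<theta> e} :: _ \<Rightarrow> real)"
     "integrable (noise n) (indicator {e \<in> space (noise n). fitted_weight n \<theta> e < w} :: _ \<Rightarrow> real)"
    by (auto intro!: integrable_noise_bounded'[where B=1] simp: indicator_def)
qed

lemma integrable_fixed_fraction:
  fixes s :: real
  assumes s: "0 < s" and A: "A \<subseteq> {1..n}" and P [measurable]: "Measurable.pred borel P"
  shows "integrable (noise n) (\<lambda>e. (\<Sum>i\<in>A. of_bool (P (e i))) / ((\<Sum>i\<in>A. of_bool (P (e i))) + s))"
proof (rule integrable_noise_bounded[where B=1])
  have [measurable]: "(\<lambda>e. \<Sum>i\<in>A. of_bool (P (e i)) :: real) \<in> borel_measurable (Pi\<^sub>M {1..n} (\<lambda>_. borel))"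
  proof (intro borel_measurable_sum)
    fix i assume "i \<in> A"
    then have [measurable]: "(\<lambda>e. e i) \<in> borel_measurable (Pi\<^sub>M {1..n} (\<lambda>_. borel))"
      using A by (intro measurable_component_singleton) auto
    show "(\<lambda>e. of_bool (P (e i)) :: real) \<in> borel_measurable (Pi\<^sub>M {1..n} (\<lambda>_. borel))" by measurable
  qed
  show "(\<lambda>e. (\<Sum>i\<in>A. of_bool (P (e i))) / ((\<Sum>i\<in>A. of_bool (P (e i))) + s)) \<in> borel_measurable (Pi\<^sub>M {1..n} (\<lambda>_. borel))"
    by measurable
  show "\<bar>(\<Sum>i\<in>A. of_bool (P (e i))) / ((\<Sum>i\<in>A. of_bool (P (e i))) + s)\<bar> \<le> 1" for e
    using sum_of_bool_bounds(1)[of "\<lambda>i. P (e i)" A] s by (simp add: divide_simps add_nonneg_pos)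
qed

text \<open>The fitted weight depends on all coordinates, so the summands of
  \<open>false_count\<close> are dependent. Where it is at most \<open>w\<close>, the count is
  dominated by \<open>N\<close>, taken at the fixed weight \<open>w\<close>; this is a sum of
  independent indicators, to which Jensen's inequality applies.\<close>

lemma FDR_upper:
  fixes t w \<mu> :: real
  assumes n: "1 \<le> n" and s: "1 \<le> card (signals n \<theta>)" and t: "0 < t" "t < 1" and w: "0 < w" "w \<le> 1"
  defines "\<mu> \<equiv> card (nulls n \<theta>) * null_reject t w"
  shows "q_FDR n t \<theta> \<le> \<mu> / (\<mu> + card (signals n \<theta>))
    + noise.prob n {e \<in> space (noise n). w < fitted_weight n \<theta> e} + q_FNR n t \<theta>"
proof -
  define S where "S = real (card (signals n \<theta>))"
  have S: "1 \<le> S" using s by (simp add: S_def)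
  define N where "N e = (\<Sum>i\<in>nulls n \<theta>. of_bool (q_value w (e i) < t) :: real)" for e
  define I where "I = (indicator {e \<in> space (noise n). w < fitted_weight n \<theta> e} :: _ \<Rightarrow> real)"
  have intI: "integrable (noise n) I" unfolding I_def by (rule integrable_weight_event[OF n])
  have intN: "integrable (noise n) (\<lambda>e. N e / (N e + S))"
    unfolding N_def using S by (intro integrable_fixed_fraction nulls_subset) auto
  have "(\<integral>e. false_count n t \<theta> e / (false_count n t \<theta> e + S) \<partial>noise n) \<le> (\<integral>e. N e / (N e + S) + I e \<partial>noise n)"
  proof (intro integral_mono integrable_false_fraction n Bochner_Integration.integrable_add intI intN)
    fix e assume e: "e \<in> space (noise n)"
    have "false_count n t \<theta> e \<le> N e" if "\<not> w < fitted_weight n \<theta> e"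
      unfolding false_count_def N_def
      using that fitted_weight_pos[OF n, of \<theta> e] w t
      by (intro sum_mono) (auto intro: q_value_less_mono_weight[of "fitted_weight n \<theta> e" w])
    then show "false_count n t \<theta> e / (false_count n t \<theta> e + S) \<le> N e / (N e + S) + I e"
      using S e sum_of_bool_bounds(1) by (intro fraction_le_plus_exception false_count_bounds) (auto simp: I_def N_def indicator_def)
  qed (use S in auto)
  also have "\<dots> = (\<integral>e. N e / (N e + S) \<partial>noise n) + noise.prob n {e \<in> space (noise n). w < fitted_weight n \<theta> e}"
    using intI intN fitted_weight_measurable[OF n] by (simp add: I_def)
  also have "(\<integral>e. N e / (N e + S) \<partial>noise n) \<le> \<mu> / (\<mu> + S)"
    unfolding N_def \<mu>_def null_reject_def
    using S by (intro expected_fraction_bounds nulls_subset null_event_measurable) auto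
  finally show ?thesis
    using FDR_fraction_bounds(2)[OF n s, of t] unfolding S_def by linarith
qed

text \<open>The same comparison from below. The term \<open>1 / s\<close> is the price of reversing
  Jensen's inequality. The FNR does not enter, as missed signals only increase the false discovery
  proportion.\<close>

lemma FDR_lower:
  fixes t w \<mu> :: real
  assumes n: "1 \<le> n" and s: "1 \<le> card (signals n \<theta>)" and t: "0 < t" "t < 1" and w: "0 < w" "w \<le> 1"
  defines "\<mu> \<equiv> card (nulls n \<theta>) * null_reject t w"
  shows "\<mu> / (\<mu> + card (signals n \<theta>)) - 1 / card (signals n \<theta>)
    - noise.prob n {e \<in> space (noise n). fitted_weight n \<theta> e < w} \<le> q_FDR n t \<theta>"
proof -
  define S where "S = real (card (signals n \<theta>))"
  have S: "1 \<le> S" using s by (simp add: S_def)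
  define N where "N e = (\<Sum>i\<in>nulls n \<theta>. of_bool (q_value w (e i) < t) :: real)" for e
  define I where "I = (indicator {e \<in> space (noise n). fitted_weight n \<theta> e < w} :: _ \<Rightarrow> real)"
  have intI: "integrable (noise n) I" unfolding I_def by (rule integrable_weight_event[OF n])
  have intN: "integrable (noise n) (\<lambda>e. N e / (N e + S))"
    unfolding N_def using S by (intro integrable_fixed_fraction nulls_subset) auto
  have "\<mu> / (\<mu> + S) - 1 / S - noise.prob n {e \<in> space (noise n). fitted_weight n \<theta> e < w}
      \<le> (\<integral>e. N e / (N e + S) \<partial>noise n) - noise.prob n {e \<in> space (noise n). fitted_weight n \<theta> e < w}"
    unfolding N_def \<mu>_def null_reject_def
    using S by (intro diff_mono order_refl expected_fraction_bounds nulls_subset null_event_measurable) auto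
  also have "\<dots> = (\<integral>e. N e / (N e + S) - I e \<partial>noise n)"
    using intI intN fitted_weight_measurable[OF n] by (simp add: I_def)
  also have "\<dots> \<le> (\<integral>e. false_count n t \<theta> e / (false_count n t \<theta> e + S) \<partial>noise n)"
  proof (intro integral_mono integrable_false_fraction n Bochner_Integration.integrable_diff intI intN)
    fix e assume e: "e \<in> space (noise n)"
    have "N e \<le> false_count n t \<theta> e" if "\<not> fitted_weight n \<theta> e < w"
      unfolding false_count_def N_def
      using that fitted_weight_le_1[OF n, of \<theta> e] w t
      by (intro sum_mono) (auto intro: q_value_less_mono_weight[of w "fitted_weight n \<theta> e"])
    then have "N e / (N e + S) \<le> false_count n t \<theta> e / (false_count n t \<theta> e + S) + I e"
      using S e sum_of_bool_bounds(1) by (intro fraction_le_plus_exception false_count_bounds) (auto simp: I_def N_def indicator_def)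
    then show "N e / (N e + S) - I e \<le> false_count n t \<theta> e / (false_count n t \<theta> e + S)" by simp
  qed (use S in auto)
  also have "\<dots> \<le> q_FDR n t \<theta>"
    using FDR_fraction_bounds(1)[OF n s, of t] unfolding S_def .
  finally show ?thesis unfolding S_def .
qed

lemma FNR_upper:
  assumes n: "1 \<le> n" and s: "1 \<le> card (signals n \<theta>)" and t: "0 < t" "t < 1" and w: "0 < w" "w \<le> 1"
    and miss: "\<And>i. i \<in> signals n \<theta> \<Longrightarrow> gauss_prob.prob {x. \<not> q_value w (\<theta> i + x) < t} \<le> \<beta>"
  shows "q_FNR n t \<theta> \<le> \<beta> + noise.prob n {e \<in> space (noise n). fitted_weight n \<theta> e < w}"
proof -
  define S where "S = real (card (signals n \<theta>))"
  have S: "1 \<le> S" using s by (simp add: S_def)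
  define N where "N e = (\<Sum>i\<in>signals n \<theta>. of_bool (\<not> q_value w (\<theta> i + e i) < t) :: real)" for e
  define I where "I = (indicator {e \<in> space (noise n). fitted_weight n \<theta> e < w} :: _ \<Rightarrow> real)"
  have intI: "integrable (noise n) I" unfolding I_def by (rule integrable_weight_event[OF n])
  define f where "f = (\<lambda>i x. of_bool (\<not> q_value w (\<theta> i + x) < t) :: real)"
  have fm [measurable]: "f i \<in> borel_measurable borel" for i unfolding f_def by measurable
  have fb: "\<bar>f i x\<bar> \<le> 1" for i x by (simp add: f_def)
  have N_f: "N = (\<lambda>e. \<Sum>i\<in>signals n \<theta>. f i (e i))" by (simp add: N_def f_def fun_eq_iff)
  have N0: "0 \<le> N e" "N e \<le> S" for e unfolding N_def S_def by (rule sum_of_bool_bounds)+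
  have Nm: "N \<in> borel_measurable (Pi\<^sub>M {1..n} (\<lambda>_. borel))"
    unfolding N_f using signals_subset
    by (intro borel_measurable_sum measurable_compose[OF _ fm] measurable_component_singleton) blast
  have intN: "integrable (noise n) N"
    by (rule integrable_noise_bounded[OF Nm, where B=S]) (use N0 in auto)
  have EN: "(\<integral>e. N e \<partial>noise n) \<le> S * \<beta>"
  proof -
    have "(\<integral>e. N e \<partial>noise n) = (\<Sum>i\<in>signals n \<theta>. \<integral>x. f i x \<partial>gauss_measure)"
      unfolding N_f by (rule noise_sum_moments(1)[OF signals_subset fm fb])
    also have "\<dots> \<le> (\<Sum>i\<in>signals n \<theta>. \<beta>)"
    proof (rule sum_mono)
      fix i assume i: "i \<in> signals n \<theta>"
      have "(\<integral>x. f i x \<partial>gauss_measure) = (\<integral>x. indicator {x. \<not> q_value w (\<theta> i + x) < t} x \<partial>gauss_measure)"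
        by (intro Bochner_Integration.integral_cong) (auto simp: indicator_def f_def)
      also have "\<dots> = gauss_prob.prob {x. \<not> q_value w (\<theta> i + x) < t}" by simp
      finally show "(\<integral>x. f i x \<partial>gauss_measure) \<le> \<beta>" using miss[OF i] by simp
    qed
    finally show ?thesis by (simp add: S_def)
  qed
  have "(\<integral>e. missed_count n t \<theta> e / S \<partial>noise n) \<le> (\<integral>e. N e / S + I e \<partial>noise n)"
  proof (intro integral_mono Bochner_Integration.integrable_add intI)
    fix e assume e: "e \<in> space (noise n)"
    show "missed_count n t \<theta> e / S \<le> N e / S + I e"
    proof (cases "fitted_weight n \<theta> e < w")
      case True
      then have "I e = 1" using e by (simp add: I_def)
      moreover have "missed_count n t \<theta> e / S \<le> 1"
        using missed_count_bounds(2)[of n t \<theta> e] S by (simp add: S_def)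
      moreover have "0 \<le> N e / S" using N0 S by simp
      ultimately show ?thesis by linarith
    next
      case False
      have "missed_count n t \<theta> e \<le> N e"
        unfolding missed_count_def N_def
      proof (rule sum_mono)
        fix i
        have "q_value (fitted_weight n \<theta> e) (\<theta> i + e i) < t" if "q_value w (\<theta> i + e i) < t"
          using that False fitted_weight_le_1[OF n, of \<theta> e] w t by (intro q_value_less_mono_weight[of w "fitted_weight n \<theta> e"]) auto
        then show "of_bool (\<not> q_value (fitted_weight n \<theta> e) (\<theta> i + e i) < t) \<le> (of_bool (\<not> q_value w (\<theta> i + e i) < t) :: real)"
          by auto
      qed
      then have "missed_count n t \<theta> e / S \<le> N e / S"
        using S by (intro divide_right_mono) auto
      moreover have "0 \<le> I e" by (simp add: I_def)
      ultimately show ?thesis by linarith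
    qed
  qed (use intN integrable_missed_count[OF n] in auto)
  also have "\<dots> = (\<integral>e. N e \<partial>noise n) / S + noise.prob n {e \<in> space (noise n). fitted_weight n \<theta> e < w}"
    using intI intN fitted_weight_measurable[OF n] by (simp add: I_def)
  also have "(\<integral>e. N e \<partial>noise n) / S \<le> \<beta>"
    using EN S by (simp add: divide_simps mult.commute)
  finally show ?thesis
    unfolding FNR_eq_missed_count[OF n s] S_def by simp
qed

section \<open>Concentration of the fitted weight\<close>

lemma score_observe: "score n (observe n \<theta> e) w = (\<Sum>i\<in>{1..n}. score_term w (\<theta> i + e i))"
  unfolding score_def by (intro sum.cong) auto

text \<open>In units of \<open>1 / w\<^sup>2\<close> a signal has second moment at most 1 and a null
  at most \<open>2 * w * null_drift w\<close>, so the variance is measured by the two quantities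
  whose balance determines the fitted weight.\<close>

lemma score_deviation:
  fixes n :: nat and \<theta> :: "nat \<Rightarrow> real"
  assumes w: "0 < w" "w \<le> 1" and c: "0 < c"
  defines "m \<equiv> (\<Sum>i\<in>signals n \<theta>. \<integral>x. score_term w (\<theta> i + x) \<partial>gauss_measure) - card (nulls n \<theta>) * null_drift w"
  shows "noise.prob n {e \<in> space (noise n). c \<le> \<bar>score n (observe n \<theta> e) w - m\<bar>}
    \<le> (card (signals n \<theta>) + 2 * (card (nulls n \<theta>) * (w * null_drift w))) / (w\<^sup>2 * c\<^sup>2)"
proof -
  define f where "f = (\<lambda>i x. score_term w (\<theta> i + x))"
  have fm: "f i \<in> borel_measurable borel" for i unfolding f_def by measurable
  have fb: "\<bar>f i x\<bar> \<le> 1 / w" for i x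
    unfolding f_def using abs_score_term_le[OF w] .
  have "(\<Sum>i\<in>nulls n \<theta>. \<integral>x. f i x \<partial>gauss_measure) = (\<Sum>i\<in>nulls n \<theta>. - null_drift w)"
    by (intro sum.cong refl) (auto simp: f_def nulls_def null_drift_def)
  then have mean: "(\<Sum>i\<in>{1..n}. \<integral>x. f i x \<partial>gauss_measure) = m"
    unfolding sum_nulls_signals[of _ n \<theta>] by (simp add: m_def f_def)
  have "(\<Sum>i\<in>nulls n \<theta>. \<integral>x. (f i x)\<^sup>2 \<partial>gauss_measure) \<le> (\<Sum>i\<in>nulls n \<theta>. 2 / w * null_drift w)"
    by (intro sum_mono) (use integral_score_term_square_le[OF w] in \<open>auto simp: f_def nulls_def\<close>)
  moreover have "(\<Sum>i\<in>signals n \<theta>. \<integral>x. (f i x)\<^sup>2 \<partial>gauss_measure) \<le> (\<Sum>i\<in>signals n \<theta>. (1 / w)\<^sup>2)"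
  proof (rule sum_mono)
    fix i
    have b: "(f i x)\<^sup>2 \<le> (1 / w)\<^sup>2" for x
      using power_mono[OF fb, of i x 2] by simp
    have "(\<integral>x. (f i x)\<^sup>2 \<partial>gauss_measure) \<le> (\<integral>x. (1 / w)\<^sup>2 \<partial>gauss_measure)"
      using fm by (intro integral_mono integrable_gauss_measure_bounded[where B="(1 / w)\<^sup>2"]) (auto intro: b)
    then show "(\<integral>x. (f i x)\<^sup>2 \<partial>gauss_measure) \<le> (1 / w)\<^sup>2"
      by (simp add: gauss_prob.prob_space[simplified])
  qed
  ultimately have "(\<Sum>i\<in>{1..n}. \<integral>x. (f i x)\<^sup>2 \<partial>gauss_measure)
      \<le> card (nulls n \<theta>) * (2 / w * null_drift w) + card (signals n \<theta>) * (1 / w)\<^sup>2"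
    unfolding sum_nulls_signals[of _ n \<theta>] by (intro add_mono) simp_all
  also have "\<dots> = (card (signals n \<theta>) + 2 * (card (nulls n \<theta>) * (w * null_drift w))) / w\<^sup>2"
    using w by (simp add: field_simps power2_eq_square)
  finally have var: "(\<Sum>i\<in>{1..n}. \<integral>x. (f i x)\<^sup>2 \<partial>gauss_measure) \<le> \<dots>" .
  have "noise.prob n {e \<in> space (noise n). c \<le> \<bar>(\<Sum>i\<in>{1..n}. f i (e i)) - m\<bar>}
      \<le> (\<Sum>i\<in>{1..n}. \<integral>x. (f i x)\<^sup>2 \<partial>gauss_measure) / c\<^sup>2"
    unfolding mean[symmetric] by (rule noise_sum_Chebyshev[OF order_refl fm fb c])
  also have "\<dots> \<le> (card (signals n \<theta>) + 2 * (card (nulls n \<theta>) * (w * null_drift w))) / w\<^sup>2 / c\<^sup>2"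
    by (intro divide_right_mono var) auto
  finally show ?thesis by (simp add: score_observe f_def)
qed

lemma score_event_measurable:
  "{e \<in> space (noise n). c \<le> \<bar>score n (observe n \<theta> e) w - m\<bar>} \<in> sets (noise n)"
proof -
  have [measurable]: "(\<lambda>e. score n (observe n \<theta> e) w) \<in> borel_measurable (noise n)"
    by (rule measurable_compose[OF observe_measurable score_measurable])
  show ?thesis by measurable
qed

text \<open>Signals of any size contribute at most \<open>1 / w\<close> to the score, so its mean is
  at most \<open>(s - D) / w\<close>. If the fitted weight exceeds \<open>w\<close>, concavity makes
  the score at \<open>w\<close> nonnegative, a deviation of at least
  \<open>(D - s) / w\<close>.\<close>

lemma prob_fitted_weight_gt:
  fixes n :: nat and \<theta> :: "nat \<Rightarrow> real"
  assumes n: "1 \<le> n" and w: "1 / real n \<le> w" "w \<le> 1"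
  defines "D \<equiv> card (nulls n \<theta>) * (w * null_drift w)" and "s \<equiv> real (card (signals n \<theta>))"
  assumes D: "s < D"
  shows "noise.prob n {e \<in> space (noise n). w < fitted_weight n \<theta> e} \<le> (s + 2 * D) / (D - s)\<^sup>2"
proof -
  have w0: "0 < w" by (rule less_le_trans[OF _ w(1)]) (use n in simp)
  define m where "m = (\<Sum>i\<in>signals n \<theta>. \<integral>x. score_term w (\<theta> i + x) \<partial>gauss_measure) - card (nulls n \<theta>) * null_drift w"
  define c where "c = (D - s) / w"
  have c: "0 < c" using D w0 by (simp add: c_def)
  have "(\<Sum>i\<in>signals n \<theta>. \<integral>x. score_term w (\<theta> i + x) \<partial>gauss_measure) \<le> (\<Sum>i\<in>signals n \<theta>. 1 / w)"
  proof (rule sum_mono)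
    fix i
    have "(\<integral>x. score_term w (\<theta> i + x) \<partial>gauss_measure) \<le> (\<integral>x. 1 / w \<partial>gauss_measure)"
      by (intro integral_mono integrable_gauss_measure_bounded[where B="1 / w"] score_term_le abs_score_term_le w0 w)
         (use w0 in auto)
    then show "(\<integral>x. score_term w (\<theta> i + x) \<partial>gauss_measure) \<le> 1 / w"
      by (simp add: gauss_prob.prob_space[simplified])
  qed
  then have "m \<le> s / w - D / w"
    using w0 by (simp add: m_def s_def D_def)
  then have m: "m \<le> - c" by (simp add: c_def diff_divide_distrib)
  have "noise.prob n {e \<in> space (noise n). w < fitted_weight n \<theta> e}
      \<le> noise.prob n {e \<in> space (noise n). c \<le> \<bar>score n (observe n \<theta> e) w - m\<bar>}"
  proof (intro noise.finite_measure_mono score_event_measurable subsetI)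
    fix e assume e: "e \<in> {e \<in> space (noise n). w < fitted_weight n \<theta> e}"
    have "0 \<le> score n (observe n \<theta> e) w"
    proof (rule ccontr)
      assume "\<not> 0 \<le> score n (observe n \<theta> e) w"
      then have "fitted_weight n \<theta> e \<le> w"
        unfolding fitted_weight_def by (intro w_hat_le n w) auto
      then show False using e by simp
    qed
    then show "e \<in> {e \<in> space (noise n). c \<le> \<bar>score n (observe n \<theta> e) w - m\<bar>}"
      using e m by auto
  qed
  also have "\<dots> \<le> (s + 2 * D) / (w\<^sup>2 * c\<^sup>2)"
    unfolding m_def s_def D_def by (rule score_deviation[OF w0 w(2) c])
  also have "w\<^sup>2 * c\<^sup>2 = (D - s)\<^sup>2"
    using w0 by (simp add: c_def power_divide)
  finally show ?thesis .
qed

text \<open>Here the signals must be strong: \<kappa> is the fraction of the maximal contribution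
  \<open>1 / w\<close> that each of them reaches on average. The rest mirrors
  \<open>prob_fitted_weight_gt\<close>.\<close>

lemma prob_fitted_weight_lt:
  fixes n :: nat and \<theta> :: "nat \<Rightarrow> real"
  assumes n: "1 \<le> n" and w: "0 < w" "w \<le> 1"
  defines "D \<equiv> card (nulls n \<theta>) * (w * null_drift w)" and "s \<equiv> real (card (signals n \<theta>))"
  assumes sig: "\<And>i. i \<in> signals n \<theta> \<Longrightarrow> \<kappa> / w \<le> (\<integral>x. score_term w (\<theta> i + x) \<partial>gauss_measure)"
    and D: "D < s * \<kappa>"
  shows "noise.prob n {e \<in> space (noise n). fitted_weight n \<theta> e < w} \<le> (s + 2 * D) / (s * \<kappa> - D)\<^sup>2"
proof -
  define m where "m = (\<Sum>i\<in>signals n \<theta>. \<integral>x. score_term w (\<theta> i + x) \<partial>gauss_measure) - card (nulls n \<theta>) * null_drift w"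
  define c where "c = (s * \<kappa> - D) / w"
  have c: "0 < c" using D w by (simp add: c_def)
  have "(\<Sum>i\<in>signals n \<theta>. \<kappa> / w) \<le> (\<Sum>i\<in>signals n \<theta>. \<integral>x. score_term w (\<theta> i + x) \<partial>gauss_measure)"
    by (intro sum_mono sig)
  then have "s * \<kappa> / w - D / w \<le> m"
    using w by (simp add: m_def s_def D_def)
  then have m: "c \<le> m" by (simp add: c_def diff_divide_distrib)
  have "noise.prob n {e \<in> space (noise n). fitted_weight n \<theta> e < w}
      \<le> noise.prob n {e \<in> space (noise n). c \<le> \<bar>score n (observe n \<theta> e) w - m\<bar>}"
  proof (intro noise.finite_measure_mono score_event_measurable subsetI)
    fix e assume e: "e \<in> {e \<in> space (noise n). fitted_weight n \<theta> e < w}"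
    have "score n (observe n \<theta> e) w \<le> 0"
    proof (rule ccontr)
      assume "\<not> score n (observe n \<theta> e) w \<le> 0"
      then have "w \<le> fitted_weight n \<theta> e"
        unfolding fitted_weight_def by (intro w_hat_ge n w) auto
      then show False using e by simp
    qed
    then show "e \<in> {e \<in> space (noise n). c \<le> \<bar>score n (observe n \<theta> e) w - m\<bar>}"
      using e m by auto
  qed
  also have "\<dots> \<le> (s + 2 * D) / (w\<^sup>2 * c\<^sup>2)"
    unfolding m_def s_def D_def by (rule score_deviation[OF w c])
  also have "w\<^sup>2 * c\<^sup>2 = (s * \<kappa> - D)\<^sup>2"
    using w by (simp add: c_def power_divide)
  finally show ?thesis .
qed

section \<open>Strong signals: their score and their rejection\<close>

lemma prob_small_observation:
  assumes a: "y + x0 \<le> \<bar>a\<bar>" and x0: "1 \<le> x0"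
  shows "gauss_prob.prob {x. \<bar>a + x\<bar> < y} \<le> exp (- x0\<^sup>2 / 2)"
proof -
  have "gauss_prob.prob {x. \<bar>a + x\<bar> < y} \<le> gauss_prob.prob {x. x0 < \<bar>x\<bar>}"
    using a by (intro gauss_prob.finite_measure_mono) auto
  also have "\<dots> = 2 * normal_tail x0"
    using x0 by (intro measure_gauss_tails) simp
  also have "\<dots> \<le> exp (- x0\<^sup>2 / 2)"
    using normal_tail_upper_exp[OF x0] by simp
  finally show ?thesis .
qed

text \<open>The score is \<open>1 / w * (1 - 1 / d)\<close>. The loss \<open>1 / d\<close> is at
  most \<delta> when the observation reaches \<open>y\<close>, and at most 2 always, since
  \<open>d \<ge> 1 / 2\<close>; on average it is at most
  \<open>\<delta> + 2 * \<delta>\<close>.\<close>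

lemma strong_signal_score:
  assumes w: "0 < w" "w \<le> 1" and \<delta>: "0 < \<delta>" and y: "0 \<le> y"
    and big: "1 / \<delta> \<le> w * (lik_ratio y - 1)" and p: "gauss_prob.prob {x. \<bar>a + x\<bar> < y} \<le> \<delta>"
  shows "(1 - 3 * \<delta>) / w \<le> (\<integral>x. score_term w (a + x) \<partial>gauss_measure)"
proof -
  define I where "I = (indicator {x. \<bar>a + x\<bar> < y} :: real \<Rightarrow> real)"
  have Im [measurable]: "I \<in> borel_measurable borel" unfolding I_def by measurable
  have intI: "integrable gauss_measure I"
    by (rule integrable_gauss_measure_bounded[where B=1]) (auto simp: I_def indicator_def)
  have EI: "(\<integral>x. I x \<partial>gauss_measure) \<le> \<delta>"
    using p by (simp add: I_def)
  have pw: "1 / w * (1 - \<delta> - 2 * I x) \<le> score_term w (a + x)" for x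
  proof -
    define d where "d = 1 + w * (lik_ratio (a + x) - 1)"
    have d: "1 / 2 \<le> d" using score_denom_ge[of w "a + x"] w by (simp add: d_def)
    have eq: "score_term w (a + x) = 1 / w * (1 - 1 / d)"
    proof -
      have "1 - 1 / d = (d - 1) / d" using d by (simp add: diff_divide_distrib)
      then show ?thesis using w by (simp add: score_term_def d_def)
    qed
    have "1 / d \<le> \<delta> + 2 * I x"
    proof (cases "\<bar>a + x\<bar> < y")
      case True
      have "1 / d \<le> 2" using d by (simp add: field_simps)
      then show ?thesis using True \<delta> by (simp add: I_def)
    next
      case False
      then have "lik_ratio y \<le> lik_ratio (a + x)"
        using y by (intro lik_ratio_mono) auto
      then have "w * (lik_ratio y - 1) \<le> w * (lik_ratio (a + x) - 1)"
        using w by (intro mult_left_mono) auto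
      then have "1 / \<delta> \<le> d" using big by (simp add: d_def)
      then have "1 / d \<le> \<delta>" using d \<delta> by (simp add: field_simps)
      then show ?thesis using False by (simp add: I_def)
    qed
    then show ?thesis
      unfolding eq using w by (intro mult_left_mono) auto
  qed
  have "(1 - 3 * \<delta>) / w \<le> 1 / w * (1 - \<delta> - 2 * (\<integral>x. I x \<partial>gauss_measure))"
    using EI w by (simp add: divide_right_mono)
  also have "\<dots> = (\<integral>x. 1 / w * (1 - \<delta> - 2 * I x) \<partial>gauss_measure)"
    using intI by (simp add: gauss_prob.prob_space[simplified])
  also have "\<dots> \<le> (\<integral>x. score_term w (a + x) \<partial>gauss_measure)"
  proof (rule integral_mono)
    show "integrable gauss_measure (\<lambda>x. score_term w (a + x))"
      by (intro integrable_gauss_measure_bounded[where B="1 / w"] abs_score_term_le w) simp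
  qed (use intI pw in auto)
  finally show ?thesis .
qed

text \<open>The condition that makes the score nearly maximal also forces rejection: for
  \<open>y \<ge> 1\<close> the normal tail is at most \<open>gauss y\<close> and
  \<open>tail_gap y\<close> is at least the slab density, so it suffices that
  \<open>t * w * lik_ratio y > 1\<close>, which \<open>\<delta> < t\<close> provides.\<close>

lemma strong_signal_reject:
  assumes w: "0 < w" "w \<le> 1" and t: "0 < t" "t < 1" and \<delta>: "0 < \<delta>" "\<delta> < t" and y: "1 \<le> y"
    and big: "1 / \<delta> \<le> w * (lik_ratio y - 1)" and u: "y \<le> \<bar>u\<bar>"
  shows "q_value w u < t"
proof -
  have "(1 - t - w) * normal_tail y \<le> 1 * normal_tail y"
    using t w normal_tail_nonneg by (intro mult_right_mono) auto
  also have "\<dots> \<le> gauss y / y"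
    using normal_tail_upper[of y] y by simp
  also have "\<dots> \<le> gauss y"
    using y gauss_pos[of y] by (simp add: divide_simps)
  also have "\<dots> < t * (w * lik_ratio y) * gauss y"
  proof -
    have "1 = t * (1 / t)" using t by simp
    also have "\<dots> < t * (1 / \<delta>)"
      using t \<delta> by (intro mult_strict_left_mono) (auto simp: divide_simps)
    also have "\<dots> \<le> t * (w * lik_ratio y)"
      using t w by (intro mult_left_mono order_trans[OF big]) auto
    finally show ?thesis using gauss_pos[of y] by simp
  qed
  also have "\<dots> \<le> y * (t * (w * lik_ratio y) * gauss y)"
  proof -
    have "0 \<le> t * (w * lik_ratio y) * gauss y"
      using t w lik_ratio_pos[of y] gauss_pos[of y] by simp
    from mult_right_mono[OF y this] show ?thesis by simp
  qed
  also have "\<dots> = t * w * tail_gap y"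
    by (simp add: tail_gap_def slab_density_eq)
  finally have "q_value w y < t"
    using y w by (subst q_value_less_iff_gap) auto
  then show ?thesis
    using w t u y by (intro q_value_less_mono_obs[of w t y u]) auto
qed

text \<open>The intermediate value theorem between \<open>a\<close> and \<open>w1\<close>: at
  \<open>a\<close> the left side is at most \<open>a\<close> because the drift is at most 1. Any
  solution serves the purpose.\<close>

lemma weight_equation_solvable:
  assumes a: "0 < a" and w1: "0 < w1" "w1 < 1" "a \<le> w1 * null_drift w1"
  obtains w where "a \<le> w" "w \<le> w1" "w * null_drift w = a"
proof -
  have aw: "a \<le> w1"
  proof -
    have "w1 * null_drift w1 \<le> w1 * 1"
      using w1 by (intro mult_left_mono null_drift_le_1) auto
    then show ?thesis using w1(3) by linarith
  qed
  have "\<exists>w\<ge>a. w \<le> w1 \<and> w * null_drift w = a"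
  proof (rule IVT)
    show "a * null_drift a \<le> a"
    proof -
      have "a * null_drift a \<le> a * 1"
        using a aw w1 by (intro mult_left_mono null_drift_le_1) auto
      then show ?thesis by simp
    qed
    show "\<forall>x. a \<le> x \<and> x \<le> w1 \<longrightarrow> isCont (\<lambda>w. w * null_drift w) x"
      using a w1 by (auto intro!: continuous_intros isCont_null_drift)
  qed (use w1 aw in auto)
  then show thesis using that by blast
qed

section \<open>Uniform bounds on the error rates\<close>

text \<open>The exponents of the comparison weights are only located within a factor 2 of
  \<open>L\<close>. From \<open>4 \<le> L\<close> follow \<open>l \<le> L\<^sup>2\<close> and
  \<open>L \<le> l\<^sup>2\<close>, so the logarithms too agree up to a factor 2.\<close>

lemma log_over_self_compare:
  fixes L l :: real
  assumes L: "4 \<le> L" and l: "L / 2 \<le> l" "l \<le> 2 * L"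
  shows "ln L / L / 4 \<le> ln l / l" "ln l / l \<le> 4 * (ln L / L)"
proof -
  have lnL: "0 \<le> ln L" using L by simp
  have "2 * L \<le> L * L" using L by (intro mult_right_mono) auto
  then have "l \<le> L * L" using l by linarith
  then have "ln l \<le> ln (L * L)"
    using L l by (subst ln_le_cancel_iff) auto
  then have up: "ln l \<le> 2 * ln L" using L by (simp add: ln_mult)
  have "ln L \<le> ln (l * l)"
  proof (subst ln_le_cancel_iff)
    have "L * 1 \<le> L * (L / 4)" using L by (intro mult_left_mono) auto
    also have "\<dots> = (L / 2) * (L / 2)" by simp
    also have "\<dots> \<le> l * l" using L l by (intro mult_mono) auto
    finally show "L \<le> l * l" by simp
  qed (use L l in auto)
  then have low: "ln L / 2 \<le> ln l" using L l by (simp add: ln_mult)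
  have "ln L / L / 4 = (ln L / 2) / (2 * L)" by simp
  also have "\<dots> \<le> ln l / l" using L l low lnL by (intro frac_le) auto
  finally show "ln L / L / 4 \<le> ln l / l" .
  have "ln l / l \<le> (2 * ln L) / (L / 2)" using L l up lnL by (intro frac_le) auto
  then show "ln l / l \<le> 4 * (ln L / L)" by simp
qed

text \<open>At \<open>x = 1\<close> the value is \<open>t\<close>: a ratio
  \<open>t / (1 - t)\<close> of false to true discoveries is exactly the target level, and
  \<open>x\<close> measures the relative excess.\<close>

lemma limiting_fraction_eq:
  fixes t x s :: real
  assumes "t < 1" "0 < s"
  shows "(x * (t / (1 - t)) * s) / (x * (t / (1 - t)) * s + s) = x * t / (x * t + (1 - t))"
proof -
  have "x * (t / (1 - t)) * s + s = (x * t + (1 - t)) * (s / (1 - t))"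
    using assms by (simp add: field_simps)
  moreover have "x * (t / (1 - t)) * s = x * t * (s / (1 - t))" by simp
  ultimately show ?thesis using assms by simp
qed

lemma limiting_fraction_upper:
  fixes t \<eta> \<delta> s \<mu> :: real
  assumes t: "0 < t" "t < 1" and \<eta>: "0 \<le> \<eta>" "\<eta> \<le> 1" and \<delta>: "0 \<le> \<delta>" and s: "0 < s"
    and \<mu>: "0 \<le> \<mu>" "\<mu> \<le> ((1 + \<eta>) * (1 + 2 * \<delta>)) * (t / (1 - t)) * s"
  shows "\<mu> / (\<mu> + s) \<le> t + \<eta> + 4 * \<delta>"
proof -
  define x where "x = (1 + \<eta>) * (1 + 2 * \<delta>)"
  have "1 * 1 \<le> x" unfolding x_def using \<eta> \<delta> by (intro mult_mono) auto
  then have x: "1 \<le> x" by simp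
  have "\<mu> / (\<mu> + s) \<le> x * t / (x * t + (1 - t))"
    unfolding limiting_fraction_eq[OF t(2) s, symmetric]
    using \<mu> s unfolding x_def[symmetric] by (intro fraction_mono)
  also have "\<dots> \<le> x * t / 1"
  proof -
    have "1 * t \<le> x * t" using x t by (intro mult_right_mono) auto
    then have D: "1 \<le> x * t + (1 - t)" by simp
    then have D': "0 < (x * t + (1 - t)) * 1" by simp
    show ?thesis by (rule divide_left_mono[OF D _ D']) (use x t in simp)
  qed
  also have "\<dots> = t + t * (\<eta> + 2 * \<delta> * (1 + \<eta>))"
    by (simp add: x_def algebra_simps)
  also have "\<dots> \<le> t + 1 * (\<eta> + 2 * \<delta> * 2)"
    using t \<eta> \<delta> by (intro add_left_mono mult_mono add_mono order_refl) auto
  finally show ?thesis by simp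
qed

text \<open>\<open>F\<close> is the value for \<open>\<delta> = 0\<close>. Its excess over
  \<open>t\<close> is exactly \<open>t * (1 - t) * \<eta> / (1 + t * \<eta>)\<close>, with
  denominator at most 2, and the factor \<open>1 - 5 * \<delta>\<close> lowers it by at most
  \<open>5 * \<delta>\<close> since \<open>F \<le> 1\<close>.\<close>

lemma limiting_fraction_lower:
  fixes t \<eta> \<delta> s \<mu> :: real
  assumes t: "0 < t" "t < 1" and \<eta>: "0 \<le> \<eta>" "\<eta> \<le> 1" and \<delta>: "0 \<le> \<delta>" "\<delta> \<le> 1 / 5" and s: "0 < s"
    and \<mu>: "((1 + \<eta>) * (1 - 5 * \<delta>)) * (t / (1 - t)) * s \<le> \<mu>"
  shows "t + t * (1 - t) / 2 * \<eta> - 5 * \<delta> \<le> \<mu> / (\<mu> + s)"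
proof -
  define k where "k = 1 - 5 * \<delta>"
  have k: "0 \<le> k" "k \<le> 1" using \<delta> by (auto simp: k_def)
  define F where "F = (1 + \<eta>) * t / ((1 + \<eta>) * t + (1 - t))"
  have den: "(1 + \<eta>) * t + (1 - t) = 1 + t * \<eta>" by (simp add: algebra_simps)
  have F: "F \<le> 1" unfolding F_def using t \<eta> by (simp add: divide_simps add_nonneg_pos)
  have "t * (1 - t) / 2 * \<eta> = t * (1 - t) * \<eta> / 2" by simp
  also have "\<dots> \<le> t * (1 - t) * \<eta> / (1 + t * \<eta>)"
    using t \<eta> mult_mono[of t 1 \<eta> 1] by (intro divide_left_mono) (auto intro: add_pos_nonneg)
  also have "\<dots> = F - t"
    unfolding F_def den using t \<eta> by (simp add: field_simps add_nonneg_eq_0_iff)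
  finally have 1: "t + t * (1 - t) / 2 * \<eta> \<le> F" by simp
  have "t + t * (1 - t) / 2 * \<eta> - 5 * \<delta> \<le> F - 5 * \<delta> * 1" using 1 by simp
  also have "\<dots> \<le> F - 5 * \<delta> * F"
    using F \<delta> by (intro diff_mono mult_left_mono) auto
  also have "\<dots> = k * ((1 + \<eta>) * t) / ((1 + \<eta>) * t + (1 - t))"
    by (simp add: k_def F_def algebra_simps diff_divide_distrib)
  also have "\<dots> \<le> k * ((1 + \<eta>) * t) / (k * ((1 + \<eta>) * t) + (1 - t))"
  proof (intro divide_left_mono mult_pos_pos add_right_mono)
    show "k * ((1 + \<eta>) * t) \<le> (1 + \<eta>) * t"
      using k t \<eta> mult_right_mono[of k 1 "(1 + \<eta>) * t"] by simp
  qed (use k t \<eta> in \<open>auto intro!: add_nonneg_pos\<close>)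
  also have "\<dots> = (((1 + \<eta>) * k) * t) / (((1 + \<eta>) * k) * t + (1 - t))"
    by (simp add: mult_ac)
  also have "\<dots> \<le> \<mu> / (\<mu> + s)"
    unfolding limiting_fraction_eq[OF t(2) s, symmetric]
    using \<mu> k t \<eta> s unfolding k_def[symmetric] by (intro fraction_mono mult_nonneg_nonneg) auto
  finally show ?thesis .
qed

text \<open>The cross term \<open>sqrt (2 * L) * u\<close> in \<open>y\<^sup>2 / 2\<close> does the
  work: as \<open>u \<ge> 1\<close>, its exponential is at least \<open>exp (sqrt (2 * L))\<close>,
  which absorbs the denominator \<open>y\<^sup>2 \<le> 6 * L\<close> and the missing factor
  \<open>exp (u\<^sup>2 / 2) \<le> L\<close>.\<close>

lemma strong_signal_location:
  assumes L: "1 \<le> L" "36 * L\<^sup>2 \<le> exp (sqrt (2 * L))" and u: "1 \<le> u" "u\<^sup>2 \<le> ln L"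
    and w: "exp (- L) / 2 \<le> w"
  defines "y \<equiv> sqrt (2 * L) + u"
  shows "exp (u\<^sup>2) \<le> w * (lik_ratio y - 1)"
proof -
  have lnL: "ln L \<le> L" using L ln_le_minus_one[of L] by simp
  have y1: "1 \<le> y" using u L by (simp add: y_def add_increasing)
  then have y21: "1 \<le> y\<^sup>2" by simp
  have y2: "y\<^sup>2 / 2 = L + sqrt (2 * L) * u + u\<^sup>2 / 2"
    using L by (simp add: y_def power2_sum del: real_sqrt_mult)
  have "y\<^sup>2 \<le> 2 * ((sqrt (2 * L))\<^sup>2 + u\<^sup>2)"
    unfolding y_def using sum_squares_bound[of "sqrt (2 * L)" u] by (simp add: power2_sum)
  also have "\<dots> \<le> 6 * L" using u lnL L by simp
  finally have y_le: "y\<^sup>2 \<le> 6 * L" .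
  have "exp (u\<^sup>2 / 2) \<le> exp (ln L)" using u zero_le_power2[of u] by (subst exp_le_cancel_iff) linarith
  then have eu: "exp (u\<^sup>2 / 2) \<le> L" using L by simp
  have euu: "exp (u\<^sup>2) = exp (u\<^sup>2 / 2) * exp (u\<^sup>2 / 2)" by (simp flip: exp_add)
  have "2 * exp L * exp (u\<^sup>2) * (2 * y\<^sup>2) = exp L * exp (u\<^sup>2 / 2) * (4 * y\<^sup>2 * exp (u\<^sup>2 / 2))"
    unfolding euu by simp
  also have "\<dots> \<le> exp L * exp (u\<^sup>2 / 2) * (4 * (6 * L) * L)"
    using L by (intro mult_left_mono mult_mono y_le eu) auto
  also have "\<dots> \<le> exp L * exp (u\<^sup>2 / 2) * exp (sqrt (2 * L))"
  proof (intro mult_left_mono)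
    have "4 * (6 * L) * L \<le> 36 * L\<^sup>2" by (simp add: power2_eq_square)
    then show "4 * (6 * L) * L \<le> exp (sqrt (2 * L))" using L(2) by linarith
  qed auto
  also have "\<dots> \<le> exp L * exp (u\<^sup>2 / 2) * exp (sqrt (2 * L) * u)"
    using L u mult_left_mono[of 1 u "sqrt (2 * L)"] by (intro mult_left_mono) auto
  also have "\<dots> = exp (y\<^sup>2 / 2)"
    unfolding y2 by (simp add: exp_add)
  finally have big: "2 * exp L * exp (u\<^sup>2) * (2 * y\<^sup>2) \<le> exp (y\<^sup>2 / 2)" .
  have "1 * 1 \<le> exp L * exp (u\<^sup>2)"
    using L by (intro mult_mono) auto
  then have "2 * y\<^sup>2 \<le> 2 * exp L * exp (u\<^sup>2) * y\<^sup>2"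
    using y21 by (intro mult_right_mono) auto
  then have "2 * exp L * exp (u\<^sup>2) * y\<^sup>2 + 1 + y\<^sup>2 \<le> exp (y\<^sup>2 / 2)"
    using big y21 by linarith
  then have "(2 * exp L * exp (u\<^sup>2) + 1) * y\<^sup>2 \<le> exp (y\<^sup>2 / 2) - 1"
    by (simp only: distrib_right)
  then have "2 * exp L * exp (u\<^sup>2) + 1 \<le> (exp (y\<^sup>2 / 2) - 1) / y\<^sup>2"
    using y21 by (subst pos_le_divide_eq) auto
  then have r: "2 * exp L * exp (u\<^sup>2) \<le> lik_ratio y - 1"
    using y1 by (simp add: lik_ratio_def)
  have "exp (u\<^sup>2) = exp (- L) / 2 * (2 * exp L * exp (u\<^sup>2))"
    by (simp add: exp_minus)
  also have "\<dots> \<le> w * (lik_ratio y - 1)"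
    using w r by (intro mult_mono) (auto intro: order_trans[of 0 "exp (- L) / 2"])
  finally show ?thesis .
qed

text \<open>Here \<open>\<delta>\<close> is the relative accuracy to which the score is controlled. It is constant in part (i) and
  \<open>1 / ln (n / s)\<close> in part (ii).\<close>
definition error_bounds :: "real \<Rightarrow> nat \<Rightarrow> nat \<Rightarrow> real \<Rightarrow> (nat \<Rightarrow> real) \<Rightarrow> bool" where
  "error_bounds t n s \<delta> \<theta> \<longleftrightarrow>
    t * (1 - t) / 96 * (ln (ln (real n / real s)) / ln (real n / real s)) - 5 * (\<delta> + 1 / (real s * \<delta>\<^sup>2))
      \<le> q_FDR n t \<theta> - t \<and>
    q_FDR n t \<theta> - t
      \<le> 8 * (ln (ln (real n / real s)) / ln (real n / real s)) + 5 * (\<delta> + 1 / (real s * \<delta>\<^sup>2)) \<and>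
    q_FNR n t \<theta> \<le> \<delta> + 1 / (real s * \<delta>\<^sup>2)"

text \<open>Stated for single \<open>n\<close> and \<open>s\<close> with \<open>L0\<close> chosen
  first, so that uniformity over the class and over sequences is automatic. The condition
  \<open>1 / L \<le> \<delta>\<close>, where \<open>L = ln (n / s)\<close>, is the bound
  \<open>u\<^sup>2 \<le> ln L\<close> of \<open>strong_signal_location\<close> for
  \<open>exp (u\<^sup>2) = 1 / \<delta>\<close>.\<close>

lemma error_bounds_eventually:
  assumes t: "0 < t" "t < 1"
  shows "\<exists>L0. \<forall>n s v \<delta> \<theta>. 1 \<le> s \<longrightarrow> s \<le> n \<longrightarrow> L0 \<le> ln (real n / real s) \<longrightarrow> 1 / ln (real n / real s) \<le> \<delta> \<longrightarrow>
    \<delta> \<le> 1 / 10 \<longrightarrow> \<delta> < t \<longrightarrow> 3 * sqrt (ln (1 / \<delta>)) \<le> v \<longrightarrow> \<theta> \<in> signal_class n s v \<longrightarrow>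
    error_bounds t n s \<delta> \<theta>"
proof -
  have "\<forall>\<^sub>F l in at_top.
      (1 + 1 / 12 * (ln l / l)) * (t / (1 - t)) * (exp (- l) * null_drift (exp (- l))) \<le> null_reject t (exp (- l)) \<and>
      null_reject t (exp (- l)) \<le> (1 + 2 * (ln l / l)) * (t / (1 - t)) * (exp (- l) * null_drift (exp (- l))) \<and>
      4 * exp (- l) \<le> null_drift (exp (- l))"
    using eventually_null_reject_lower[OF t] eventually_null_reject_upper[OF t] eventually_null_drift_large
    by eventually_elim blast
  then obtain l0 where l0: "\<And>l. l0 \<le> l \<Longrightarrow>
      (1 + 1 / 12 * (ln l / l)) * (t / (1 - t)) * (exp (- l) * null_drift (exp (- l))) \<le> null_reject t (exp (- l)) \<and>
      null_reject t (exp (- l)) \<le> (1 + 2 * (ln l / l)) * (t / (1 - t)) * (exp (- l) * null_drift (exp (- l))) \<and>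
      4 * exp (- l) \<le> null_drift (exp (- l))"
    unfolding eventually_at_top_linorder by blast
  \<comment> \<open>The weights \<open>exp (- l)\<close> met below have
    \<open>l \<ge> L / 2\<close>, whence \<open>2 * l0\<close>. The second condition leaves at least
    three quarters of the coordinates null; the last one keeps \<eta> at most 1 in the limiting
    fractions.\<close>
  have "\<forall>\<^sub>F L in at_top. max 4 (2 * l0) \<le> L \<and> exp (- L) \<le> (1 / 4 :: real) \<and> 36 * L\<^sup>2 \<le> exp (sqrt (2 * L)) \<and> 8 * (ln L / L) \<le> (1 :: real)"
  proof (intro eventually_conj)
    show "\<forall>\<^sub>F L in at_top. max 4 (2 * l0) \<le> L" by (rule eventually_ge_at_top)
    show "\<forall>\<^sub>F L in at_top. exp (- L) \<le> (1 / 4 :: real)" by real_asymp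
    show "\<forall>\<^sub>F L in at_top. 36 * L\<^sup>2 \<le> exp (sqrt (2 * L :: real))" by real_asymp
    show "\<forall>\<^sub>F L in at_top. 8 * (ln L / L) \<le> (1 :: real)" by real_asymp
  qed
  then obtain L0 where L0: "\<And>L. L0 \<le> L \<Longrightarrow> max 4 (2 * l0) \<le> L \<and> exp (- L) \<le> (1 / 4 :: real) \<and> 36 * L\<^sup>2 \<le> exp (sqrt (2 * L)) \<and> 8 * (ln L / L) \<le> (1 :: real)"
    unfolding eventually_at_top_linorder by blast
  show ?thesis
  proof (intro exI[of _ L0] allI impI)
    fix n s :: nat and v \<delta> :: real and \<theta> :: "nat \<Rightarrow> real"
    assume s1: "1 \<le> s" and sn: "s \<le> n" and L_ge: "L0 \<le> ln (real n / real s)"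
      and \<delta>L: "1 / ln (real n / real s) \<le> \<delta>" and \<delta>10: "\<delta> \<le> 1 / 10" and \<delta>t: "\<delta> < t"
      and v: "3 * sqrt (ln (1 / \<delta>)) \<le> v" and \<theta>: "\<theta> \<in> signal_class n s v"
    define L where "L = ln (real n / real s)"
    have L: "4 \<le> L" "2 * l0 \<le> L" "exp (- L) \<le> 1 / 4" "36 * L\<^sup>2 \<le> exp (sqrt (2 * L))" "8 * (ln L / L) \<le> 1"
      using L0[OF L_ge] by (auto simp: L_def)
    have n1: "1 \<le> n" using s1 sn by simp
    have s0: "0 < real s" "1 \<le> real s" using s1 by auto
    have \<rho>: "real s / real n = exp (- L)"
      using s1 n1 by (simp add: L_def exp_minus)
    have \<delta>0: "0 < \<delta>" using \<delta>L L by (intro less_le_trans[OF _ \<delta>L]) (simp add: L_def)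
    have \<delta>L': "1 / \<delta> \<le> L"
      using \<delta>L \<delta>0 L by (simp add: L_def[symmetric] field_simps)
    define u where "u = sqrt (ln (1 / \<delta>))"
    have ln\<delta>: "1 \<le> ln (1 / \<delta>)"
    proof -
      have "exp 1 \<le> (1 / \<delta> :: real)"
      proof -
        have "(3::real) \<le> 1 / \<delta>" using \<delta>0 \<delta>10 by (simp add: field_simps)
        then show ?thesis using exp_le by linarith
      qed
      then have "ln (exp 1) \<le> ln (1 / \<delta>)" using \<delta>0 by (subst ln_le_cancel_iff) auto
      then show ?thesis by simp
    qed
    have u: "1 \<le> u" "u\<^sup>2 = ln (1 / \<delta>)" "exp (u\<^sup>2) = 1 / \<delta>" "u\<^sup>2 \<le> ln L"
    proof -
      show "1 \<le> u" unfolding u_def using ln\<delta> by (intro real_le_rsqrt) auto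
      show u2: "u\<^sup>2 = ln (1 / \<delta>)" unfolding u_def using ln\<delta> by (intro real_sqrt_pow2) linarith
      show "exp (u\<^sup>2) = 1 / \<delta>" unfolding u2 using \<delta>0 by (intro exp_ln) simp
      show "u\<^sup>2 \<le> ln L" unfolding u2 using \<delta>0 \<delta>L' L by (subst ln_le_cancel_iff) auto
    qed
    have card_S: "card (signals n \<theta>) = s"
      using \<theta> by (simp add: signal_class_def signals_def)
    have card_N: "real (card (nulls n \<theta>)) = real n - real s"
      by (simp add: card_nulls card_S)
    define N0 where "N0 = real n - real s"
    have sn4: "real s \<le> real n / 4"
      using L(3) n1 unfolding \<rho>[symmetric] by (simp add: field_simps)
    then have N0: "3 / 4 * real n \<le> N0" "N0 \<le> real n" "0 < N0" using s0 by (auto simp: N0_def)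
    \<comment> \<open>The upper end of the intermediate value argument: as
      \<open>w1 * w1 = exp (- L)\<close>, the value there is at least \<open>4 * exp (- L)\<close>,
      above every target \<open>s * x / N0 \<le> 2 * exp (- L)\<close>.\<close>
    define w1 where "w1 = exp (- (L / 2))"
    have w1: "0 < w1" "w1 < 1" "4 * exp (- L) \<le> w1 * null_drift w1"
    proof -
      have "4 * w1 \<le> null_drift w1" unfolding w1_def using l0[of "L / 2"] L by auto
      then have "w1 * (4 * w1) \<le> w1 * null_drift w1" by (intro mult_left_mono) (auto simp: w1_def)
      moreover have "w1 * w1 = exp (- L)" by (simp add: w1_def flip: exp_add)
      ultimately show "4 * exp (- L) \<le> w1 * null_drift w1" by simp
    qed (use L in \<open>auto simp: w1_def\<close>)
    have solve: "\<exists>w. exp (- L) * x / 2 \<le> w \<and> real s * x / N0 \<le> w \<and> w \<le> w1 \<and> N0 * (w * null_drift w) = real s * x"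
      if x: "0 < x" "x \<le> 3 / 2" for x
    proof -
      have "real s * x / N0 \<le> (real s * (3 / 2)) / (3 / 4 * real n)"
        using s0 x N0 n1 by (intro frac_le) auto
      also have "\<dots> = 2 * exp (- L)" unfolding \<rho>[symmetric] by simp
      also have "\<dots> \<le> 4 * exp (- L)" by simp
      also have "\<dots> \<le> w1 * null_drift w1" by (rule w1)
      finally have le: "real s * x / N0 \<le> w1 * null_drift w1" .
      obtain w where w: "real s * x / N0 \<le> w" "w \<le> w1" "w * null_drift w = real s * x / N0"
        using s0 x N0 by (auto intro: weight_equation_solvable[OF _ w1(1,2) le])
      have "exp (- L) * x / 2 \<le> real s * x / real n"
        unfolding \<rho>[symmetric] using x s0 by (simp add: divide_simps)
      also have "\<dots> \<le> real s * x / N0" using s0 x N0 by (intro divide_left_mono) auto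
      finally have "exp (- L) * x / 2 \<le> w" using w(1) by linarith
      moreover have "N0 * (w * null_drift w) = real s * x" unfolding w(3) using N0 by simp
      ultimately show ?thesis using w(1,2) by blast
    qed
    have weight: "\<exists>l. w = exp (- l) \<and> L / 2 \<le> l \<and> l \<le> 2 * L" if w: "exp (- L) / 4 \<le> w" "w \<le> w1" for w
    proof -
      have w0: "0 < w" by (rule less_le_trans[OF _ w(1)]) simp
      have "ln w \<le> - (L / 2)"
        using w0 w(2) by (simp add: w1_def ln_ge_iff[symmetric] flip: ln_le_cancel_iff)
      moreover have "- (2 * L) \<le> ln w"
      proof -
        have "exp (- (2 * L)) = exp (- L) * exp (- L)" by (simp flip: exp_add)
        also have "\<dots> \<le> exp (- L) * (1 / 4)" by (intro mult_left_mono L) simp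
        also have "\<dots> \<le> w" using w by simp
        finally show ?thesis using w0 by (simp add: ln_ge_iff)
      qed
      ultimately show ?thesis using w0 by (intro exI[of _ "- ln w"]) auto
    qed
    \<comment> \<open>In units of \<open>1 / w\<close> the mean pull of the signals is at most
      \<open>s\<close>, and at \<open>wm\<close> at least \<open>s * (1 - 3 * \<delta>)\<close>.
      Prescribing \<open>1 + 2 * \<delta>\<close> and \<open>1 - 5 * \<delta>\<close> for the nulls
      leaves a margin of \<open>2 * \<delta> * s\<close> on either side.\<close>
    obtain wp where wp: "real s * (1 + 2 * \<delta>) / N0 \<le> wp" "exp (- L) * (1 + 2 * \<delta>) / 2 \<le> wp" "wp \<le> w1"
      "N0 * (wp * null_drift wp) = real s * (1 + 2 * \<delta>)"
      using solve[of "1 + 2 * \<delta>"] \<delta>0 \<delta>10 by auto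
    obtain wm where wm: "exp (- L) * (1 - 5 * \<delta>) / 2 \<le> wm" "real s * (1 - 5 * \<delta>) / N0 \<le> wm" "wm \<le> w1"
      "N0 * (wm * null_drift wm) = real s * (1 - 5 * \<delta>)"
      using solve[of "1 - 5 * \<delta>"] \<delta>0 \<delta>10 by auto
    have wp4: "exp (- L) / 4 \<le> wp"
    proof -
      have "exp (- L) * (1 / 2) \<le> exp (- L) * (1 + 2 * \<delta>)"
        using \<delta>0 by (intro mult_left_mono) auto
      then show ?thesis using wp(2) by linarith
    qed
    have wm4: "exp (- L) / 4 \<le> wm"
    proof -
      have "exp (- L) * (1 / 2) \<le> exp (- L) * (1 - 5 * \<delta>)"
        using \<delta>10 by (intro mult_left_mono) auto
      then show ?thesis using wm(1) by linarith
    qed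
    obtain lp where lp: "wp = exp (- lp)" "L / 2 \<le> lp" "lp \<le> 2 * L" using weight[OF wp4 wp(3)] by auto
    obtain lm where lm: "wm = exp (- lm)" "L / 2 \<le> lm" "lm \<le> 2 * L" using weight[OF wm4 wm(3)] by auto
    have wp01: "0 < wp" "wp \<le> 1" and wm01: "0 < wm" "wm \<le> 1"
      using wp4 wm4 wp(3) wm(3) w1(2) exp_gt_zero[of "- L"] by linarith+
    define P where "P = 1 / (real s * \<delta>\<^sup>2)"
    have P_s: "1 / real s \<le> P"
    proof -
      have "\<delta>\<^sup>2 \<le> 1" using \<delta>0 \<delta>10 by (intro power_le_one) auto
      then have "real s * \<delta>\<^sup>2 \<le> real s * 1" using s0 by (intro mult_left_mono) auto
      then show ?thesis unfolding P_def using s0 \<delta>0 by (intro divide_left_mono) auto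
    qed
    \<comment> \<open>As \<open>\<delta> \<le> 1 / 10\<close>, both prescribed pulls are at most
      \<open>3 / 2 * s\<close>, so the numerator is at most \<open>4 * s\<close>.\<close>
    have chebyshev: "(real s + 2 * D) / (2 * \<delta> * real s)\<^sup>2 \<le> P" if "D \<le> real s * (3 / 2)" for D
    proof -
      have "(real s + 2 * D) / (2 * \<delta> * real s)\<^sup>2 \<le> (4 * real s) / (2 * \<delta> * real s)\<^sup>2"
        using that by (intro divide_right_mono) auto
      also have "\<dots> = P" using s0 \<delta>0 by (simp add: P_def power2_eq_square field_simps)
      finally show ?thesis .
    qed
    have prob_gt: "noise.prob n {e \<in> space (noise n). wp < fitted_weight n \<theta> e} \<le> P"
    proof -
      have "1 / real n \<le> real s * (1 + 2 * \<delta>) / N0"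
        using s0 \<delta>0 N0 n1 mult_mono[of 1 "real s" 1 "1 + 2 * \<delta>"] by (intro frac_le) auto
      then have "1 / real n \<le> wp" using wp(1) by linarith
      moreover have "real s * 1 < real s * (1 + 2 * \<delta>)" using s0 \<delta>0 by (intro mult_strict_left_mono) auto
      ultimately have "noise.prob n {e \<in> space (noise n). wp < fitted_weight n \<theta> e}
          \<le> (real s + 2 * (real s * (1 + 2 * \<delta>))) / (real s * (1 + 2 * \<delta>) - real s)\<^sup>2"
        using prob_fitted_weight_gt[OF n1 _ wp01(2), of \<theta>]
        unfolding card_N card_S N0_def[symmetric] wp(4) by simp
      also have "real s * (1 + 2 * \<delta>) - real s = 2 * \<delta> * real s" by (simp add: algebra_simps)
      finally show ?thesis using chebyshev[of "real s * (1 + 2 * \<delta>)"] \<delta>10 s0 by simp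
    qed
    define y where "y = sqrt (2 * L) + u"
    have y1: "1 \<le> y" using u L by (simp add: y_def add_increasing)
    have big: "1 / \<delta> \<le> wm * (lik_ratio y - 1)"
    proof -
      \<comment> \<open>\<open>wm(1)\<close> would give only a quarter of \<open>exp (- L)\<close>;
        the bound with \<open>N0 \<le> n\<close> in the denominator gives the half that
        \<open>strong_signal_location\<close> asks for.\<close>
      have "exp (- L) / 2 \<le> wm"
      proof -
        have "exp (- L) / 2 = real s * (1 / 2) / real n" unfolding \<rho>[symmetric] by simp
        also have "\<dots> \<le> real s * (1 - 5 * \<delta>) / N0"
          using s0 \<delta>10 N0 by (intro frac_le mult_left_mono) auto
        finally show ?thesis using wm(2) by linarith
      qed
      then show ?thesis
        unfolding u(3)[symmetric] y_def using L u by (intro strong_signal_location) auto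
    qed
    \<comment> \<open>The signal exceeds \<open>sqrt (2 * L)\<close> by at least
      \<open>3 * u\<close>. One \<open>u\<close> is spent on reaching \<open>y\<close>; the other
      two absorb the noise, with failure probability
      \<open>exp (- 2 * u\<^sup>2) \<le> \<delta>\<close>. This is where the 3 in the condition on
      \<open>v\<close> is used.\<close>
    have small: "gauss_prob.prob {x. \<bar>\<theta> i + x\<bar> < y} \<le> \<delta>" if i: "i \<in> signals n \<theta>" for i
    proof -
      have "sqrt (2 * L) + v \<le> \<bar>\<theta> i\<bar>"
        using \<theta> i by (auto simp: signal_class_def signals_def L_def)
      moreover have "3 * u \<le> v" using v by (simp add: u_def)
      ultimately have "gauss_prob.prob {x. \<bar>\<theta> i + x\<bar> < y} \<le> exp (- (2 * u)\<^sup>2 / 2)"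
        using u(1) by (intro prob_small_observation) (auto simp: y_def)
      also have "\<dots> \<le> exp (- u\<^sup>2)" by (simp add: power_mult_distrib)
      also have "\<dots> = \<delta>" using u(3) \<delta>0 by (simp add: exp_minus)
      finally show ?thesis .
    qed
    have prob_lt: "noise.prob n {e \<in> space (noise n). fitted_weight n \<theta> e < wm} \<le> P"
    proof -
      have sig: "(1 - 3 * \<delta>) / wm \<le> (\<integral>x. score_term wm (\<theta> i + x) \<partial>gauss_measure)" if "i \<in> signals n \<theta>" for i
        using y1 by (intro strong_signal_score[OF wm01 \<delta>0 _ big small[OF that]]) auto
      have "real s * (1 - 5 * \<delta>) < real s * (1 - 3 * \<delta>)" using s0 \<delta>0 by (intro mult_strict_left_mono) auto
      then have "noise.prob n {e \<in> space (noise n). fitted_weight n \<theta> e < wm}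
          \<le> (real s + 2 * (real s * (1 - 5 * \<delta>))) / (real s * (1 - 3 * \<delta>) - real s * (1 - 5 * \<delta>))\<^sup>2"
        using prob_fitted_weight_lt[where \<theta>=\<theta> and \<kappa>="1 - 3 * \<delta>", OF n1 wm01 sig]
        unfolding card_N card_S N0_def[symmetric] wm(4) by simp
      also have "real s * (1 - 3 * \<delta>) - real s * (1 - 5 * \<delta>) = 2 * \<delta> * real s" by (simp add: algebra_simps)
      finally show ?thesis using chebyshev[of "real s * (1 - 5 * \<delta>)"] \<delta>0 s0 by simp
    qed
    have FNR: "q_FNR n t \<theta> \<le> \<delta> + P"
    proof -
      have "gauss_prob.prob {x. \<not> q_value wm (\<theta> i + x) < t} \<le> \<delta>" if i: "i \<in> signals n \<theta>" for i
      proof -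
        have "gauss_prob.prob {x. \<not> q_value wm (\<theta> i + x) < t} \<le> gauss_prob.prob {x. \<bar>\<theta> i + x\<bar> < y}"
          using strong_signal_reject[OF wm01 t \<delta>0 \<delta>t y1 big]
          by (intro gauss_prob.finite_measure_mono) (force simp: not_less[symmetric])+
        then show ?thesis using small[OF i] by linarith
      qed
      then have "q_FNR n t \<theta> \<le> \<delta> + noise.prob n {e \<in> space (noise n). fitted_weight n \<theta> e < wm}"
        using s1 by (intro FNR_upper n1 t wm01) (auto simp: card_S)
      then show ?thesis using prob_lt by linarith
    qed
    define Q where "Q = ln L / L"
    have Q: "0 \<le> Q" "8 * Q \<le> 1" using L by (auto simp: Q_def)
    have upper: "q_FDR n t \<theta> \<le> t + 8 * Q + 5 * \<delta> + 2 * P"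
    proof -
      define \<mu> where "\<mu> = N0 * null_reject t wp"
      have "\<mu> \<le> N0 * ((1 + 2 * (ln lp / lp)) * (t / (1 - t)) * (wp * null_drift wp))"
        unfolding \<mu>_def lp(1) using l0[of lp] lp L N0 by (intro mult_left_mono) auto
      also have "\<dots> = (1 + 2 * (ln lp / lp)) * (t / (1 - t)) * (N0 * (wp * null_drift wp))"
        by (simp add: mult_ac)
      also have "\<dots> = (1 + 2 * (ln lp / lp)) * (t / (1 - t)) * (real s * (1 + 2 * \<delta>))"
        by (simp only: wp(4))
      also have "\<dots> \<le> (1 + 8 * Q) * (t / (1 - t)) * (real s * (1 + 2 * \<delta>))"
        using log_over_self_compare(2)[OF L(1) lp(2,3)] t \<delta>0 unfolding Q_def
        by (intro mult_right_mono) auto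
      finally have "\<mu> \<le> ((1 + 8 * Q) * (1 + 2 * \<delta>)) * (t / (1 - t)) * real s"
        by (simp add: mult_ac)
      moreover have "0 \<le> \<mu>" using N0 by (simp add: \<mu>_def null_reject_def)
      ultimately have "\<mu> / (\<mu> + real s) \<le> t + 8 * Q + 4 * \<delta>"
        using t Q \<delta>0 s0 by (intro limiting_fraction_upper) auto
      moreover have "q_FDR n t \<theta> \<le> \<mu> / (\<mu> + real s)
          + noise.prob n {e \<in> space (noise n). wp < fitted_weight n \<theta> e} + q_FNR n t \<theta>"
        using FDR_upper[OF n1 _ t wp01, of \<theta>] s1 unfolding card_N card_S \<mu>_def N0_def by simp
      ultimately show ?thesis using prob_gt FNR by linarith
    qed
    have lower: "t + t * (1 - t) / 96 * Q - 5 * \<delta> - 2 * P \<le> q_FDR n t \<theta>"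
    proof -
      define \<mu> where "\<mu> = N0 * null_reject t wm"
      \<comment> \<open>\<open>1 / 48\<close> is the \<open>1 / 12\<close> of
        \<open>eventually_null_reject_lower\<close> with the factor 4 of
        \<open>log_over_self_compare\<close>; \<open>limiting_fraction_lower\<close> halves it to
        \<open>1 / 96\<close>.\<close>
      have "((1 + 1 / 48 * Q) * (1 - 5 * \<delta>)) * (t / (1 - t)) * real s
          = (1 + 1 / 12 * (Q / 4)) * (t / (1 - t)) * (real s * (1 - 5 * \<delta>))"
        by (simp add: mult_ac)
      also have "\<dots> \<le> (1 + 1 / 12 * (ln lm / lm)) * (t / (1 - t)) * (real s * (1 - 5 * \<delta>))"
        using log_over_self_compare(1)[OF L(1) lm(2,3)] t \<delta>10 unfolding Q_def
        by (intro mult_right_mono) auto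
      also have "\<dots> = (1 + 1 / 12 * (ln lm / lm)) * (t / (1 - t)) * (N0 * (wm * null_drift wm))"
        by (simp only: wm(4))
      also have "\<dots> = N0 * ((1 + 1 / 12 * (ln lm / lm)) * (t / (1 - t)) * (wm * null_drift wm))"
        by (simp add: mult_ac)
      also have "\<dots> \<le> \<mu>"
        unfolding \<mu>_def lm(1) using l0[of lm] lm L N0 by (intro mult_left_mono) auto
      finally have "t + t * (1 - t) / 2 * (1 / 48 * Q) - 5 * \<delta> \<le> \<mu> / (\<mu> + real s)"
        using t Q \<delta>0 \<delta>10 s0 by (intro limiting_fraction_lower) auto
      moreover have "\<mu> / (\<mu> + real s) - 1 / real s - noise.prob n {e \<in> space (noise n). fitted_weight n \<theta> e < wm}
          \<le> q_FDR n t \<theta>"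
        using FDR_lower[OF n1 _ t wm01, of \<theta>] s1 unfolding card_N card_S \<mu>_def N0_def by simp
      ultimately show ?thesis using prob_lt P_s by simp
    qed
    show "error_bounds t n s \<delta> \<theta>"
    proof -
      have "0 \<le> P" using s0 by (simp add: P_def)
      then show ?thesis
        using upper lower FNR unfolding error_bounds_def L_def[symmetric] Q_def[symmetric] P_def[symmetric] by auto
    qed
  qed
qed

section \<open>Passage to sequences and suprema\<close>

lemma FNR_nonneg: "0 \<le> FNR n \<phi> \<theta>"
  unfolding FNR_def by (intro Bochner_Integration.integral_nonneg divide_nonneg_nonneg sum_nonneg) auto

text \<open>The supremum of the empty set of reals carries no information, so bounds on suprema over
  the class require a member.\<close>

lemma signal_class_nonempty:
  assumes "s \<le> n"
  shows "signal_class n s v \<noteq> {}"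
proof -
  \<comment> \<open>The \<open>max 1\<close> keeps the signals nonzero even if the required size is
    zero or negative.\<close>
  define a where "a = max 1 (sqrt (2 * ln (real n / real s)) + v)"
  define \<theta> where "\<theta> = (\<lambda>i\<in>{1..n}. if i \<le> s then a else 0)"
  have a: "a \<noteq> 0" "sqrt (2 * ln (real n / real s)) + v \<le> \<bar>a\<bar>" by (auto simp: a_def)
  have "{i \<in> {1..n}. \<theta> i \<noteq> 0} = {1..s}"
    using a assms by (auto simp: \<theta>_def)
  moreover have "\<theta> \<in> {1..n} \<rightarrow>\<^sub>E UNIV" by (auto simp: \<theta>_def)
  moreover have "\<forall>i\<in>{1..s}. sqrt (2 * ln (real n / real s)) + v \<le> \<bar>\<theta> i\<bar>"
    using a assms by (auto simp: \<theta>_def)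
  ultimately have "\<theta> \<in> {1..n} \<rightarrow>\<^sub>E UNIV \<and> card {i \<in> {1..n}. \<theta> i \<noteq> 0} = s \<and>
      (\<forall>i\<in>{i \<in> {1..n}. \<theta> i \<noteq> 0}. sqrt (2 * ln (real n / real s)) + v \<le> \<bar>\<theta> i\<bar>)"
    by (simp only: card_atLeastAtMost) simp
  then have "\<theta> \<in> signal_class n s v" unfolding signal_class_def by blast
  then show ?thesis by blast
qed

lemma SUP_tendsto_0:
  fixes f :: "nat \<Rightarrow> 'a \<Rightarrow> real"
  assumes ne: "\<forall>\<^sub>F n in sequentially. A n \<noteq> {}" and nonneg: "\<And>n x. 0 \<le> f n x"
    and bnd: "\<And>e. 0 < e \<Longrightarrow> \<forall>\<^sub>F n in sequentially. \<forall>x\<in>A n. f n x \<le> e"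
  shows "(\<lambda>n. SUP x\<in>A n. f n x) \<longlonglongrightarrow> 0"
proof (rule tendstoI)
  fix e :: real assume e: "0 < e"
  have "\<forall>\<^sub>F n in sequentially. \<forall>x\<in>A n. f n x \<le> e / 2" using e by (intro bnd) simp
  with ne show "\<forall>\<^sub>F n in sequentially. dist (SUP x\<in>A n. f n x) 0 < e"
  proof eventually_elim
    case (elim n)
    have "(SUP x\<in>A n. f n x) \<le> e / 2"
      using elim by (intro cSUP_least) auto
    moreover obtain x where "x \<in> A n" using elim by blast
    then have "f n x \<le> (SUP x\<in>A n. f n x)"
      using elim by (intro cSUP_upper) (auto intro!: bdd_aboveI[of _ "e / 2"])
    with nonneg[of n x] have "0 \<le> (SUP x\<in>A n. f n x)" by linarith
    ultimately show ?case using e by simp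
  qed
qed

lemma sparse_log_at_top:
  fixes s :: "nat \<Rightarrow> nat"
  assumes pos: "\<forall>n\<ge>1. 0 < s n" and lim: "(\<lambda>n. real (s n) / real n) \<longlonglongrightarrow> 0"
  shows "filterlim (\<lambda>n. ln (real n / real (s n))) at_top sequentially"
proof -
  have "\<forall>\<^sub>F n in sequentially. 0 < real (s n) / real n"
    using eventually_ge_at_top[of 1] by eventually_elim (use pos in auto)
  with lim have "filterlim (\<lambda>n. inverse (real (s n) / real n)) at_top sequentially"
    by (rule filterlim_inverse_at_top)
  then have "filterlim (\<lambda>n. real n / real (s n)) at_top sequentially" by simp
  then show ?thesis by (rule filterlim_compose[OF ln_at_top])
qed

lemma sparse_eventually_le:
  fixes s :: "nat \<Rightarrow> nat"
  assumes lim: "(\<lambda>n. real (s n) / real n) \<longlonglongrightarrow> 0"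
  shows "\<forall>\<^sub>F n in sequentially. s n \<le> n"
proof -
  have "\<forall>\<^sub>F n in sequentially. real (s n) / real n < 1"
    using order_tendstoD(2)[OF lim, of 1] by simp
  then show ?thesis
    using eventually_ge_at_top[of 1] by eventually_elim (simp add: divide_less_eq)
qed

lemma uniform_error_bounds:
  fixes s :: "nat \<Rightarrow> nat" and v :: "nat \<Rightarrow> real"
  assumes t: "0 < t" "t < 1"
    and pos: "\<forall>n\<ge>1. 0 < s n" and s_lim: "filterlim s at_top sequentially"
    and sparse: "(\<lambda>n. real (s n) / real n) \<longlonglongrightarrow> 0" and v_lim: "filterlim v at_top sequentially"
    and e: "0 < e"
  shows "\<forall>\<^sub>F n in sequentially. \<forall>\<theta>\<in>signal_class n (s n) (v n).
    \<bar>q_FDR n t \<theta> - t\<bar> \<le> e \<and> q_FNR n t \<theta> \<le> e"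
proof -
  obtain L0 where L0: "\<And>n s v \<delta> \<theta>. \<lbrakk>1 \<le> s; s \<le> n; L0 \<le> ln (real n / real s); 1 / ln (real n / real s) \<le> \<delta>;
      \<delta> \<le> 1 / 10; \<delta> < t; 3 * sqrt (ln (1 / \<delta>)) \<le> v; \<theta> \<in> signal_class n s v\<rbrakk> \<Longrightarrow>
    error_bounds t n s \<delta> \<theta>"
    using error_bounds_eventually[OF t] by blast
  \<comment> \<open>With \<delta> fixed and \<open>s\<close> large, both \<open>\<delta>\<close> and
    \<open>1 / (s * \<delta>\<^sup>2)\<close> are at most \<open>e / 20\<close>; five times their
    sum is \<open>e / 2\<close> at most, and the bias takes another \<open>e / 4\<close>.\<close>
  define \<delta> where "\<delta> = min (1 / 10) (min (t / 2) (e / 20))"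
  have \<delta>: "0 < \<delta>" "\<delta> \<le> 1 / 10" "\<delta> < t" "\<delta> \<le> e / 20" using t e by (auto simp: \<delta>_def)
  note L_lim = sparse_log_at_top[OF pos sparse]
  have "\<forall>\<^sub>F L in at_top. max 1 (max L0 (1 / \<delta>)) \<le> L \<and> 8 * (ln L / L) \<le> e / 4"
  proof (intro eventually_conj)
    show "\<forall>\<^sub>F L in at_top. max 1 (max L0 (1 / \<delta>)) \<le> L" by (rule eventually_ge_at_top)
    have "((\<lambda>L::real. 8 * (ln L / L)) \<longlongrightarrow> 0) at_top" by real_asymp
    from order_tendstoD(2)[OF this, of "e / 4"] show "\<forall>\<^sub>F L in at_top. 8 * (ln L / L) \<le> e / 4"
      using e by (auto elim: eventually_mono)
  qed
  then have "\<forall>\<^sub>F n in sequentially. max 1 (max L0 (1 / \<delta>)) \<le> ln (real n / real (s n)) \<and>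
      8 * (ln (ln (real n / real (s n))) / ln (real n / real (s n))) \<le> e / 4"
    using L_lim by (rule eventually_compose_filterlim)
  moreover have "\<forall>\<^sub>F n in sequentially. 3 * sqrt (ln (1 / \<delta>)) \<le> v n"
    using v_lim unfolding filterlim_at_top by blast
  moreover have "\<forall>\<^sub>F n in sequentially. 20 / (e * \<delta>\<^sup>2) \<le> real (s n)"
    using filterlim_compose[OF filterlim_real_sequentially s_lim] unfolding filterlim_at_top by blast
  moreover have "\<forall>\<^sub>F n in sequentially. 1 \<le> n" by (rule eventually_ge_at_top)
  moreover note sparse_eventually_le[OF sparse]
  ultimately show ?thesis
  proof eventually_elim
    case (elim n)
    define L where "L = ln (real n / real (s n))"
    have L: "1 \<le> L" "L0 \<le> L" "1 / \<delta> \<le> L" "8 * (ln L / L) \<le> e / 4" using elim by (auto simp: L_def)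
    have s1: "1 \<le> s n" using pos elim by (auto simp: Suc_le_eq)
    have d: "1 / L \<le> \<delta>" using L \<delta> by (simp add: field_simps)
    have P: "1 / (real (s n) * \<delta>\<^sup>2) \<le> e / 20"
    proof -
      have "20 / (e * \<delta>\<^sup>2) * (e * \<delta>\<^sup>2) \<le> real (s n) * (e * \<delta>\<^sup>2)"
        using elim e \<delta> by (intro mult_right_mono) auto
      then have "20 \<le> real (s n) * \<delta>\<^sup>2 * e" using e \<delta> by (simp add: mult_ac)
      then show ?thesis using s1 e \<delta> by (simp add: field_simps)
    qed
    show ?case
    proof
      fix \<theta> assume "\<theta> \<in> signal_class n (s n) (v n)"
      from L0[OF s1 elim(5) L(2)[unfolded L_def] d[unfolded L_def] \<delta>(2,3) elim(2) this]
      have *: "t * (1 - t) / 96 * (ln L / L) - 5 * (\<delta> + 1 / (real (s n) * \<delta>\<^sup>2))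
          \<le> q_FDR n t \<theta> - t"
        "q_FDR n t \<theta> - t \<le> 8 * (ln L / L) + 5 * (\<delta> + 1 / (real (s n) * \<delta>\<^sup>2))"
        "q_FNR n t \<theta> \<le> \<delta> + 1 / (real (s n) * \<delta>\<^sup>2)"
        by (auto simp: L_def error_bounds_def)
      define p where "p = 1 / (real (s n) * \<delta>\<^sup>2)"
      have "0 \<le> t * (1 - t) / 96 * (ln L / L)" using t L by simp
      then show "\<bar>q_FDR n t \<theta> - t\<bar> \<le> e \<and> q_FNR n t \<theta> \<le> e"
        using *[folded p_def] P[folded p_def] L(4) \<delta>(4) e by (auto simp: abs_le_iff)
    qed
  qed
qed

text \<open>The choice \<open>\<delta> = 1 / L\<close> turns all errors other than the bias into at
  most \<open>10 / L\<close>. Since \<open>1 / L \<le> ln L / L\<close>, this gives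
  \<open>18 = 8 + 10\<close> above, and 2 for the FNR.\<close>

lemma uniform_error_rates:
  fixes s :: "nat \<Rightarrow> nat" and v :: "nat \<Rightarrow> real"
  assumes t: "0 < t" "t < 1"
    and pos: "\<forall>n\<ge>1. 0 < s n"
    and sparse: "(\<lambda>n. real (s n) / real n) \<longlonglongrightarrow> 0"
    and s_large: "\<forall>\<^sub>F n in sequentially. real (s n) \<ge> ln (real n) ^ 3"
    and v_large: "\<forall>\<^sub>F n in sequentially. v n \<ge> 3 * sqrt (ln (ln (real n / real (s n))))"
  shows "\<forall>\<^sub>F n in sequentially. \<forall>\<theta>\<in>signal_class n (s n) (v n).
    t * (1 - t) / 192 * (ln (ln (real n / real (s n))) / ln (real n / real (s n)))
      \<le> q_FDR n t \<theta> - t \<and>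
    q_FDR n t \<theta> - t
      \<le> 18 * (ln (ln (real n / real (s n))) / ln (real n / real (s n))) \<and>
    q_FNR n t \<theta> \<le> 2 * inverse (ln (real n / real (s n)))"
proof -
  obtain L0 where L0: "\<And>n s v \<delta> \<theta>. \<lbrakk>1 \<le> s; s \<le> n; L0 \<le> ln (real n / real s); 1 / ln (real n / real s) \<le> \<delta>;
      \<delta> \<le> 1 / 10; \<delta> < t; 3 * sqrt (ln (1 / \<delta>)) \<le> v; \<theta> \<in> signal_class n s v\<rbrakk> \<Longrightarrow>
    error_bounds t n s \<delta> \<theta>"
    using error_bounds_eventually[OF t] by blast
  \<comment> \<open>Half of the coefficient in \<open>error_bounds\<close>; the other half absorbs
    \<open>10 / L\<close> as soon as \<open>ln L \<ge> 10 / c\<close>.\<close>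
  define c where "c = t * (1 - t) / 192"
  have c: "0 < c" using t by (simp add: c_def)
  have "\<forall>\<^sub>F L in at_top. max (max 10 (2 / t)) L0 \<le> L \<and> max 1 (10 / c) \<le> ln (L::real)"
  proof (intro eventually_conj)
    show "\<forall>\<^sub>F L in at_top. max 1 (10 / c) \<le> ln (L::real)"
      using ln_at_top unfolding filterlim_at_top by blast
  qed (rule eventually_ge_at_top)
  then have "\<forall>\<^sub>F n in sequentially. max (max 10 (2 / t)) L0 \<le> ln (real n / real (s n)) \<and>
      max 1 (10 / c) \<le> ln (ln (real n / real (s n)))"
    using sparse_log_at_top[OF pos sparse] by (rule eventually_compose_filterlim)
  moreover have "\<forall>\<^sub>F n in sequentially. 1 \<le> n" by (rule eventually_ge_at_top)
  moreover note sparse_eventually_le[OF sparse] s_large v_large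
  ultimately show ?thesis
  proof eventually_elim
    case (elim n)
    define L where "L = ln (real n / real (s n))"
    have L: "10 \<le> L" "2 / t \<le> L" "L0 \<le> L" "1 \<le> ln L" "10 / c \<le> ln L" using elim(1) by (auto simp: L_def)
    have s1: "1 \<le> s n" using pos elim by (auto simp: Suc_le_eq)
    \<comment> \<open>This is where \<open>s \<ge> (ln n) ^ 3\<close> enters: it gives
      \<open>s \<ge> L ^ 3\<close>, exactly what makes the Chebyshev error as small as
      \<delta>.\<close>
    have P: "1 / (real (s n) * (1 / L)\<^sup>2) \<le> 1 / L"
    proof -
      have "real n / real (s n) \<le> real n / 1"
        using s1 by (intro divide_left_mono) auto
      then have "L \<le> ln (real n)"
        unfolding L_def using s1 elim(2) by (subst ln_le_cancel_iff) auto
      then have "L ^ 3 \<le> ln (real n) ^ 3" using L by (intro power_mono) auto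
      then have "L ^ 3 \<le> real (s n)" using elim(4) by linarith
      then show ?thesis
        using L s1 by (simp add: divide_simps power2_eq_square power3_eq_cube mult_ac)
    qed
    have dt: "1 / L < t"
    proof -
      have "2 \<le> L * t" using L(2) t by (simp add: divide_le_eq)
      then have "1 < t * L" by (simp add: mult.commute)
      then show ?thesis using L(1) by (simp add: divide_less_eq)
    qed
    have v': "3 * sqrt (ln (1 / (1 / L))) \<le> v n" using elim(5) by (simp add: L_def)
    have Q: "10 * (1 / L) \<le> c * (ln L / L)" "1 / L \<le> ln L / L"
    proof -
      have "10 \<le> c * ln L" using L(5) c by (simp add: divide_le_eq mult.commute)
      then have "10 / L \<le> c * ln L / L" using L by (intro divide_right_mono) auto
      then show "10 * (1 / L) \<le> c * (ln L / L)" by simp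
      show "1 / L \<le> ln L / L" using L by (intro divide_right_mono) auto
    qed
    show ?case
    proof
      fix \<theta> assume "\<theta> \<in> signal_class n (s n) (v n)"
      from L0[OF s1 elim(3) L(3)[unfolded L_def] _ _ dt v' this] L(1)
      have *: "2 * c * (ln L / L) - 5 * (1 / L + 1 / (real (s n) * (1 / L)\<^sup>2))
          \<le> q_FDR n t \<theta> - t"
        "q_FDR n t \<theta> - t \<le> 8 * (ln L / L) + 5 * (1 / L + 1 / (real (s n) * (1 / L)\<^sup>2))"
        "q_FNR n t \<theta> \<le> 1 / L + 1 / (real (s n) * (1 / L)\<^sup>2)"
        by (simp_all add: error_bounds_def L_def[symmetric] c_def)
      define p where "p = 1 / (real (s n) * (1 / L)\<^sup>2)"
      have "c * (ln L / L) \<le> q_FDR n t \<theta> - t"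
      proof -
        have "2 * x - 5 * (q + p) \<le> F \<Longrightarrow> p \<le> q \<Longrightarrow> 10 * q \<le> x \<Longrightarrow> x \<le> F" for x F q :: real
          by argo
        from this[OF _ P[folded p_def] Q(1)] *(1)[folded p_def] show ?thesis
          by (simp only: mult.assoc)
      qed
      moreover have "q_FDR n t \<theta> - t \<le> 18 * (ln L / L)"
      proof -
        have "F \<le> 8 * x + 5 * (q + p) \<Longrightarrow> p \<le> q \<Longrightarrow> q \<le> x \<Longrightarrow> F \<le> 18 * x" for x F q :: real
          by argo
        from this[OF *(2)[folded p_def] P[folded p_def] Q(2)] show ?thesis .
      qed
      moreover have "q_FNR n t \<theta> \<le> 2 * inverse L"
        using *(3) P by (simp add: inverse_eq_divide)
      ultimately show "t * (1 - t) / 192 * (ln (ln (real n / real (s n))) / ln (real n / real (s n)))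
          \<le> q_FDR n t \<theta> - t \<and>
        q_FDR n t \<theta> - t
          \<le> 18 * (ln (ln (real n / real (s n))) / ln (real n / real (s n))) \<and>
        q_FNR n t \<theta> \<le> 2 * inverse (ln (real n / real (s n)))"
        by (simp only: L_def c_def)
    qed
  qed
qed

theorem theorem3:
  fixes t :: real
  assumes "0 < t" and "t < 1"
  shows
    "(\<forall>(s :: nat \<Rightarrow> nat) (v :: nat \<Rightarrow> real).
        (\<forall>n\<ge>1. 0 < s n) \<longrightarrow> filterlim s at_top sequentially \<longrightarrow>
        (\<lambda>n. real (s n) / real n) \<longlonglongrightarrow> 0 \<longrightarrow> filterlim v at_top sequentially \<longrightarrow>
        (\<lambda>n. SUP \<theta>\<in>signal_class n (s n) (v n). \<bar>FDR n (q_value_procedure n t) \<theta> - t\<bar>)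
          \<longlonglongrightarrow> 0 \<and>
        (\<lambda>n. SUP \<theta>\<in>signal_class n (s n) (v n). FNR n (q_value_procedure n t) \<theta>)
          \<longlonglongrightarrow> 0) \<and>
     (\<exists>c>0. \<exists>C>0. \<exists>C'>0. \<forall>(s :: nat \<Rightarrow> nat) (v :: nat \<Rightarrow> real).
        (\<forall>n\<ge>1. 0 < s n) \<longrightarrow> filterlim s at_top sequentially \<longrightarrow>
        (\<lambda>n. real (s n) / real n) \<longlonglongrightarrow> 0 \<longrightarrow> filterlim v at_top sequentially \<longrightarrow>
        (\<forall>\<^sub>F n in sequentially. real (s n) \<ge> ln (real n) ^ 3) \<longrightarrow>
        (\<forall>\<^sub>F n in sequentially. v n \<ge> 3 * sqrt (ln (ln (real n / real (s n))))) \<longrightarrow>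
        (\<forall>\<^sub>F n in sequentially. \<forall>\<theta>\<in>signal_class n (s n) (v n).
           c * (ln (ln (real n / real (s n))) / ln (real n / real (s n)))
             \<le> FDR n (q_value_procedure n t) \<theta> - t \<and>
           FDR n (q_value_procedure n t) \<theta> - t
             \<le> C * (ln (ln (real n / real (s n))) / ln (real n / real (s n))) \<and>
           FNR n (q_value_procedure n t) \<theta> \<le> C' * inverse (ln (real n / real (s n)))))"
proof (intro conjI allI impI, goal_cases)
  case (1 s v)
  show ?case
  proof (rule SUP_tendsto_0)
    show "\<forall>\<^sub>F n in sequentially. signal_class n (s n) (v n) \<noteq> {}"
      by (rule eventually_mono[OF sparse_eventually_le[OF 1(3)] signal_class_nonempty])
    fix e :: real assume "0 < e"
    from uniform_error_bounds[OF assms 1 this]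
    show "\<forall>\<^sub>F n in sequentially. \<forall>\<theta>\<in>signal_class n (s n) (v n). \<bar>q_FDR n t \<theta> - t\<bar> \<le> e"
      by eventually_elim blast
  qed simp
next
  case (2 s v)
  show ?case
  proof (rule SUP_tendsto_0[OF _ FNR_nonneg])
    show "\<forall>\<^sub>F n in sequentially. signal_class n (s n) (v n) \<noteq> {}"
      by (rule eventually_mono[OF sparse_eventually_le[OF 2(3)] signal_class_nonempty])
    fix e :: real assume "0 < e"
    from uniform_error_bounds[OF assms 2 this]
    show "\<forall>\<^sub>F n in sequentially. \<forall>\<theta>\<in>signal_class n (s n) (v n). q_FNR n t \<theta> \<le> e"
      by eventually_elim blast
  qed
next
  case 3
  show ?case
  proof (rule exI[of _ "t * (1 - t) / 192"], intro conjI, goal_cases)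
    case 2
    show ?case
      by (rule exI[of _ 18], intro conjI, simp, rule exI[of _ 2], intro conjI, simp,
          intro allI impI, rule uniform_error_rates[OF assms])
  qed (use assms in simp)
qed

end
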